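(* Let $(S_n)_{n\ge 0}$ be an ERWG process with any memory matrix $B$ (not necessarily diagonalisable). If $\eta<\frac12$ then $$\frac{S_n}{\sqrt n}\xrightarrow{d}\mathcal{N}_k(0,\Sigma^{(1)}),\qquad \Sigma^{(1)}=\int_0^\infty e^{(B-\frac12I)'t}e^{(B-\frac12I)t}\,dt,$$ and if $\eta=\frac12$ then $$\frac{S_n}{\sqrt n(\log n)^{\nu-\frac12}}\xrightarrow{d}\mathcal{N}_k(0,\Sigma^{(3)}),\qquad \Sigma^{(3)}:=\lim_{n\to\infty}\frac{1}{(\log n)^{2\nu-1}}\int_0^{\log n}e^{(B-\frac12I)'t}e^{(B-\frac12I)t}\,dt.$$
   Context: ERWG model. Let $k\ge1$, $V=\{1,\dots,k\}$, and let $(V,\overrightarrow{E})$, $\overrightarrow{E}\subseteq V\times V$, be a directed graph (self-loops allowed) in which every vertex $j$ has in-degree $d_j^{\rm in}=|\{i:(i,j)\in\overrightarrow{E}\}|\ge1$. Let $p_v,q_v\in[0,1]$ for $v\in V$. $\mathrm{Rad}(p)$ is the law on $\{-1,1\}$ giving mass $p$ to $1$. Let $\{\sigma^{(v)},\xi_n^{(v)},D_n^{(v)},u_n^{(v)}: n\ge1,v\in V\}$ be independent with $\sigma^{(v)}\sim\mathrm{Rad}(q_v)$, $\xi_n^{(v)}\sim\mathrm{Rad}(p_v)$, $D_n^{(v)}\sim\mathrm{Unif}\{1,\dots,n\}$, $u_n^{(v)}\sim\mathrm{Unif}\{v':(v',v)\in\overrightarrow{E}\}$. Define $X_1^{(v)}=\sigma^{(v)}$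 and, for $n\ge1$, $X_{n+1}^{(v)}=\xi_n^{(v)}X^{(u_n^{(v)})}_{D_n^{(v)}}$; set $X_n=(X_n^{(1)},\dots,X_n^{(k)})$, $S_0=0$, $S_n=\sum_{j=1}^nX_j$. The process $(S_n)$ is called the ERWG process. Its memory matrix is the $k\times k$ matrix $B$ with $B_{i,j}=\frac{2p_j-1}{d_j^{\rm in}}\mathbf{1}_{\{(i,j)\in\overrightarrow{E}\}}$, and $\eta$ is the maximum of the real parts of the eigenvalues of $B$. All vectors are row vectors; $A'$ is the transpose of $A$ and $I$ the identity. Definition of $\nu$. Let $\lambda_1,\dots,\lambda_s$ be the distinct eigenvalues of $B$, so that $1-\lambda_1,\dots,1-\lambda_s$ are the distinct eigenvalues of $\mathbf{H}=I-B$. Write the Jordan canonical form $\mathbf{T}^{-1}\mathbf{H}\mathbf{T}=\mathrm{diag}(\mathbf{J}_1,\dots,\mathbf{J}_s)$, where $\mathbf{J}_t$ is the $\nu_t\times\nu_t$ Jordan part belonging to the eigenvalue $1-\lambda_t$ (so $\nu_t$ is the algebraic multiplicity of $1-\lambda_t$). Set $\nu=\max\{\nu_t:\Re(\lambda_t)=\eta\}$. A degenerate (possibly zero) covariance matrix is allowed in the limiting normal law. *)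

theory Defs
  imports
    "Jordan_Normal_Form.Spectral_Radius"
    "HOL-Probability.Probability"
begin

no_notation Matrix.vec_index (infixl "$" 100)

definition in_nbrs :: "('v \<times> 'v) set \<Rightarrow> 'v \<Rightarrow> 'v set" where
  "in_nbrs E v = {v'. (v', v) \<in> E}"

definition rademacher_pmf :: "real \<Rightarrow> int pmf" where
  "rademacher_pmf p = map_pmf (\<lambda>b. if b then 1 else -1) (bernoulli_pmf p)"

text \<open>The guard below makes the recursion well-founded. It fails only when the memory variable
  \<open>D\<close> lies outside its range, which is a null event under the laws assumed later. Time starts at 1;
  the value at time 0 is a dummy.\<close>

fun erwg_step ::
  "('v \<Rightarrow> 'a \<Rightarrow> int) \<Rightarrow> (nat \<Rightarrow> 'v \<Rightarrow> 'a \<Rightarrow> int) \<Rightarrow> (nat \<Rightarrow> 'v \<Rightarrow> 'a \<Rightarrow> nat) \<Rightarrow>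
   (nat \<Rightarrow> 'v \<Rightarrow> 'a \<Rightarrow> 'v) \<Rightarrow> 'a \<Rightarrow> nat \<Rightarrow> 'v \<Rightarrow> int" where
  "erwg_step \<sigma> \<xi> D u \<omega> 0 v = 0"
| "erwg_step \<sigma> \<xi> D u \<omega> (Suc 0) v = \<sigma> v \<omega>"
| "erwg_step \<sigma> \<xi> D u \<omega> (Suc (Suc n)) v =
     (if D (Suc n) v \<omega> \<in> {1..Suc n}
      then \<xi> (Suc n) v \<omega> * erwg_step \<sigma> \<xi> D u \<omega> (D (Suc n) v \<omega>) (u (Suc n) v \<omega>)
      else 0)"

definition erwg_walk ::
  "('v::finite \<Rightarrow> 'a \<Rightarrow> int) \<Rightarrow> (nat \<Rightarrow> 'v \<Rightarrow> 'a \<Rightarrow> int) \<Rightarrow> (nat \<Rightarrow> 'v \<Rightarrow> 'a \<Rightarrow> nat) \<Rightarrow>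
   (nat \<Rightarrow> 'v \<Rightarrow> 'a \<Rightarrow> 'v) \<Rightarrow> nat \<Rightarrow> 'a \<Rightarrow> real ^ 'v" where
  "erwg_walk \<sigma> \<xi> D u n \<omega> = (\<chi> v. \<Sum>j = 1..n. real_of_int (erwg_step \<sigma> \<xi> D u \<omega> j v))"

text \<open>The driving variables take values in different types, so joint independence is stated
  through the sigma-algebras they generate, indexed by one common type.\<close>

datatype 'v driver = Init 'v | Xi nat 'v | Mem nat 'v | Nbr nat 'v

fun driver_events ::
  "'a measure \<Rightarrow> ('v \<Rightarrow> 'a \<Rightarrow> int) \<Rightarrow> (nat \<Rightarrow> 'v \<Rightarrow> 'a \<Rightarrow> int) \<Rightarrow> (nat \<Rightarrow> 'v \<Rightarrow> 'a \<Rightarrow> nat) \<Rightarrow>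
   (nat \<Rightarrow> 'v \<Rightarrow> 'a \<Rightarrow> 'v) \<Rightarrow> 'v driver \<Rightarrow> 'a set set" where
  "driver_events M \<sigma> \<xi> D u (Init v) =
     sets (vimage_algebra (space M) (\<sigma> v) (count_space UNIV))"
| "driver_events M \<sigma> \<xi> D u (Xi n v) =
     sets (vimage_algebra (space M) (\<xi> n v) (count_space UNIV))"
| "driver_events M \<sigma> \<xi> D u (Mem n v) =
     sets (vimage_algebra (space M) (D n v) (count_space UNIV))"
| "driver_events M \<sigma> \<xi> D u (Nbr n v) =
     sets (vimage_algebra (space M) (u n v) (count_space UNIV))"

definition driver_indices :: "'v driver set" where
  "driver_indices =
     {Init v | v. True} \<union> {Xi n v | n v. n \<ge> 1} \<union> {Mem n v | n v. n \<ge> 1} \<union> {Nbr n v | n v. n \<ge> 1}"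

locale erwg = prob_space M
  for M :: "'a measure"
    and E :: "('v::finite \<times> 'v) set"
    and p q :: "'v \<Rightarrow> real"
    and \<sigma> :: "'v \<Rightarrow> 'a \<Rightarrow> int"
    and \<xi> :: "nat \<Rightarrow> 'v \<Rightarrow> 'a \<Rightarrow> int"
    and D :: "nat \<Rightarrow> 'v \<Rightarrow> 'a \<Rightarrow> nat"
    and u :: "nat \<Rightarrow> 'v \<Rightarrow> 'a \<Rightarrow> 'v" +
  assumes in_degree: "card (in_nbrs E v) \<ge> 1"
    and p_range: "p v \<in> {0..1}"
    and q_range: "q v \<in> {0..1}"
    and sigma_rv: "\<sigma> v \<in> measurable M (count_space UNIV)"
    and xi_rv: "n \<ge> 1 \<Longrightarrow> \<xi> n v \<in> measurable M (count_space UNIV)"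
    and D_rv: "n \<ge> 1 \<Longrightarrow> D n v \<in> measurable M (count_space UNIV)"
    and u_rv: "n \<ge> 1 \<Longrightarrow> u n v \<in> measurable M (count_space UNIV)"
    and sigma_law: "distr M (count_space UNIV) (\<sigma> v) = measure_pmf (rademacher_pmf (q v))"
    and xi_law: "n \<ge> 1 \<Longrightarrow>
      distr M (count_space UNIV) (\<xi> n v) = measure_pmf (rademacher_pmf (p v))"
    and D_law: "n \<ge> 1 \<Longrightarrow>
      distr M (count_space UNIV) (D n v) = measure_pmf (pmf_of_set {1..n})"
    and u_law: "n \<ge> 1 \<Longrightarrow>
      distr M (count_space UNIV) (u n v) = measure_pmf (pmf_of_set (in_nbrs E v))"
    and drivers_indep: "indep_sets (driver_events M \<sigma> \<xi> D u) driver_indices"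

definition memory_matrix :: "('v::finite \<times> 'v) set \<Rightarrow> ('v \<Rightarrow> real) \<Rightarrow> real ^ 'v ^ 'v" where
  "memory_matrix E p =
     (\<chi> i j. if (i, j) \<in> E then (2 * p j - 1) / real (card (in_nbrs E j)) else 0)"

text \<open>Complexification, with the index type enumerated by \<open>from_nat_into UNIV\<close>, which is a
  bijection from \<open>{..<CARD('v)}\<close> to \<open>'v\<close>. The notions below do not depend on the enumeration.\<close>

definition complex_mat :: "real ^ 'v ^ 'v \<Rightarrow> complex Matrix.mat" where
  "complex_mat A = Matrix.mat CARD('v::finite) CARD('v)
     (\<lambda>(i, j). complex_of_real (A $ from_nat_into UNIV i $ from_nat_into UNIV j))"

definition max_Re_eigenvalue :: "real ^ 'v ^ 'v \<Rightarrow> real" where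
  "max_Re_eigenvalue B = Max (Re ` {z. eigenvalue (complex_mat B) z})"

text \<open>The size of the whole Jordan part of an eigenvalue: all Jordan blocks with that
  eigenvalue are added up, so this is the algebraic multiplicity and not the size of the
  largest block. Jordan forms differ only in the order of the blocks.\<close>

definition jordan_part_size :: "complex Matrix.mat \<Rightarrow> complex \<Rightarrow> nat" where
  "jordan_part_size A a =
     (\<Sum>(n, b) \<leftarrow> (SOME n_as. jordan_nf A n_as). if b = a then n else 0)"

definition max_jordan_part :: "real ^ 'v ^ 'v \<Rightarrow> nat" where
  "max_jordan_part B = Max {jordan_part_size (complex_mat (mat 1 - B)) (1 - z) | z.
     eigenvalue (complex_mat B) z \<and> Re z = max_Re_eigenvalue B}"

definition mexp :: "real ^ 'v ^ 'v \<Rightarrow> real ^ 'v ^ 'v" where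
  "mexp A = (\<Sum>n. (((**) A ^^ n) (mat 1)) /\<^sub>R fact n)"

definition cov_integrand :: "real ^ 'v ^ 'v \<Rightarrow> real \<Rightarrow> real ^ 'v ^ 'v" where
  "cov_integrand B t = (let C = B - (1/2) *\<^sub>R mat 1 in
     mexp (t *\<^sub>R transpose C) ** mexp (t *\<^sub>R C))"

definition Sigma1 :: "real ^ 'v ^ 'v \<Rightarrow> real ^ 'v ^ 'v" where
  "Sigma1 B = (LINT t:{0..}|lborel. cov_integrand B t)"

definition Sigma3_seq :: "real ^ 'v ^ 'v \<Rightarrow> nat \<Rightarrow> nat \<Rightarrow> real ^ 'v ^ 'v" where
  "Sigma3_seq B \<nu> n = (1 / ln (real n) ^ (2 * \<nu> - 1)) *\<^sub>R
     (LINT t:{0..ln (real n)}|lborel. cov_integrand B t)"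

definition Sigma3 :: "real ^ 'v ^ 'v \<Rightarrow> nat \<Rightarrow> real ^ 'v ^ 'v" where
  "Sigma3 B \<nu> = lim (Sigma3_seq B \<nu>)"

definition centered_normal :: "real ^ 'v ^ 'v \<Rightarrow> (real ^ 'v) measure \<Rightarrow> bool" where
  "centered_normal C \<mu> \<longleftrightarrow>
     transpose C = C \<and> prob_space \<mu> \<and> sets \<mu> = sets borel \<and>
     (\<forall>a. (CLINT x|\<mu>. iexp (inner a x)) = complex_of_real (exp (- (inner a (C *v a)) / 2)))"

definition converges_in_distr ::
  "'a measure \<Rightarrow> (nat \<Rightarrow> 'a \<Rightarrow> 'b::topological_space) \<Rightarrow> 'b measure \<Rightarrow> bool" where
  "converges_in_distr M Y \<mu> \<longleftrightarrow>
     (\<forall>n. Y n \<in> borel_measurable M) \<and> prob_space \<mu> \<and> sets \<mu> = sets borel \<and>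
     (\<forall>f :: 'b \<Rightarrow> real. continuous_on UNIV f \<and> bounded (range f) \<longrightarrow>
        (\<lambda>n. LINT \<omega>|M. f (Y n \<omega>)) \<longlonglongrightarrow> (LINT x|\<mu>. f x))"

end

theory Submission
  imports Defs
begin

text \<open>
  Testing the walk against the vectors \<open>b j\<close> that solve the backward recursion
  \<open>b j = b (j + 1) + (1 / j) B b (j + 1)\<close>, \<open>b n = a\<close>, turns \<open>inner (b j) (S j)\<close> into a martingale with
  bounded increments. Given the past, the coordinates of a step are independent signs, so one step
  multiplies the characteristic function by \<open>exp (- (norm (b j))\<^sup>2 / 2)\<close> up to an error controlled by
  \<open>norm (b j) ^ 3\<close> and the squared drift \<open>S j B / j\<close>, and the limit is governed by the deterministic
  sum of the \<open>(norm (b j))\<^sup>2\<close>. The transition matrices agree with the matrix powers \<open>(n / j) ^ B\<close> up to a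
  relative error \<open>O(1 / j)\<close>, which makes this sum a Riemann sum of the covariance integral after the
  substitution \<open>t = ln (n / j)\<close>. The Jordan form shows that the entries of the matrix exponential are
  exponential polynomials. In the critical case, blocks smaller than the whole Jordan part only
  shrink the limit, possibly to zero.
\<close>

section \<open>Convergence in distribution from characteristic functions\<close>

text \<open>Given the past, a coordinate of a step has variance 1 minus its squared drift. This is
  deterministic up to a quantity whose mean tends to zero, so comparing characteristic functions
  step by step replaces a law of large numbers for conditional variances. The mean of the squared
  drift is controlled by the same backward recursion applied to second moments: it is of order
  \<open>w n / n\<close>. The approximation errors are sums over \<open>j\<close> of
  \<open>z n j = (opnorm (U (ln (n / j))))^2 / w n\<close> against summable weights such as
  \<open>j powr (- 3/2)\<close>. For fixed \<open>j\<close> each term vanishes, so one dominated-sum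
  argument, \<open>toeplitz_null\<close>, treats both regimes. The spectrum of \<open>B\<close>
  enters only through the conditions of \<open>regular_scale\<close> and the existence of the
  limiting covariance. The limit may be degenerate, so neither densities nor an inverse covariance
  are available. The limit law is built as a linear image of independent standard normals, and
  convergence follows from characteristic functions and tightness in all dimensions at once.\<close>

inductive trig_poly :: "('a::euclidean_space \<Rightarrow> real) \<Rightarrow> bool" where
  trig_poly_cos: "trig_poly (\<lambda>x. c * cos (inner a x + b))"
| trig_poly_add: "trig_poly f \<Longrightarrow> trig_poly g \<Longrightarrow> trig_poly (\<lambda>x. f x + g x)"

lemma trig_poly_const: "trig_poly (\<lambda>x. c)"
  using trig_poly_cos[of c 0 0] by simp

text \<open>The product-to-sum formula makes the span of phase-shifted cosines an algebra, as
  Stone-Weierstrass requires; the phase \<open>b\<close> puts sines into the span.\<close>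

lemma trig_poly_mult:
  assumes "trig_poly f" "trig_poly g"
  shows "trig_poly (\<lambda>x. f x * g x)"
  using assms
proof (induction arbitrary: g rule: trig_poly.induct)
  case (trig_poly_cos c a b)
  from trig_poly_cos show ?case
  proof (induction rule: trig_poly.induct)
    case (trig_poly_cos c' a' b')
    have "trig_poly (\<lambda>x. c * c' / 2 * cos (inner (a - a') x + (b - b'))
                     + c * c' / 2 * cos (inner (a + a') x + (b + b')))"
      by (intro trig_poly.intros)
    moreover have "c * c' / 2 * cos (inner (a - a') x + (b - b'))
                     + c * c' / 2 * cos (inner (a + a') x + (b + b'))
      = c * cos (inner a x + b) * (c' * cos (inner a' x + b'))" for x
    proof -
      have 1: "inner (a - a') x + (b - b') = (inner a x + b) - (inner a' x + b')"
        and 2: "inner (a + a') x + (b + b') = (inner a x + b) + (inner a' x + b')"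
        by (simp_all add: inner_diff_left inner_add_left)
      show ?thesis unfolding 1 2 cos_add cos_diff by (simp add: field_simps)
    qed
    ultimately show ?case by simp
  next
    case (trig_poly_add f g)
    then show ?case by (simp add: distrib_left trig_poly.trig_poly_add)
  qed
next
  case (trig_poly_add f1 f2)
  then show ?case by (simp add: distrib_right trig_poly.trig_poly_add)
qed

lemma continuous_on_trig_poly: "trig_poly f \<Longrightarrow> continuous_on S f"
  by (induction rule: trig_poly.induct) (auto intro!: continuous_intros)

lemma trig_poly_bounded: "trig_poly f \<Longrightarrow> \<exists>C. \<forall>x. \<bar>f x\<bar> \<le> C"
proof (induction rule: trig_poly.induct)
  case (trig_poly_cos c a b)
  have "\<bar>c * cos (inner a x + b)\<bar> \<le> \<bar>c\<bar>" for x
    by (simp add: abs_mult mult_left_le)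
  then show ?case by blast
next
  case (trig_poly_add f g)
  then obtain C C' where "\<And>x. \<bar>f x\<bar> \<le> C" "\<And>x. \<bar>g x\<bar> \<le> C'" by blast
  then have "\<bar>f x + g x\<bar> \<le> C + C'" for x
    by (meson abs_triangle_ineq add_mono order_trans)
  then show ?case by blast
qed

lemma trig_poly_compose_polynomial:
  assumes "real_polynomial_function p" "trig_poly g"
  shows "trig_poly (\<lambda>x. p (g x) :: real)"
  using assms(1)
proof (induction rule: real_polynomial_function.induct)
  case (linear f)
  have "(\<lambda>x. f (g x)) = (\<lambda>x. f 1 * g x)"
  proof
    show "f (g x) = f 1 * g x" for x
      using linear_cmul[OF bounded_linear.linear[OF linear], of "g x" 1] by simp
  qed
  then show ?case using trig_poly_mult[OF trig_poly_const assms(2), of "f 1"] by argo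
qed (rule trig_poly_const trig_poly_mult trig_poly_add; assumption?)+

lemma trig_poly_separates:
  fixes x y :: "'a::euclidean_space"
  assumes "x \<noteq> y"
  shows "\<exists>f. trig_poly f \<and> f x \<noteq> f y"
proof -
  \<comment> \<open>Scaled so that the phases at \<open>x\<close> and \<open>y\<close> differ by
    pi/2; after the shift by \<open>- inner a y\<close> the cosine is 0 at \<open>x\<close> and 1 at
    \<open>y\<close>.\<close>
  define a where "a = (pi / 2 / (norm (x - y))\<^sup>2) *\<^sub>R (x - y)"
  have "inner a x - inner a y = pi / 2"
    using assms unfolding inner_diff_right[symmetric] a_def
    by (simp add: power2_norm_eq_inner)
  then have "1 * cos (inner a x + - inner a y) \<noteq> 1 * cos (inner a y + - inner a y)"
    by (simp only: add_uminus_conv_diff cos_pi_half) simp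
  then show ?thesis using trig_poly_cos[of 1 a "- inner a y"] by (intro exI conjI)
qed

text \<open>Stone-Weierstrass gives no control outside the compact set. Composing the approximant with a
  polynomial approximation of the clipping function on its bounded range restores it.\<close>

lemma trig_poly_approx:
  fixes f :: "'a::euclidean_space \<Rightarrow> real"
  assumes f: "continuous_on S f" "compact S" and M: "\<And>x. \<bar>f x\<bar> \<le> M" and e: "e > 0"
  obtains g where "trig_poly g" "\<And>x. x \<in> S \<Longrightarrow> \<bar>f x - g x\<bar> < e" "\<And>x. \<bar>g x\<bar> \<le> M + e"
proof -
  have M0: "M \<ge> 0" using M[of undefined] by linarith
  have "\<exists>g. trig_poly g \<and> (\<forall>x\<in>S. \<bar>f x - g x\<bar> < e / 2)"
  proof (rule Stone_Weierstrass_HOL[where P = trig_poly and S = S])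
    show "\<exists>h. trig_poly h \<and> h x \<noteq> h y" if "x \<in> S \<and> y \<in> S \<and> x \<noteq> y" for x y :: 'a
      using that by (intro trig_poly_separates) simp
  qed (use f e in \<open>simp_all add: trig_poly_const continuous_on_trig_poly trig_poly_add trig_poly_mult\<close>)
  then obtain h where h: "trig_poly h" "\<And>x. x \<in> S \<Longrightarrow> \<bar>f x - h x\<bar> < e / 2" by blast
  obtain C where C: "\<And>x. \<bar>h x\<bar> \<le> C" using trig_poly_bounded[OF h(1)] by blast
  define c :: "real \<Rightarrow> real" where "c = (\<lambda>y. max (- M) (min M y))"
  have "continuous_on {-C..C} c" unfolding c_def by (intro continuous_intros)
  then obtain p where p: "real_polynomial_function p" "\<And>y. y \<in> {-C..C} \<Longrightarrow> \<bar>c y - p y\<bar> < e / 2"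
    using Stone_Weierstrass_real_polynomial_function[of "{-C..C}" c "e / 2"] e by auto
  have q: "\<bar>c (h x) - p (h x)\<bar> < e / 2" for x
    using p(2)[of "h x"] C[of x] by (simp add: abs_le_iff)
  show ?thesis
  proof
    show "trig_poly (\<lambda>x. p (h x))" by (rule trig_poly_compose_polynomial[OF p(1) h(1)])
    show "\<bar>f x - p (h x)\<bar> < e" if "x \<in> S" for x
    proof -
      \<comment> \<open>\<open>f x\<close> already lies in the clipping interval, so clipping
        \<open>h x\<close> cannot increase its distance from \<open>f x\<close>.\<close>
      have "\<bar>f x - c (h x)\<bar> < e / 2" using h(2)[OF that] M[of x] M0
        unfolding c_def max_def min_def by (auto split: if_splits)
      with q[of x] show ?thesis by linarith
    qed
    show "\<bar>p (h x)\<bar> \<le> M + e" for x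
    proof -
      have "\<bar>c (h x)\<bar> \<le> M" using M0 by (auto simp: c_def)
      with q[of x] e show ?thesis by linarith
    qed
  qed
qed

lemma integrable_trig_poly:
  fixes Y :: "'a \<Rightarrow> 'b::euclidean_space"
  assumes "prob_space M" "Y \<in> borel_measurable M" "trig_poly g"
  shows "integrable M (\<lambda>\<omega>. g (Y \<omega>))"
proof -
  interpret prob_space M by fact
  obtain C where "\<And>x. \<bar>g x\<bar> \<le> C" using trig_poly_bounded[OF assms(3)] by blast
  moreover have "g \<in> borel_measurable borel"
    using continuous_on_trig_poly[OF assms(3)] by (rule borel_measurable_continuous_onI)
  ultimately show ?thesis using assms(2)
    by (intro integrable_const_bound[where B = C]) auto
qed

text \<open>A phase-shifted cosine is the real part of a constant times a character, so its
  expectation depends continuously on a value of the characteristic function. The identity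
  \<open>key\<close> is stated for an arbitrary law because it is used under \<open>M\<close> and
  under \<open>\<mu>\<close>.\<close>

lemma trig_poly_expectation_tendsto:
  fixes Y :: "nat \<Rightarrow> 'a \<Rightarrow> 'b::euclidean_space"
  assumes M: "prob_space M" and Y: "\<And>n. Y n \<in> borel_measurable M"
    and mu: "prob_space \<mu>" "sets \<mu> = sets borel"
    and char: "\<And>a. (\<lambda>n. CLINT \<omega>|M. iexp (inner a (Y n \<omega>))) \<longlonglongrightarrow> (CLINT x|\<mu>. iexp (inner a x))"
    and g: "trig_poly g"
  shows "(\<lambda>n. LINT \<omega>|M. g (Y n \<omega>)) \<longlonglongrightarrow> (LINT x|\<mu>. g x)"
  using g
proof (induction rule: trig_poly.induct)
  case (trig_poly_cos c a b)
  have key: "(LINT \<omega>|N. c * cos (inner a (Z \<omega>) + b)) = c * Re (iexp b * (CLINT \<omega>|N. iexp (inner a (Z \<omega>))))"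
    if N: "prob_space N" and Z: "Z \<in> borel_measurable N" for N :: "'c measure" and Z :: "'c \<Rightarrow> 'b"
  proof -
    interpret N: prob_space N by fact
    have int: "integrable N (\<lambda>\<omega>. iexp (inner a (Z \<omega>)))"
      using Z by (intro N.integrable_const_bound[where B = 1]) (auto simp: norm_exp_i_times)
    have "iexp b * (CLINT \<omega>|N. iexp (inner a (Z \<omega>))) = (CLINT \<omega>|N. iexp b * iexp (inner a (Z \<omega>)))"
      by simp
    then have "Re (iexp b * (CLINT \<omega>|N. iexp (inner a (Z \<omega>))))
        = (LINT \<omega>|N. Re (iexp b * iexp (inner a (Z \<omega>))))"
      using int by (simp add: integral_Re)
    also have "\<dots> = (LINT \<omega>|N. cos (inner a (Z \<omega>) + b))"
      by (intro Bochner_Integration.integral_cong refl)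
        (simp add: exp_add[symmetric] distrib_left[symmetric] add.commute Re_exp
          flip: of_real_add)
    finally show ?thesis by simp
  qed
  have id: "(\<lambda>x. x) \<in> borel_measurable \<mu>" using mu(2) by (simp add: measurable_ident_sets)
  have "(\<lambda>n. c * Re (iexp b * (CLINT \<omega>|M. iexp (inner a (Y n \<omega>)))))
    \<longlonglongrightarrow> c * Re (iexp b * (CLINT x|\<mu>. iexp (inner a x)))"
    by (intro tendsto_intros char)
  then show ?case unfolding key[OF M Y] key[OF mu(1) id, symmetric] by simp
next
  case (trig_poly_add f g)
  have id: "(\<lambda>x. x) \<in> borel_measurable \<mu>" using mu(2) by (simp add: measurable_ident_sets)
  show ?case
    using tendsto_add[OF trig_poly_add.IH]
      integrable_trig_poly[OF M Y trig_poly_add.hyps(1)] integrable_trig_poly[OF M Y trig_poly_add.hyps(2)]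
      integrable_trig_poly[OF mu(1) id trig_poly_add.hyps(1)] integrable_trig_poly[OF mu(1) id trig_poly_add.hyps(2)]
    by (simp add: Bochner_Integration.integral_add)
qed

text \<open>On the ball the two functions are within \<open>e\<close>; off the ball only the crude
  bound \<open>2 * C + e\<close> is available, and it is paid with the small probability
  \<open>d\<close>. A general \<open>N\<close> and \<open>Z\<close> cover both the laws of
  \<open>Y n\<close> and the limit, where \<open>Z\<close> is the identity.\<close>

lemma expectation_close_on_large_set:
  fixes f g :: "'b::euclidean_space \<Rightarrow> real"
  assumes N: "prob_space N" and Z: "Z \<in> borel_measurable N"
    and f: "continuous_on UNIV f" "\<And>x. \<bar>f x\<bar> \<le> C"
    and g: "trig_poly g" "\<And>x. \<bar>g x\<bar> \<le> C + e"
    and e: "e > 0" and close: "\<And>x. x \<in> cball 0 R \<Longrightarrow> \<bar>f x - g x\<bar> < e"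
    and tight: "measure N {\<omega> \<in> space N. norm (Z \<omega>) > R} \<le> d"
  shows "\<bar>(LINT \<omega>|N. f (Z \<omega>)) - (LINT \<omega>|N. g (Z \<omega>))\<bar> \<le> e + (2 * C + e) * d"
proof -
  interpret N: prob_space N by fact
  have C0: "C \<ge> 0" using f(2)[of undefined] by linarith
  have fm: "f \<in> borel_measurable borel" using f(1) by (rule borel_measurable_continuous_onI)
  have int_f: "integrable N (\<lambda>\<omega>. f (Z \<omega>))"
    using fm Z f(2) by (intro N.integrable_const_bound[where B = C]) auto
  have ig: "integrable N (\<lambda>\<omega>. g (Z \<omega>))" by (rule integrable_trig_poly[OF N Z g(1)])
  define A where "A = {\<omega> \<in> space N. norm (Z \<omega>) > R}"
  have A: "A \<in> sets N" unfolding A_def using Z by measurable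
  have iA: "integrable N (\<lambda>\<omega>. e + (2 * C + e) * indicator A \<omega>)"
    using A by (auto simp: integrable_indicator_iff N.emeasure_eq_measure)
  have "\<bar>(LINT \<omega>|N. f (Z \<omega>)) - (LINT \<omega>|N. g (Z \<omega>))\<bar> = \<bar>LINT \<omega>|N. f (Z \<omega>) - g (Z \<omega>)\<bar>"
    using int_f ig by simp
  also have "\<dots> \<le> (LINT \<omega>|N. \<bar>f (Z \<omega>) - g (Z \<omega>)\<bar>)" by (rule integral_abs_bound)
  also have "\<dots> \<le> (LINT \<omega>|N. e + (2 * C + e) * indicator A \<omega>)"
  proof (rule integral_mono)
    fix \<omega> assume w: "\<omega> \<in> space N"
    show "\<bar>f (Z \<omega>) - g (Z \<omega>)\<bar> \<le> e + (2 * C + e) * indicator A \<omega>"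
    proof (cases "\<omega> \<in> A")
      case True
      then show ?thesis using f(2)[of "Z \<omega>"] g(2)[of "Z \<omega>"] e by simp
    next
      case False
      then have "Z \<omega> \<in> cball 0 R" using w by (auto simp: A_def)
      from close[OF this] False show ?thesis by simp
    qed
  qed (use int_f ig iA in auto)
  also have "\<dots> = e + (2 * C + e) * measure N A"
    using A by (subst Bochner_Integration.integral_add)
      (auto simp: integrable_indicator_iff N.emeasure_eq_measure N.prob_space)
  also have "\<dots> \<le> e + (2 * C + e) * d"
    using tight C0 e unfolding A_def by (intro add_left_mono mult_left_mono) auto
  finally show ?thesis .
qed

text \<open>Tightness is a hypothesis since second moments provide it in the application. It allows
  a bounded continuous test function to be replaced by a trigonometric polynomial at a cost uniform
  in all large \<open>n\<close>, and the expectation of a trigonometric polynomial is read off the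
  characteristic function.\<close>

theorem converges_in_distr_charfun:
  fixes Y :: "nat \<Rightarrow> 'a \<Rightarrow> 'b::euclidean_space"
  assumes M: "prob_space M" and Y: "\<And>n. Y n \<in> borel_measurable M"
    and mu: "prob_space \<mu>" "sets \<mu> = sets borel"
    and char: "\<And>a. (\<lambda>n. CLINT \<omega>|M. iexp (inner a (Y n \<omega>))) \<longlonglongrightarrow> (CLINT x|\<mu>. iexp (inner a x))"
    and tight: "\<And>d. d > 0 \<Longrightarrow> \<exists>R. \<forall>\<^sub>F n in sequentially. measure M {\<omega> \<in> space M. norm (Y n \<omega>) > R} \<le> d"
  shows "converges_in_distr M Y \<mu>"
  unfolding converges_in_distr_def
proof (intro conjI allI impI Y mu)
  fix f :: "'b \<Rightarrow> real"
  assume "continuous_on UNIV f \<and> bounded (range f)"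
  then obtain C where f: "continuous_on UNIV f" and C: "\<And>x. \<bar>f x\<bar> \<le> C"
    by (auto simp: bounded_iff)
  have C0: "C \<ge> 0" using C[of undefined] by linarith
  interpret mu: prob_space \<mu> by fact
  have id: "(\<lambda>x. x) \<in> borel_measurable \<mu>" using mu(2) by (simp add: measurable_ident_sets)
  \<comment> \<open>The complements of growing balls decrease to the empty set, so a single law is
    tight by continuity from above.\<close>
  have mu_tight: "\<exists>R. measure \<mu> {x \<in> space \<mu>. norm x > R} \<le> d" if "d > 0" for d
  proof -
    have meas: "{x \<in> space \<mu>. norm x > r} \<in> sets \<mu>" for r
      using id by measurable
    have "(\<lambda>n. measure \<mu> {x \<in> space \<mu>. norm x > real n}) \<longlonglongrightarrow>
        measure \<mu> (\<Inter>n. {x \<in> space \<mu>. norm x > real n})"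
      by (rule mu.finite_Lim_measure_decseq) (auto simp: decseq_def meas)
    moreover have "(\<Inter>n. {x \<in> space \<mu>. norm x > real n}) = {}"
    proof -
      have "x \<notin> (\<Inter>n. {x \<in> space \<mu>. norm x > real n})" for x
      proof -
        obtain n where "norm x < real n" using reals_Archimedean2 by blast
        then have "x \<notin> {x \<in> space \<mu>. norm x > real n}" by simp
        then show ?thesis by blast
      qed
      then show ?thesis by blast
    qed
    ultimately have "(\<lambda>n. measure \<mu> {x \<in> space \<mu>. norm x > real n}) \<longlonglongrightarrow> 0" by simp
    then have "\<forall>\<^sub>F n in sequentially. measure \<mu> {x \<in> space \<mu>. norm x > real n} < d"
      using that by (rule order_tendstoD)
    then show ?thesis by (auto simp: eventually_sequentially intro: less_imp_le)
  qed
  show "(\<lambda>n. LINT \<omega>|M. f (Y n \<omega>)) \<longlonglongrightarrow> (LINT x|\<mu>. f x)"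
  proof (rule tendstoI)
    fix r :: real assume r: "r > 0"
    \<comment> \<open>\<open>e\<close> and \<open>d\<close> make each replacement cost at most
      \<open>r / 3\<close>: \<open>r / 6\<close> for the ball and \<open>r / 6\<close> for its
      complement. The cap \<open>e \<le> 1\<close> lets \<open>2 * C + 1\<close> replace
      \<open>2 * C + e\<close>.\<close>
    define e where "e = min 1 (r / 6)"
    define d where "d = r / (6 * (2 * C + 1))"
    have e: "e > 0" "e \<le> 1" "e \<le> r / 6" and d: "d > 0" using r C0 by (auto simp: e_def d_def)
    have small: "e + (2 * C + e) * d \<le> r / 3"
    proof -
      have "(2 * C + e) * d \<le> (2 * C + 1) * d" using e d by (intro mult_right_mono) auto
      also have "\<dots> = r / 6" using C0 by (simp add: d_def field_simps add_pos_nonneg)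
      finally show ?thesis using e by linarith
    qed
    obtain R1 where R1: "\<forall>\<^sub>F n in sequentially. measure M {\<omega> \<in> space M. norm (Y n \<omega>) > R1} \<le> d"
      using tight[OF d] by blast
    obtain R2 where R2: "measure \<mu> {x \<in> space \<mu>. norm x > R2} \<le> d"
      using mu_tight[OF d] by blast
    define R where "R = max R1 R2"
    interpret M: prob_space M by fact
    have R1': "measure M {\<omega> \<in> space M. norm (Y n \<omega>) > R} \<le> measure M {\<omega> \<in> space M. norm (Y n \<omega>) > R1}" for n
      using Y[of n] by (intro M.finite_measure_mono) (auto simp: R_def)
    have "measure \<mu> {x \<in> space \<mu>. norm x > R} \<le> measure \<mu> {x \<in> space \<mu>. norm x > R2}"
      using id by (intro mu.finite_measure_mono) (auto simp: R_def)
    with R2 have R2': "measure \<mu> {x \<in> space \<mu>. norm x > R} \<le> d" by linarith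
    obtain g where g: "trig_poly g" "\<And>x. x \<in> cball 0 R \<Longrightarrow> \<bar>f x - g x\<bar> < e" "\<And>x. \<bar>g x\<bar> \<le> C + e"
      using trig_poly_approx[of "cball 0 R" f C e] continuous_on_subset[OF f] C e by auto
    have "(\<lambda>n. LINT \<omega>|M. g (Y n \<omega>)) \<longlonglongrightarrow> (LINT x|\<mu>. g x)"
      by (rule trig_poly_expectation_tendsto[OF M Y mu char g(1)])
    then have "\<forall>\<^sub>F n in sequentially. dist (LINT \<omega>|M. g (Y n \<omega>)) (LINT x|\<mu>. g x) < r / 3"
      using r by (intro tendstoD) auto
    with R1 show "\<forall>\<^sub>F n in sequentially. dist (LINT \<omega>|M. f (Y n \<omega>)) (LINT x|\<mu>. f x) < r"
    proof eventually_elim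
      case (elim n)
      have "\<bar>(LINT \<omega>|M. f (Y n \<omega>)) - (LINT \<omega>|M. g (Y n \<omega>))\<bar> \<le> r / 3"
        using expectation_close_on_large_set[OF M Y[of n] f C g(1,3) e(1) g(2), of R d] elim(1) R1'[of n] small
        by auto
      moreover have "\<bar>(LINT x|\<mu>. f x) - (LINT x|\<mu>. g x)\<bar> \<le> r / 3"
        using expectation_close_on_large_set[OF mu(1) id f C g(1,3) e(1) g(2), of R d] R2' small
        by auto
      ultimately show ?case using elim(2) unfolding dist_real_def by linarith
    qed
  qed
qed

section \<open>Gaussian laws with a possibly singular covariance\<close>

lemma psd_form_cauchy_schwarz_zero:
  fixes T :: "'a::euclidean_space \<Rightarrow> 'a"
  assumes T: "linear T" and sym: "\<And>x y. inner x (T y) = inner (T x) y"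
    and psd: "\<And>x. inner x (T x) \<ge> 0" and e: "inner e (T e) = 0"
  shows "T e = 0"
proof -
  have *: "inner e (T y) = 0" for y
  proof (rule ccontr)
    assume ne: "inner e (T y) \<noteq> 0"
    \<comment> \<open>Since \<open>e\<close> is isotropic, the form along
      \<open>y + s *\<^sub>R e\<close> is affine in \<open>s\<close>; this \<open>s\<close> gives it
      the value -1.\<close>
    define s where "s = - (inner y (T y) + 1) / (2 * inner e (T y))"
    have "inner (y + s *\<^sub>R e) (T (y + s *\<^sub>R e)) = inner y (T y) + 2 * s * inner e (T y)"
      using e sym[of y e]
      by (simp add: linear_add[OF T] linear_cmul[OF T] inner_add_left inner_add_right inner_commute algebra_simps)
    also have "\<dots> = -1" using ne by (simp add: s_def field_simps)
    finally show False using psd[of "y + s *\<^sub>R e"] by simp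
  qed
  show ?thesis using *[of "T e"] sym[of e "T e"] by simp
qed

text \<open>Cholesky decomposition, eliminating one basis vector at a time.\<close>

lemma psd_form_sum_squares:
  fixes T :: "'a::euclidean_space \<Rightarrow> 'a"
  assumes T: "linear T" and sym: "\<And>x y. inner x (T y) = inner (T x) y"
    and psd: "\<And>x. inner x (T x) \<ge> 0"
  obtains w :: "'a \<Rightarrow> 'a" where "\<And>x. inner x (T x) = (\<Sum>b\<in>Basis. (inner (w b) x)\<^sup>2)"
proof -
  \<comment> \<open>Invariant of the elimination: the residual form \<open>T'\<close> is still
    positive semidefinite and annihilates the basis vectors already treated, and the squares removed
    so far account for the rest of \<open>T\<close>.\<close>
  have "\<exists>T' w. linear T' \<and> (\<forall>x y. inner x (T' y) = inner (T' x) y) \<and> (\<forall>x. inner x (T' x) \<ge> 0) \<and>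
      (\<forall>b\<in>F. T' b = 0) \<and> (\<forall>x. inner x (T x) = inner x (T' x) + (\<Sum>b\<in>F. (inner (w b) x)\<^sup>2))"
    if "finite F" for F :: "'a set"
    using that
  proof induction
    case empty
    then show ?case using T sym psd by auto
  next
    case (insert e F)
    then obtain T' and w :: "'a \<Rightarrow> 'a" where T': "linear T'" and sym': "\<And>x y. inner x (T' y) = inner (T' x) y"
      and psd': "\<And>x. inner x (T' x) \<ge> 0" and ker: "\<And>b. b \<in> F \<Longrightarrow> T' b = 0"
      and dec: "\<And>x. inner x (T x) = inner x (T' x) + (\<Sum>b\<in>F. (inner (w b) x)\<^sup>2)"
      by metis
    have [simp]: "x \<in> F \<Longrightarrow> x \<noteq> e" for x using insert by auto
    show ?case
    proof (cases "inner e (T' e) = 0")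
      case True
      \<comment> \<open>A zero pivot of a positive semidefinite form forces the whole row to vanish,
        so nothing is eliminated and the vector for \<open>e\<close> is 0.\<close>
      then have "T' e = 0" using psd_form_cauchy_schwarz_zero[OF T' sym' psd'] by blast
      moreover have "(\<Sum>b\<in>insert e F. (inner ((w(e := 0)) b) x)\<^sup>2) = (\<Sum>b\<in>F. (inner (w b) x)\<^sup>2)" for x
        using insert by (simp cong: sum.cong)
      ultimately show ?thesis using T' sym' psd' ker dec
        by (intro exI[of _ T'] exI[of _ "w(e := 0)"]) auto
    next
      case False
      define q where "q = inner e (T' e)"
      have q: "q > 0" using False psd'[of e] by (simp add: q_def)
      \<comment> \<open>Schur complement with respect to the pivot \<open>q\<close>: the rank-one
        form of \<open>T' e\<close> is subtracted.\<close>
      define T'' where "T'' y = T' y - (inner (T' e) y / q) *\<^sub>R T' e" for y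
      have lin: "linear T''"
        by (rule linearI) (simp_all add: T''_def linear_add[OF T'] linear_cmul[OF T'] inner_add_right
            algebra_simps add_divide_distrib)
      have sym'': "inner x (T'' y) = inner (T'' x) y" for x y
        by (simp add: T''_def inner_diff_left inner_diff_right sym'[of x y] inner_commute)
      have quad: "inner x (T'' x) = inner x (T' x) - (inner (T' e) x)\<^sup>2 / q" for x
        by (simp add: T''_def inner_diff_right inner_commute power2_eq_square)
      have psd'': "inner x (T'' x) \<ge> 0" for x
      proof -
        \<comment> \<open>The minimiser of the form of \<open>T'\<close> along the line
          \<open>x - s *\<^sub>R e\<close>; the minimum is the value of the Schur complement at
          \<open>x\<close>.\<close>
        define s where "s = inner (T' e) x / q"
        have sx: "inner x (T' e) = s * q" "inner e (T' x) = s * q"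
          using q sym'[of e x] by (simp_all add: s_def inner_commute)
        have "0 \<le> inner (x - s *\<^sub>R e) (T' (x - s *\<^sub>R e))" by (rule psd')
        also have "\<dots> = inner x (T' x) - s * (s * q) - s * (s * q) + s * (s * q)"
          by (simp add: linear_diff[OF T'] linear_cmul[OF T'] inner_diff_left inner_diff_right sx
              flip: q_def)
        also have "\<dots> = inner x (T'' x)"
          unfolding quad using q by (simp add: s_def power2_eq_square)
        finally show ?thesis .
      qed
      have ker'': "T'' b = 0" if "b \<in> insert e F" for b
      proof (cases "b = e")
        case True
        then show ?thesis using q by (simp add: T''_def q_def inner_commute)
      next
        case False
        then have "T' b = 0" using that ker by auto
        then show ?thesis using sym'[of e b] by (simp add: T''_def)
      qed
      define w' where "w' = w(e := (1 / sqrt q) *\<^sub>R T' e)"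
      have "(\<Sum>b\<in>insert e F. (inner (w' b) x)\<^sup>2) = (inner (T' e) x)\<^sup>2 / q + (\<Sum>b\<in>F. (inner (w b) x)\<^sup>2)" for x
        using insert q by (simp add: w'_def power_divide cong: sum.cong)
      then have "inner x (T x) = inner x (T'' x) + (\<Sum>b\<in>insert e F. (inner (w' b) x)\<^sup>2)" for x
        unfolding dec quad by simp
      then show ?thesis using lin sym'' psd'' ker'' by blast
    qed
  qed
  from this[OF finite_Basis] obtain T' and w :: "'a \<Rightarrow> 'a" where
    T': "linear T'" "\<And>b. b \<in> Basis \<Longrightarrow> T' b = 0"
    and w: "\<And>x. inner x (T x) = inner x (T' x) + (\<Sum>b\<in>Basis. (inner (w b) x)\<^sup>2)" by metis
  have "T' x = 0" for x
    using linear_eq_stdbasis[OF T'(1) linear_zero] T'(2) by (metis)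
  with w show ?thesis by (intro that) simp
qed

text \<open>With \<open>w\<close> from the sum of squares, the sum of
  \<open>z b *\<^sub>R w b\<close> for independent standard normals \<open>z b\<close> has the
  required characteristic function. As an image measure, its law exists for singular
  \<open>T\<close> as well.\<close>

lemma gaussian_exists:
  fixes T :: "'a::euclidean_space \<Rightarrow> 'a"
  assumes T: "linear T" "\<And>x y. inner x (T y) = inner (T x) y" "\<And>x. inner x (T x) \<ge> 0"
  obtains \<mu> :: "'a measure" where "prob_space \<mu>" "sets \<mu> = sets borel"
    "\<And>a. (CLINT x|\<mu>. iexp (inner a x)) = complex_of_real (exp (- (inner a (T a)) / 2))"
proof -
  obtain w :: "'a \<Rightarrow> 'a" where w: "\<And>x. inner x (T x) = (\<Sum>b\<in>Basis. (inner (w b) x)\<^sup>2)"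
    using psd_form_sum_squares[OF T] by blast
  interpret N: prob_space std_normal_distribution
    by (rule prob_space_normal_density) simp
  interpret P: product_prob_space "\<lambda>_. std_normal_distribution" "Basis :: 'a set" ..
  define P where "P = PiM (Basis :: 'a set) (\<lambda>_. std_normal_distribution)"
  define Z where "Z = (\<lambda>z. \<Sum>b\<in>Basis. z b *\<^sub>R w b)"
  have Z: "Z \<in> borel_measurable P"
    unfolding Z_def P_def by measurable
  interpret PP: prob_space P unfolding P_def by (rule P.prob_space_axioms)
  show ?thesis
  proof
    show "prob_space (distr P borel Z)" using Z by (rule PP.prob_space_distr)
    show "sets (distr P borel Z) = sets borel" by simp
    fix a
    have int: "integrable std_normal_distribution (\<lambda>x. iexp (inner (w b) a * x))" for b
      by (intro N.integrable_const_bound[where B = 1]) (auto simp: norm_exp_i_times)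
    have "(CLINT x|distr P borel Z. iexp (inner a x)) = (CLINT z|P. iexp (inner a (Z z)))"
      using Z by (subst integral_distr) auto
    also have "\<dots> = (CLINT z|P. (\<Prod>b\<in>Basis. iexp (inner (w b) a * z b)))"
      by (intro Bochner_Integration.integral_cong refl)
        (simp add: Z_def inner_sum_right exp_sum[symmetric] sum_distrib_left inner_commute mult.commute
          flip: of_real_mult)
    also have "\<dots> = (\<Prod>b\<in>Basis. (CLINT x|std_normal_distribution. iexp (inner (w b) a * x)))"
      unfolding P_def by (rule P.product_integral_prod) (use int in auto)
    also have "\<dots> = (\<Prod>b\<in>Basis. complex_of_real (exp (- ((inner (w b) a)\<^sup>2) / 2)))"
      using char_std_normal_distribution by (simp add: char_def fun_eq_iff)
    also have "\<dots> = complex_of_real (exp (- (inner a (T a)) / 2))"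
      unfolding w by (simp add: exp_sum[symmetric] sum_negf sum_divide_distrib flip: of_real_prod)
    finally show "(CLINT x|distr P borel Z. iexp (inner a x)) = complex_of_real (exp (- (inner a (T a)) / 2))" .
  qed
qed

section \<open>One step of the walk\<close>

lemma Int_stable_sets: "Int_stable (sets A)"
  by (auto simp: Int_stable_def)

text \<open>\<open>cos b + \<i> * y * sin b\<close> is the characteristic function at
  \<open>b\<close> of a sign with mean \<open>y\<close>. Its variance is \<open>1 - y^2\<close>;
  writing the Gaussian factor with variance 1 costs at most \<open>b^2 * y^2\<close>, and the Taylor
  remainders cost a multiple of \<open>\<bar>b\<bar> ^ 3\<close>. In exchange the Gaussian factor
  does not depend on \<open>y\<close>, that is, on the past.\<close>

lemma charfun_step_bound:
  fixes b y :: real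
  assumes "\<bar>b\<bar> \<le> 1" "\<bar>y\<bar> \<le> 1"
  shows "cmod (complex_of_real (cos b) + \<i> * of_real (y * sin b) - iexp (b * y) * exp (- (of_real b)\<^sup>2 / 2))
    \<le> 2 * \<bar>b\<bar> ^ 3 + b\<^sup>2 * y\<^sup>2"
proof -
  have sum3: "(\<Sum>k\<le>2. (\<i> * x) ^ k / fact k) = 1 + \<i> * x - x\<^sup>2 / 2" for x :: complex
    by (simp add: numeral_2_eq_2 power_mult_distrib)
  have e3: "cmod (iexp b - (1 + \<i> * b - (complex_of_real b)\<^sup>2 / 2)) \<le> \<bar>b\<bar> ^ 3 / 6"
    using iexp_approx1[of b 2] unfolding sum3 by (simp add: eval_nat_numeral)
  have "\<bar>cos b - 1 + b\<^sup>2 / 2\<bar> \<le> \<bar>b\<bar> ^ 3 / 6"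
  proof -
    have "cos b - 1 + b\<^sup>2 / 2 = Re (iexp b - (1 + \<i> * b - (complex_of_real b)\<^sup>2 / 2))"
      by (simp add: Re_exp power2_eq_square)
    then show ?thesis using abs_Re_le_cmod e3 by (metis order_trans)
  qed
  then have c: "cmod (complex_of_real (cos b - 1 + b\<^sup>2 / 2)) \<le> \<bar>b\<bar> ^ 3 / 6"
    by (simp only: norm_of_real)
  have "\<bar>sin b - b\<bar> \<le> \<bar>b\<bar> ^ 3 / 6"
  proof -
    have "sin b - b = Im (iexp b - (1 + \<i> * b - (complex_of_real b)\<^sup>2 / 2))"
      by (simp add: Im_exp power2_eq_square)
    then show ?thesis using abs_Im_le_cmod e3 by (metis order_trans)
  qed
  then have "\<bar>y * (sin b - b)\<bar> \<le> 1 * (\<bar>b\<bar> ^ 3 / 6)"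
    unfolding abs_mult using assms(2) by (intro mult_mono) auto
  then have s: "cmod (\<i> * complex_of_real (y * (sin b - b))) \<le> \<bar>b\<bar> ^ 3 / 6"
    by (simp only: norm_mult norm_ii norm_of_real)
  have "cmod (iexp (b * y) - (1 + \<i> * of_real (b * y))) \<le> b\<^sup>2 * y\<^sup>2 / 2"
    using iexp_approx1[of "b * y" 1] by (simp add: eval_nat_numeral mult_ac)
  then have "cmod ((iexp (b * y) - (1 + \<i> * of_real (b * y))) * of_real (exp (- b\<^sup>2 / 2))) \<le> b\<^sup>2 * y\<^sup>2 / 2 * 1"
    unfolding norm_mult by (intro mult_mono) auto
  then have f1: "cmod ((iexp (b * y) - (1 + \<i> * of_real (b * y))) * of_real (exp (- b\<^sup>2 / 2))) \<le> b\<^sup>2 * y\<^sup>2"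
    by (smt (verit) divide_nonneg_nonneg field_sum_of_halves mult_nonneg_nonneg zero_le_power2)
  have b4: "b ^ 4 \<le> \<bar>b\<bar> ^ 3"
    using assms(1) power_decreasing[of 3 4 "\<bar>b\<bar>"] by simp
  have "\<bar>exp (- b\<^sup>2 / 2) - 1 + b\<^sup>2 / 2\<bar> \<le> b ^ 4 / 8"
  proof -
    have "1 - z \<le> exp (- z) \<and> exp (- z) \<le> 1 - z + z\<^sup>2 / 2" if "z \<ge> 0" for z :: real
    proof
      \<comment> \<open>The product equals \<open>1 + z ^ 4 / 4\<close>, and its second factor is at
        most \<open>exp z\<close>.\<close>
      have "1 \<le> (1 - z + z\<^sup>2 / 2) * (1 + z + z\<^sup>2 / 2)"
        using that by (simp add: field_simps power2_eq_square)
      also have "\<dots> \<le> (1 - z + z\<^sup>2 / 2) * exp z"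
      proof (rule mult_left_mono)
        show "0 \<le> 1 - z + z\<^sup>2 / 2" using sum_squares_ge_zero[of "1 - z" 1] by (simp add: power2_eq_square field_simps)
      qed (rule exp_lower_Taylor_quadratic[OF that])
      finally show "exp (- z) \<le> 1 - z + z\<^sup>2 / 2" by (simp add: exp_minus field_simps)
    qed (use exp_ge_add_one_self[of "- z"] in simp)
    from this[of "b\<^sup>2 / 2"] show ?thesis by (simp add: power2_eq_square eval_nat_numeral abs_le_iff)
  qed
  then have g: "cmod (complex_of_real (exp (- b\<^sup>2 / 2) - 1 + b\<^sup>2 / 2)) \<le> b ^ 4 / 8"
    by (simp only: norm_of_real)
  have "cmod (1 + \<i> * of_real (b * y)) \<le> 2"
  proof -
    have "\<bar>b * y\<bar> \<le> 1" unfolding abs_mult using assms by (intro mult_le_one) auto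
    then show ?thesis
      using norm_triangle_ineq[of 1 "\<i> * of_real (b * y)"] by (simp add: norm_mult)
  qed
  then have "cmod ((1 + \<i> * of_real (b * y)) * complex_of_real (exp (- b\<^sup>2 / 2) - 1 + b\<^sup>2 / 2)) \<le> 2 * (b ^ 4 / 8)"
    unfolding norm_mult using g by (intro mult_mono) auto
  then have f2: "cmod ((1 + \<i> * of_real (b * y)) * complex_of_real (exp (- b\<^sup>2 / 2) - 1 + b\<^sup>2 / 2)) \<le> \<bar>b\<bar> ^ 3 / 4"
    using b4 by linarith
  have "\<bar>y * b ^ 3 / 2\<bar> \<le> 1 * \<bar>b\<bar> ^ 3 / 2"
    using mult_right_mono[OF assms(2), of "\<bar>b\<bar> ^ 3"] by (simp add: abs_mult power_abs)
  then have f3: "cmod (\<i> * complex_of_real (y * b ^ 3 / 2)) \<le> \<bar>b\<bar> ^ 3 / 2"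
    by (simp only: norm_mult norm_ii norm_of_real)
  let ?c = "complex_of_real (cos b - 1 + b\<^sup>2 / 2)" and ?s = "\<i> * complex_of_real (y * (sin b - b))"
    and ?f1 = "(iexp (b * y) - (1 + \<i> * of_real (b * y))) * of_real (exp (- b\<^sup>2 / 2))"
    and ?f2 = "(1 + \<i> * of_real (b * y)) * complex_of_real (exp (- b\<^sup>2 / 2) - 1 + b\<^sup>2 / 2)"
    and ?f3 = "\<i> * complex_of_real (y * b ^ 3 / 2)"
  \<comment> \<open>Exact telescoping through the Taylor polynomials, with \<open>s\<close> for the
    sine, \<open>e\<close> for the character and \<open>r\<close> for the Gaussian factor. The
    product \<open>(1 + \<i> * b * y) * (1 - b^2 / 2)\<close> contains a term of third order, which
    the last summand compensates.\<close>
  have alg: "c + \<i> * (y * s) - e * r = (c - 1 + b\<^sup>2 / 2) + \<i> * (y * (s - b)) - (e - (1 + \<i> * (b * y))) * r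
      - (1 + \<i> * (b * y)) * (r - 1 + b\<^sup>2 / 2) + \<i> * (y * b ^ 3 / 2)" for c y s e r b :: complex
    by (simp add: field_simps power2_eq_square power3_eq_cube)
  have tri: "cmod (a + s - f - g + h) \<le> cmod a + cmod s + cmod f + cmod g + cmod h" for a s f g h :: complex
    using norm_triangle_ineq[of "a + s - f - g" h] norm_triangle_ineq4[of "a + s - f" g]
      norm_triangle_ineq4[of "a + s" f] norm_triangle_ineq[of a s] by linarith
  have E: "exp (- (complex_of_real b)\<^sup>2 / 2) = of_real (exp (- b\<^sup>2 / 2))"
    by (simp flip: exp_of_real)
  have eq: "complex_of_real (cos b) + \<i> * of_real (y * sin b) - iexp (b * y) * exp (- (of_real b)\<^sup>2 / 2)
      = ?c + ?s - ?f1 - ?f2 + ?f3"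
    unfolding E using alg[of "of_real (cos b)" "of_real y" "of_real (sin b)" "iexp (b * y)"
      "of_real (exp (- b\<^sup>2 / 2))" "of_real b"] by simp
  have "cmod (complex_of_real (cos b) + \<i> * of_real (y * sin b) - iexp (b * y) * exp (- (of_real b)\<^sup>2 / 2))
      \<le> cmod ?c + cmod ?s + cmod ?f1 + cmod ?f2 + cmod ?f3"
    unfolding eq by (rule tri)
  also have "\<dots> \<le> \<bar>b\<bar> ^ 3 / 6 + \<bar>b\<bar> ^ 3 / 6 + b\<^sup>2 * y\<^sup>2 + \<bar>b\<bar> ^ 3 / 4 + \<bar>b\<bar> ^ 3 / 2"
    by (rule add_mono[OF add_mono[OF add_mono[OF add_mono[OF c s] f1] f2] f3])
  also have "\<dots> \<le> 2 * \<bar>b\<bar> ^ 3 + b\<^sup>2 * y\<^sup>2" by simp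
  finally show ?thesis .
qed

lemma norm_square_vec: "(norm (b :: real ^ 'n))\<^sup>2 = (\<Sum>v\<in>UNIV. (b $ v)\<^sup>2)"
  by (simp add: norm_vec_def L2_set_def sum_nonneg)

section \<open>Independence of the past and of the drivers of the next step\<close>

context erwg
begin

text \<open>Step \<open>m + 1\<close> reads the drivers of index \<open>m\<close>, so the steps up
  to \<open>n\<close> use, besides the initial signs, only indices below \<open>n\<close>. The
  drivers of index \<open>n\<close> are collected in \<open>block n v\<close> and are reserved for
  step \<open>n + 1\<close>.\<close>

definition past :: "nat \<Rightarrow> 'v driver set" where
  "past n = {Init v | v. True} \<union> {Xi m v | m v. 1 \<le> m \<and> m < n} \<union> {Mem m v | m v. 1 \<le> m \<and> m < n}
     \<union> {Nbr m v | m v. 1 \<le> m \<and> m < n}"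

definition block :: "nat \<Rightarrow> 'v \<Rightarrow> 'v driver set" where
  "block n v = {Xi n v, Mem n v, Nbr n v}"

definition driver_algebra :: "'v driver set \<Rightarrow> 'a measure" where
  "driver_algebra I = sigma (space M) (\<Union>i\<in>I. driver_events M \<sigma> \<xi> D u i)"

lemma driver_events_space: "driver_events M \<sigma> \<xi> D u i \<subseteq> Pow (space M)"
  by (cases i) (use sets.sets_into_space in \<open>fastforce simp: space_vimage_algebra\<close>)+

lemma Int_stable_driver_events: "Int_stable (driver_events M \<sigma> \<xi> D u i)"
  by (cases i) (simp_all add: Int_stable_sets)

lemma sets_driver_algebra:
  "sets (driver_algebra I) = sigma_sets (space M) (\<Union>i\<in>I. driver_events M \<sigma> \<xi> D u i)"
  unfolding driver_algebra_def using driver_events_space by (intro sets_measure_of) auto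

lemma space_driver_algebra [simp]: "space (driver_algebra I) = space M"
  unfolding driver_algebra_def by (intro space_measure_of) (use driver_events_space in auto)

lemma driver_algebra_subset_events:
  assumes "I \<subseteq> driver_indices"
  shows "sets (driver_algebra I) \<subseteq> events"
  unfolding sets_driver_algebra
  using assms drivers_indep by (intro sets.sigma_sets_subset) (auto simp: indep_sets_def)

lemma measurable_driver_algebraI:
  assumes "\<And>A. f -` A \<inter> space M \<in> driver_events M \<sigma> \<xi> D u i" "i \<in> I"
  shows "f \<in> measurable (driver_algebra I) (count_space UNIV)"
proof (rule measurableI)
  fix A
  have "f -` A \<inter> space M \<in> (\<Union>i\<in>I. driver_events M \<sigma> \<xi> D u i)" using assms by blast
  then show "f -` A \<inter> space (driver_algebra I) \<in> sets (driver_algebra I)"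
    unfolding sets_driver_algebra by (auto intro: sigma_sets.Basic)
qed auto

lemma measurable_driver:
  "Init v \<in> I \<Longrightarrow> \<sigma> v \<in> measurable (driver_algebra I) (count_space UNIV)"
  "Xi n v \<in> I \<Longrightarrow> \<xi> n v \<in> measurable (driver_algebra I) (count_space UNIV)"
  "Mem n v \<in> I \<Longrightarrow> D n v \<in> measurable (driver_algebra I) (count_space UNIV)"
  "Nbr n v \<in> I \<Longrightarrow> u n v \<in> measurable (driver_algebra I) (count_space UNIV)"
  by (rule measurable_driver_algebraI; simp add: in_vimage_algebra)+

abbreviation X :: "nat \<Rightarrow> 'v \<Rightarrow> 'a \<Rightarrow> int" where
  "X n v \<omega> \<equiv> erwg_step \<sigma> \<xi> D u \<omega> n v"

text \<open>The recursion evaluates an earlier step at a random time and a random vertex. Both are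
  first frozen at \<open>d\<close> and \<open>w\<close>, and the countable composition rule then
  puts the random values back. The guard on \<open>D\<close> keeps \<open>d\<close> below the
  current time, as the induction hypothesis demands.\<close>

lemma X_measurable_past: "m \<le> n \<Longrightarrow> X m v \<in> measurable (driver_algebra (past n)) (count_space UNIV)"
proof (induction m arbitrary: v rule: less_induct)
  case (less m)
  consider "m = 0" | "m = Suc 0" | k where "m = Suc (Suc k)"
    by (cases m) (auto, metis not0_implies_Suc)
  then show ?case
  proof cases
    case 1
    then show ?thesis by simp
  next
    case 2
    then show ?thesis using measurable_driver(1)[of v "past n"] by (simp add: past_def)
  next
    case (3 k)
    have D: "D (Suc k) v \<in> measurable (driver_algebra (past n)) (count_space UNIV)"
      and u: "u (Suc k) v \<in> measurable (driver_algebra (past n)) (count_space UNIV)"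
      and xi: "\<xi> (Suc k) v \<in> measurable (driver_algebra (past n)) (count_space UNIV)"
      using less.prems 3 by (auto intro!: measurable_driver simp: past_def)
    have "(\<lambda>\<omega>. if d \<in> {1..Suc k} then \<xi> (Suc k) v \<omega> * X d w \<omega> else 0)
        \<in> measurable (driver_algebra (past n)) (count_space UNIV)" for d w
    proof (cases "d \<in> {1..Suc k}")
      case True
      have "X d w \<in> measurable (driver_algebra (past n)) (count_space UNIV)"
        using True 3 less.prems by (intro less.IH) auto
      then have "(\<lambda>\<omega>. \<xi> (Suc k) v \<omega> * X d w \<omega>) \<in> measurable (driver_algebra (past n)) (count_space UNIV)"
        using xi by measurable
      then show ?thesis using True by simp
    qed auto
    then have "(\<lambda>\<omega>. if d \<in> {1..Suc k} then \<xi> (Suc k) v \<omega> * X d (u (Suc k) v \<omega>) \<omega> else 0)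
        \<in> measurable (driver_algebra (past n)) (count_space UNIV)" for d
      by (rule measurable_compose_countable[OF _ u])
    then have "(\<lambda>\<omega>. if D (Suc k) v \<omega> \<in> {1..Suc k}
          then \<xi> (Suc k) v \<omega> * X (D (Suc k) v \<omega>) (u (Suc k) v \<omega>) \<omega> else 0)
        \<in> measurable (driver_algebra (past n)) (count_space UNIV)"
      by (rule measurable_compose_countable[OF _ D])
    then show ?thesis using 3 by simp
  qed
qed

lemma past_subset: "past n \<subseteq> driver_indices"
  by (auto simp: past_def driver_indices_def)

lemma block_subset: "n \<ge> 1 \<Longrightarrow> block n v \<subseteq> driver_indices"
  by (auto simp: block_def driver_indices_def)

lemma X_measurable [measurable]: "X n v \<in> measurable M (count_space UNIV)"
proof -
  have "X n v \<in> measurable (driver_algebra (past n)) (count_space UNIV)"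
    by (rule X_measurable_past) simp
  then show ?thesis
    using driver_algebra_subset_events[OF past_subset, of n] by (auto simp: measurable_def)
qed

text \<open>Grouping independent drivers into disjoint classes preserves independence. In the index
  type of the classes, \<open>None\<close> stands for the past and \<open>Some v\<close> for the
  block of vertex \<open>v\<close>.\<close>

lemma prob_past_Int_blocks:
  assumes n: "n \<ge> 1" and A: "A \<in> sets (driver_algebra (past n))"
    and F: "\<And>v. F v \<in> sets (driver_algebra (block n v))"
  shows "prob (A \<inter> (\<Inter>v. F v)) = prob A * (\<Prod>v\<in>UNIV. prob (F v))"
proof -
  define I where "I j = (case j of None \<Rightarrow> past n | Some v \<Rightarrow> block n v)" for j
  have sub: "(\<Union>j\<in>UNIV. I j) \<subseteq> driver_indices"
  proof (rule UN_least)
    show "I j \<subseteq> driver_indices" for j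
      using past_subset[of n] block_subset[OF n] by (cases j) (simp_all add: I_def)
  qed
  have "indep_sets (\<lambda>j. sigma_sets (space M) (\<Union>i\<in>I j. driver_events M \<sigma> \<xi> D u i)) UNIV"
  proof (rule indep_sets_collect_sigma)
    show "indep_sets (driver_events M \<sigma> \<xi> D u) (\<Union>j\<in>UNIV. I j)"
      by (rule indep_sets_mono_index[OF sub drivers_indep])
    show "disjoint_family_on I UNIV"
      by (auto simp: disjoint_family_on_def I_def past_def block_def split: option.splits)
  qed (rule Int_stable_driver_events)
  then have ind: "indep_sets (\<lambda>j. sets (driver_algebra (I j))) UNIV"
    by (simp add: sets_driver_algebra)
  define G where "G j = (case j of None \<Rightarrow> A | Some v \<Rightarrow> F v)" for j
  have "prob (\<Inter>j\<in>UNIV. G j) = (\<Prod>j\<in>UNIV. prob (G j))"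
    by (rule indep_setsD[OF ind]) (use A F in \<open>auto simp: G_def I_def split: option.splits\<close>)
  then show ?thesis
    by (simp add: UNIV_option_conv G_def prod.reindex)
qed

definition signs :: "int set" where "signs = {-1, 1}"

lemma prob_distr_eq:
  assumes "Z \<in> measurable M (count_space UNIV)"
  shows "prob {\<omega>\<in>space M. Z \<omega> = s} = measure (distr M (count_space UNIV) Z) {s}"
  using assms by (subst measure_distr) (auto simp: vimage_def intro!: arg_cong[where f = prob])

text \<open>The affine form in \<open>s\<close> covers both signs and can be averaged linearly over
  times and neighbours in \<open>prob_block_step\<close>.\<close>

lemma rademacher_prob:
  assumes "Z \<in> measurable M (count_space UNIV)"
    and "distr M (count_space UNIV) Z = measure_pmf (rademacher_pmf r)" "r \<in> {0..1}" "s \<in> signs"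
  shows "prob {\<omega>\<in>space M. Z \<omega> = s} = (1 + s * (2 * r - 1)) / 2"
proof -
  have "measure_pmf.prob (rademacher_pmf r) {s} = (1 + s * (2 * r - 1)) / 2"
  proof -
    have "pmf (rademacher_pmf r) s = pmf (bernoulli_pmf r) (s = 1)"
    proof -
      have s: "s = (if s = 1 then 1 else -1)" using assms(4) by (auto simp: signs_def)
      have "inj (\<lambda>b. if b then 1 else (-1::int))" by (auto simp: inj_def)
      then show ?thesis unfolding rademacher_pmf_def
        using pmf_map_inj'[of "\<lambda>b. if b then 1 else (-1::int)" "bernoulli_pmf r" "s = 1"] s by simp
    qed
    then show ?thesis using assms(3,4) by (auto simp: signs_def measure_pmf_single field_simps)
  qed
  then show ?thesis unfolding prob_distr_eq[OF assms(1)] assms(2) .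
qed

lemma AE_distr_pmf:
  assumes "Z \<in> measurable M (count_space UNIV)" "distr M (count_space UNIV) Z = measure_pmf P"
    "set_pmf P \<subseteq> A"
  shows "AE \<omega> in M. Z \<omega> \<in> A"
proof -
  have "AE x in distr M (count_space UNIV) Z. x \<in> A"
    unfolding assms(2) using assms(3) by (auto simp: AE_measure_pmf_iff)
  then show ?thesis using assms(1) by (subst (asm) AE_distr_iff) auto
qed

lemma set_rademacher: "set_pmf (rademacher_pmf r) \<subseteq> signs"
  by (auto simp: rademacher_pmf_def signs_def)

lemma in_nbrs_nonempty: "in_nbrs E v \<noteq> {}"
  using in_degree[of v] by auto

lemma AE_drivers:
  "AE \<omega> in M. (\<forall>v. \<sigma> v \<omega> \<in> signs) \<and>
     (\<forall>n\<ge>1. \<forall>v. \<xi> n v \<omega> \<in> signs \<and> D n v \<omega> \<in> {1..n} \<and> u n v \<omega> \<in> in_nbrs E v)"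
proof -
  have "AE \<omega> in M. \<forall>v\<in>UNIV. \<sigma> v \<omega> \<in> signs"
    by (rule AE_finite_allI) (auto intro: AE_distr_pmf[OF sigma_rv sigma_law set_rademacher])
  moreover have "AE \<omega> in M. \<forall>n. \<forall>v\<in>UNIV. n \<ge> 1 \<longrightarrow>
      \<xi> n v \<omega> \<in> signs \<and> D n v \<omega> \<in> {1..n} \<and> u n v \<omega> \<in> in_nbrs E v"
    unfolding AE_all_countable
  proof (intro allI AE_finite_allI)
    fix n v
    show "AE \<omega> in M. n \<ge> 1 \<longrightarrow> \<xi> n v \<omega> \<in> signs \<and> D n v \<omega> \<in> {1..n} \<and> u n v \<omega> \<in> in_nbrs E v"
    proof (cases "n \<ge> 1")
      case True
      then show ?thesis
        using AE_distr_pmf[OF xi_rv[OF True] xi_law[OF True] set_rademacher, of v]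
          AE_distr_pmf[OF D_rv[OF True] D_law[OF True], of "{1..n}" v]
          AE_distr_pmf[OF u_rv[OF True] u_law[OF True], of v "in_nbrs E v"] in_nbrs_nonempty[of v]
        by (auto simp: set_pmf_of_set)
    qed simp
  qed simp
  ultimately show ?thesis by eventually_elim auto
qed

lemma signs_mult: "a \<in> signs \<Longrightarrow> b \<in> signs \<Longrightarrow> a * b \<in> signs"
  by (auto simp: signs_def)

lemma AE_X_signs: "AE \<omega> in M. \<forall>n\<ge>1. \<forall>v. X n v \<omega> \<in> signs"
  using AE_drivers
proof eventually_elim
  case (elim \<omega>)
  have "n \<ge> 1 \<Longrightarrow> X n v \<omega> \<in> signs" for n v
  proof (induction n arbitrary: v rule: less_induct)
    case (less n)
    then consider "n = Suc 0" | k where "n = Suc (Suc k)"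
      by (cases n) (auto, metis not0_implies_Suc)
    then show ?case
    proof cases
      case (2 k)
      have "D (Suc k) v \<omega> \<in> {1..Suc k}" "\<xi> (Suc k) v \<omega> \<in> signs" using elim by auto
      then show ?thesis using 2 less.IH[of "D (Suc k) v \<omega>"] by (auto intro!: signs_mult)
    qed (use elim in auto)
  qed
  then show ?case by blast
qed

text \<open>Conditional mean of step \<open>n + 1\<close> at \<open>v\<close> given the history
  \<open>h\<close>: the mean \<open>2 * p v - 1\<close> of \<open>\<xi>\<close> times the average of
  \<open>h\<close> over the uniform choice of a time and of an in-neighbour.\<close>

definition mean_step :: "nat \<Rightarrow> (nat \<Rightarrow> 'v \<Rightarrow> int) \<Rightarrow> 'v \<Rightarrow> real" where
  "mean_step n h v = (2 * p v - 1) / (n * card (in_nbrs E v)) * (\<Sum>d=1..n. \<Sum>w\<in>in_nbrs E v. of_int (h d w))"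

lemma prob_driver_block:
  assumes n: "n \<ge> 1" and d: "d \<in> {1..n}" and w: "w \<in> in_nbrs E v" and s: "s \<in> signs"
  shows "prob {\<omega>\<in>space M. D n v \<omega> = d \<and> u n v \<omega> = w \<and> \<xi> n v \<omega> = s}
    = 1 / n * (1 / card (in_nbrs E v)) * ((1 + s * (2 * p v - 1)) / 2)"
proof -
  \<comment> \<open>A block contains exactly one driver of each of the three kinds, so the
    constructor alone selects the event.\<close>
  define F where "F i = (case i of Mem _ _ \<Rightarrow> {\<omega>\<in>space M. D n v \<omega> = d}
    | Nbr _ _ \<Rightarrow> {\<omega>\<in>space M. u n v \<omega> = w} | _ \<Rightarrow> {\<omega>\<in>space M. \<xi> n v \<omega> = s})" for i :: "'v driver"
  have eq: "{\<omega>\<in>space M. Z \<omega> = c} = Z -` {c} \<inter> space M" for Z :: "'a \<Rightarrow> 'z" and c by auto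
  have "prob (\<Inter>i\<in>block n v. F i) = (\<Prod>i\<in>block n v. prob (F i))"
    by (rule indep_setsD[OF drivers_indep block_subset[OF n]])
      (auto simp: block_def F_def eq intro!: in_vimage_algebra)
  also have "(\<Inter>i\<in>block n v. F i) = {\<omega>\<in>space M. D n v \<omega> = d \<and> u n v \<omega> = w \<and> \<xi> n v \<omega> = s}"
    by (auto simp: block_def F_def)
  also have "(\<Prod>i\<in>block n v. prob (F i)) = prob {\<omega>\<in>space M. D n v \<omega> = d} *
      prob {\<omega>\<in>space M. u n v \<omega> = w} * prob {\<omega>\<in>space M. \<xi> n v \<omega> = s}"
    by (simp add: block_def F_def mult_ac)
  also have "prob {\<omega>\<in>space M. D n v \<omega> = d} = 1 / n"
    unfolding prob_distr_eq[OF D_rv[OF n]] D_law[OF n] using d n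
    by (simp add: measure_pmf_single pmf_of_set)
  also have "prob {\<omega>\<in>space M. u n v \<omega> = w} = 1 / card (in_nbrs E v)"
    unfolding prob_distr_eq[OF u_rv[OF n]] u_law[OF n] using w in_nbrs_nonempty
    by (simp add: measure_pmf_single pmf_of_set)
  also have "prob {\<omega>\<in>space M. \<xi> n v \<omega> = s} = (1 + s * (2 * p v - 1)) / 2"
    by (rule rademacher_prob[OF xi_rv[OF n] xi_law[OF n] p_range s])
  finally show ?thesis .
qed

text \<open>Stated for an arbitrary \<open>N\<close> because it is needed in \<open>M\<close> and in
  the algebra of a single block.\<close>

lemma block_step_event:
  assumes "D n v \<in> measurable N (count_space UNIV)" "u n v \<in> measurable N (count_space UNIV)"
    "\<xi> n v \<in> measurable N (count_space UNIV)"
  shows "{\<omega>\<in>space N. D n v \<omega> \<in> {1..n} \<and> \<xi> n v \<omega> * h (D n v \<omega>) (u n v \<omega>) = x} \<in> sets N"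
proof -
  have "(\<lambda>\<omega>. d \<in> {1..n} \<and> \<xi> n v \<omega> * h d w = x) \<in> measurable N (count_space UNIV)" for d w
    using assms(3) by measurable
  then have "(\<lambda>\<omega>. d \<in> {1..n} \<and> \<xi> n v \<omega> * h d (u n v \<omega>) = x) \<in> measurable N (count_space UNIV)" for d
    by (rule measurable_compose_countable[OF _ assms(2)])
  then have "(\<lambda>\<omega>. D n v \<omega> \<in> {1..n} \<and> \<xi> n v \<omega> * h (D n v \<omega>) (u n v \<omega>) = x) \<in> measurable N (count_space UNIV)"
    by (rule measurable_compose_countable[OF _ assms(1)])
  then show ?thesis by measurable
qed

text \<open>Here \<open>h\<close> is a fixed pattern of signs; the random past enters only in
  \<open>prob_history_step\<close>. Summing over the values of the memory and neighbour variables
  leaves the average of an affine function of \<open>h\<close>, which is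
  \<open>mean_step\<close>.\<close>

lemma prob_block_step:
  assumes n: "n \<ge> 1" and h: "\<And>d w. d \<in> {1..n} \<Longrightarrow> h d w \<in> signs" and x: "x \<in> signs"
  shows "prob {\<omega>\<in>space M. D n v \<omega> \<in> {1..n} \<and> \<xi> n v \<omega> * h (D n v \<omega>) (u n v \<omega>) = x}
    = (1 + x * mean_step n h v) / 2" (is "prob ?A = _")
proof -
  note [measurable] = D_rv[OF n] u_rv[OF n] xi_rv[OF n]
  define F where "F = (\<lambda>(d, w). {\<omega>\<in>space M. D n v \<omega> = d \<and> u n v \<omega> = w \<and> \<xi> n v \<omega> = x * h d w})"
  have Fm: "F i \<in> events" for i by (cases i) (simp add: F_def)
  \<comment> \<open>A sign is its own inverse, so the condition on the product becomes a condition
    on the driver alone.\<close>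
  have inv: "\<xi> n v \<omega> * h d w = x \<longleftrightarrow> \<xi> n v \<omega> = x * h d w" if "d \<in> {1..n}" for d w \<omega>
    using h[OF that, of w] by (auto simp: signs_def)
  have "?A \<in> events" by (rule block_step_event) measurable
  moreover have "AE \<omega> in M. \<omega> \<in> ?A \<longleftrightarrow> \<omega> \<in> (\<Union>i\<in>{1..n} \<times> in_nbrs E v. F i)"
    using AE_drivers
  proof eventually_elim
    case (elim \<omega>)
    then have "D n v \<omega> \<in> {1..n}" "u n v \<omega> \<in> in_nbrs E v" using n by auto
    then show ?case using inv by (auto simp: F_def)
  qed
  ultimately have "prob ?A = prob (\<Union>i\<in>{1..n} \<times> in_nbrs E v. F i)"
    using Fm by (intro measure_eq_AE) auto
  also have "\<dots> = (\<Sum>i\<in>{1..n} \<times> in_nbrs E v. prob (F i))"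
    using Fm by (intro finite_measure_finite_Union) (auto simp: F_def disjoint_family_on_def)
  also have "\<dots> = (\<Sum>d=1..n. \<Sum>w\<in>in_nbrs E v. prob (F (d, w)))"
    by (simp add: sum.cartesian_product)
  also have "\<dots> = (\<Sum>d=1..n. \<Sum>w\<in>in_nbrs E v.
      1 / n * (1 / card (in_nbrs E v)) * ((1 + (x * h d w) * (2 * p v - 1)) / 2))"
    unfolding F_def
    using prob_driver_block[OF n _ _ signs_mult[OF x h]] by (intro sum.cong refl) auto
  also have "\<dots> = 1 / n * (1 / card (in_nbrs E v)) / 2 *
      (\<Sum>d=1..n. \<Sum>w\<in>in_nbrs E v. 1 + x * (2 * p v - 1) * h d w)"
    by (simp only: sum_distrib_left) (intro sum.cong refl, simp add: field_simps)
  also have "(\<Sum>d=1..n. \<Sum>w\<in>in_nbrs E v. 1 + x * (2 * p v - 1) * h d w)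
      = n * card (in_nbrs E v) + x * (2 * p v - 1) * (\<Sum>d=1..n. \<Sum>w\<in>in_nbrs E v. of_int (h d w))"
    by (simp add: sum.distrib sum_distrib_left)
  also have "1 / n * (1 / card (in_nbrs E v)) / 2 * \<dots> = (1 + x * mean_step n h v) / 2"
  proof -
    have alg: "1 / a * (1 / c) / 2 * (a * c + x * q * T) = (1 + x * (q / (a * c) * T)) / 2"
      if "a > 0" "c > 0" for a c x q T :: real using that by (simp add: field_simps)
    show ?thesis unfolding mean_step_def of_nat_mult
      by (rule alg) (use n in_degree[of v] in auto)
  qed
  finally show ?thesis .
qed


section \<open>Conditional law of a step given the history\<close>

definition walk_of :: "nat \<Rightarrow> (nat \<times> 'v \<Rightarrow> int) \<Rightarrow> real ^ 'v" where
  "walk_of n h = (\<chi> v. \<Sum>j = 1..n. of_int (h (j, v)))"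

text \<open>Extensional functions into the signs: almost every path up to time \<open>n\<close>
  agrees with exactly one of them, and there are finitely many, so conditioning on the past becomes
  a finite sum.\<close>

definition histories :: "nat \<Rightarrow> (nat \<times> 'v \<Rightarrow> int) set" where
  "histories n = PiE ({1..n} \<times> UNIV) (\<lambda>_. signs)"

definition sign_vectors :: "('v \<Rightarrow> int) set" where
  "sign_vectors = PiE UNIV (\<lambda>_. signs)"

definition history_event :: "nat \<Rightarrow> (nat \<times> 'v \<Rightarrow> int) \<Rightarrow> 'a set" where
  "history_event n h = {\<omega>\<in>space M. \<forall>i\<in>{1..n} \<times> UNIV. X (fst i) (snd i) \<omega> = h i}"

definition step_event :: "nat \<Rightarrow> ('v \<Rightarrow> int) \<Rightarrow> 'a set" where
  "step_event n x = {\<omega>\<in>space M. \<forall>v. X n v \<omega> = x v}"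

definition drift :: "nat \<Rightarrow> real ^ 'v \<Rightarrow> real ^ 'v" where
  "drift n s = (1 / n) *\<^sub>R (s v* memory_matrix E p)"

text \<open>Summing the history over time produces the walk, so the conditional mean of the next
  step sees the past only through the current position.\<close>

lemma mean_step_eq_drift: "mean_step n (\<lambda>d w. h (d, w)) v = drift n (walk_of n h) $ v"
proof -
  have "(\<Sum>i\<in>UNIV. walk_of n h $ i * memory_matrix E p $ i $ v)
      = (\<Sum>i\<in>in_nbrs E v. (2 * p v - 1) / card (in_nbrs E v) * walk_of n h $ i)"
    by (rule sum.mono_neutral_cong_right) (auto simp: memory_matrix_def in_nbrs_def)
  also have "\<dots> = (2 * p v - 1) / card (in_nbrs E v) * (\<Sum>i\<in>in_nbrs E v. \<Sum>j = 1..n. of_int (h (j, i)))"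
    by (simp add: sum_distrib_left walk_of_def)
  also have "(\<Sum>i\<in>in_nbrs E v. \<Sum>j = 1..n. real_of_int (h (j, i)))
      = (\<Sum>j = 1..n. \<Sum>i\<in>in_nbrs E v. of_int (h (j, i)))"
    by (rule sum.swap)
  finally show ?thesis
    unfolding mean_step_def drift_def vector_matrix_mult_def by simp
qed

lemma finite_signs [simp]: "finite signs" and finite_histories [simp]: "finite (histories n)"
  and finite_sign_vectors [simp]: "finite sign_vectors"
  by (auto simp: signs_def histories_def sign_vectors_def intro!: finite_PiE)

lemma history_event_past: "history_event n h \<in> sets (driver_algebra (past n))"
proof -
  have eq: "{\<omega>\<in>space N. f \<omega> = c} \<in> sets N" if "f \<in> measurable N (count_space UNIV)"
    for f :: "'a \<Rightarrow> int" and N c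
    using that by measurable
  have "{\<omega>\<in>space (driver_algebra (past n)). \<forall>i\<in>{1..n} \<times> UNIV. X (fst i) (snd i) \<omega> = h i}
      \<in> sets (driver_algebra (past n))"
  proof (rule sets.sets_Collect_finite_All)
    fix i :: "nat \<times> 'v" assume "i \<in> {1..n} \<times> UNIV"
    then show "{\<omega>\<in>space (driver_algebra (past n)). X (fst i) (snd i) \<omega> = h i} \<in> sets (driver_algebra (past n))"
      by (intro eq X_measurable_past) auto
  qed simp
  then show ?thesis by (simp add: history_event_def)
qed

lemma history_event_events [simp]: "history_event n h \<in> events"
  using history_event_past driver_algebra_subset_events[OF past_subset] by blast

lemma step_event_events [simp]: "step_event n x \<in> events"
  unfolding step_event_def by measurable

text \<open>On \<open>history_event n h\<close> the values that the next step reads can be replaced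
  by those of \<open>h\<close>. Up to a null set, the step then becomes an intersection of block
  events in which \<open>h\<close> is a constant, and these are independent of the past and of each
  other.\<close>

lemma prob_history_step:
  assumes n: "n \<ge> 1" and h: "h \<in> histories n" and x: "x \<in> sign_vectors"
  shows "prob (history_event n h \<inter> step_event (Suc n) x)
    = prob (history_event n h) * (\<Prod>v\<in>UNIV. (1 + x v * drift n (walk_of n h) $ v) / 2)"
proof -
  define F where "F v = {\<omega>\<in>space M. D n v \<omega> \<in> {1..n} \<and> \<xi> n v \<omega> * h (D n v \<omega>, u n v \<omega>) = x v}" for v
  have F: "F v \<in> sets (driver_algebra (block n v))" for v
    using block_step_event[of n v "driver_algebra (block n v)" "\<lambda>d w. h (d, w)" "x v"]
    by (auto simp: F_def block_def measurable_driver)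
  have Fe: "F v \<in> events" for v
    using F driver_algebra_subset_events[OF block_subset[OF n]] by blast
  have "prob (history_event n h \<inter> step_event (Suc n) x) = prob (history_event n h \<inter> (\<Inter>v. F v))"
  proof (rule measure_eq_AE)
    show "AE \<omega> in M. \<omega> \<in> history_event n h \<inter> step_event (Suc n) x \<longleftrightarrow>
        \<omega> \<in> history_event n h \<inter> (\<Inter>v. F v)"
      using AE_drivers AE_space
    proof eventually_elim
      case (elim \<omega>)
      obtain k where k: "n = Suc k" using n by (cases n) auto
      have "X (Suc n) v \<omega> = \<xi> n v \<omega> * X (D n v \<omega>) (u n v \<omega>) \<omega>" "D n v \<omega> \<in> {1..n}" for v
        using elim n unfolding k by auto
      then show ?case using elim(2) by (auto simp: history_event_def step_event_def F_def)
    qed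
  qed (use Fe in \<open>auto intro!: sets.Int sets.finite_INT\<close>)
  also have "\<dots> = prob (history_event n h) * (\<Prod>v\<in>UNIV. prob (F v))"
    by (rule prob_past_Int_blocks[OF n history_event_past F])
  also have "(\<Prod>v\<in>UNIV. prob (F v)) = (\<Prod>v\<in>UNIV. (1 + x v * drift n (walk_of n h) $ v) / 2)"
  proof (rule prod.cong)
    fix v
    have "prob (F v) = (1 + x v * mean_step n (\<lambda>d w. h (d, w)) v) / 2"
      unfolding F_def
      by (rule prob_block_step[OF n]) (use h x in \<open>auto simp: histories_def sign_vectors_def PiE_iff\<close>)
    then show "prob (F v) = (1 + x v * drift n (walk_of n h) $ v) / 2"
      by (simp add: mean_step_eq_drift)
  qed simp
  finally show ?thesis .
qed

abbreviation S :: "nat \<Rightarrow> 'a \<Rightarrow> real ^ 'v" where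
  "S n \<omega> \<equiv> erwg_walk \<sigma> \<xi> D u n \<omega>"

text \<open>The functional \<open>F\<close> is quantified inside the almost-sure statement so that
  it may depend on the outcome; \<open>expectation_step\<close> uses it with the next step plugged
  in.\<close>

lemma AE_indicator_history:
  shows "AE \<omega> in M. \<forall>F. F (S n \<omega>) = (\<Sum>h\<in>histories n. indicat_real (history_event n h) \<omega> *\<^sub>R (F (walk_of n h) :: 'c::real_vector))"
  using AE_X_signs AE_space
proof eventually_elim
  case (elim \<omega>)
  define g where "g = restrict (\<lambda>i. X (fst i) (snd i) \<omega>) ({1..n} \<times> UNIV)"
  have g: "g \<in> histories n" using elim by (auto simp: g_def histories_def)
  have mem: "\<omega> \<in> history_event n h \<longleftrightarrow> h = g" if h: "h \<in> histories n" for h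
  proof
    assume w: "\<omega> \<in> history_event n h"
    show "h = g"
    proof (rule PiE_ext[OF h[unfolded histories_def] g[unfolded histories_def]])
      show "h i = g i" if "i \<in> {1..n} \<times> UNIV" for i
        using w that by (cases i) (auto simp: history_event_def g_def)
    qed
  next
    assume "h = g"
    then show "\<omega> \<in> history_event n h" using elim(2) by (simp add: history_event_def g_def)
  qed
  have "(\<Sum>h\<in>histories n. indicat_real (history_event n h) \<omega> *\<^sub>R F (walk_of n h))
      = (\<Sum>h\<in>histories n. if h = g then F (walk_of n h) else 0)" for F :: "real ^ 'v \<Rightarrow> 'c"
    by (intro sum.cong) (auto simp: mem)
  moreover have "walk_of n g = S n \<omega>"
    by (simp add: walk_of_def erwg_walk_def g_def vec_eq_iff)
  ultimately show ?case using g by simp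
qed

lemma AE_indicator_step:
  assumes "n \<ge> 1"
  shows "AE \<omega> in M. \<forall>F. F (\<lambda>v. X n v \<omega>) =
    (\<Sum>x\<in>sign_vectors. indicat_real (step_event n x) \<omega> *\<^sub>R (F x :: 'c::real_vector))"
  using AE_X_signs AE_space
proof eventually_elim
  case (elim \<omega>)
  define g where "g = (\<lambda>v. X n v \<omega>)"
  have g: "g \<in> sign_vectors" using elim assms by (auto simp: g_def sign_vectors_def)
  have "(\<Sum>x\<in>sign_vectors. indicat_real (step_event n x) \<omega> *\<^sub>R F x)
      = (\<Sum>x\<in>sign_vectors. if x = g then F x else 0)" for F :: "('v \<Rightarrow> int) \<Rightarrow> 'c"
    using elim by (intro sum.cong) (auto simp: step_event_def g_def indicator_def)
  then show ?case using g by (simp add: g_def)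
qed

text \<open>Given the past, the coordinates of the next step are independent signs with mean given by the
  drift.\<close>

lemma expectation_step:
  fixes F :: "real ^ 'v \<Rightarrow> ('v \<Rightarrow> int) \<Rightarrow> 'c::{banach, second_countable_topology}"
  assumes n: "n \<ge> 1"
  defines "G \<equiv> \<lambda>s. \<Sum>x\<in>sign_vectors. (\<Prod>v\<in>UNIV. (1 + x v * drift n s $ v) / 2) *\<^sub>R F s x"
  assumes [measurable]: "(\<lambda>\<omega>. F (S n \<omega>) (\<lambda>v. X (Suc n) v \<omega>)) \<in> borel_measurable M"
    "(\<lambda>\<omega>. G (S n \<omega>)) \<in> borel_measurable M"
  shows "(\<integral>\<omega>. F (S n \<omega>) (\<lambda>v. X (Suc n) v \<omega>) \<partial>M) = (\<integral>\<omega>. G (S n \<omega>) \<partial>M)"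
proof -
  let ?H = "history_event n" and ?E = "step_event (Suc n)"
  let ?P = "\<lambda>h x. \<Prod>v\<in>UNIV. (1 + real_of_int (x v) * drift n (walk_of n h) $ v) / 2"
  have int: "integrable M (\<lambda>\<omega>. indicat_real A \<omega> *\<^sub>R (c::'c))" if "A \<in> events" for A c
    using that by (intro integrable_scaleR_left) (auto simp: integrable_indicator_iff emeasure_eq_measure)
  have ind_meas: "(\<lambda>\<omega>. indicat_real A \<omega> *\<^sub>R (c::'c)) \<in> borel_measurable M" if "A \<in> events" for A c
    using int[OF that] by (rule borel_measurable_integrable)
  have val: "(\<integral>\<omega>. indicat_real A \<omega> *\<^sub>R (c::'c) \<partial>M) = prob A *\<^sub>R c" if "A \<in> events" for A c
    using that by (subst integral_scaleR_left) (auto simp: integrable_indicator_iff emeasure_eq_measure)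
  have "(\<integral>\<omega>. F (S n \<omega>) (\<lambda>v. X (Suc n) v \<omega>) \<partial>M)
      = (\<integral>\<omega>. (\<Sum>h\<in>histories n. \<Sum>x\<in>sign_vectors. indicat_real (?H h \<inter> ?E x) \<omega> *\<^sub>R F (walk_of n h) x) \<partial>M)"
  proof (rule integral_cong_AE)
    have "AE \<omega> in M. \<forall>f :: ('v \<Rightarrow> int) \<Rightarrow> 'c. f (\<lambda>v. X (Suc n) v \<omega>) =
        (\<Sum>x\<in>sign_vectors. indicat_real (?E x) \<omega> *\<^sub>R f x)"
      by (rule AE_indicator_step) simp
    moreover have "AE \<omega> in M. \<forall>f :: real ^ 'v \<Rightarrow> 'c. f (S n \<omega>) =
        (\<Sum>h\<in>histories n. indicat_real (?H h) \<omega> *\<^sub>R f (walk_of n h))"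
      by (rule AE_indicator_history)
    ultimately show "AE \<omega> in M. F (S n \<omega>) (\<lambda>v. X (Suc n) v \<omega>) =
        (\<Sum>h\<in>histories n. \<Sum>x\<in>sign_vectors. indicat_real (?H h \<inter> ?E x) \<omega> *\<^sub>R F (walk_of n h) x)"
    proof eventually_elim
      case (elim \<omega>)
      have "F (S n \<omega>) (\<lambda>v. X (Suc n) v \<omega>)
          = (\<Sum>h\<in>histories n. indicat_real (?H h) \<omega> *\<^sub>R F (walk_of n h) (\<lambda>v. X (Suc n) v \<omega>))"
        by (rule elim(2)[rule_format])
      also have "\<dots> = (\<Sum>h\<in>histories n. indicat_real (?H h) \<omega> *\<^sub>R
          (\<Sum>x\<in>sign_vectors. indicat_real (?E x) \<omega> *\<^sub>R F (walk_of n h) x))"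
        by (intro sum.cong refl arg_cong2[where f = scaleR] elim(1)[rule_format])
      also have "\<dots> = (\<Sum>h\<in>histories n. \<Sum>x\<in>sign_vectors. indicat_real (?H h \<inter> ?E x) \<omega> *\<^sub>R F (walk_of n h) x)"
        unfolding scaleR_sum_right by (intro sum.cong refl) (simp add: indicator_inter_arith)
      finally show ?case .
    qed
  qed (use assms(3) in \<open>auto intro!: borel_measurable_sum ind_meas sets.Int simp del: sum_indicator_scaleR\<close>)
  also have "\<dots> = (\<Sum>h\<in>histories n. \<Sum>x\<in>sign_vectors. prob (?H h \<inter> ?E x) *\<^sub>R F (walk_of n h) x)"
    by (simp add: Bochner_Integration.integral_sum int val integrable_sum sets.Int del: sum_indicator_scaleR)
  \<comment> \<open>The conditional law and \<open>F\<close> depend on \<open>h\<close> only through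
    \<open>walk_of n h\<close>, so the inner sum is \<open>G\<close> at the current
    position.\<close>
  also have "\<dots> = (\<Sum>h\<in>histories n. prob (?H h) *\<^sub>R G (walk_of n h))"
    unfolding G_def scaleR_sum_right by (intro sum.cong refl) (simp add: prob_history_step[OF n])
  also have "\<dots> = (\<integral>\<omega>. (\<Sum>h\<in>histories n. indicat_real (?H h) \<omega> *\<^sub>R G (walk_of n h)) \<partial>M)"
    by (simp add: Bochner_Integration.integral_sum int val del: sum_indicator_scaleR)
  also have "\<dots> = (\<integral>\<omega>. G (S n \<omega>) \<partial>M)"
  proof (rule integral_cong_AE)
    have "AE \<omega> in M. \<forall>f :: real ^ 'v \<Rightarrow> 'c. f (S n \<omega>) =
        (\<Sum>h\<in>histories n. indicat_real (?H h) \<omega> *\<^sub>R f (walk_of n h))"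
      by (rule AE_indicator_history)
    then show "AE \<omega> in M. (\<Sum>h\<in>histories n. indicat_real (?H h) \<omega> *\<^sub>R G (walk_of n h)) = G (S n \<omega>)"
      by eventually_elim simp
  qed (use assms(4) in \<open>auto intro!: borel_measurable_sum ind_meas simp del: sum_indicator_scaleR\<close>)
  finally show ?thesis .
qed

lemma S_measurable [measurable]: "S n \<in> borel_measurable M"
  unfolding erwg_walk_def
  by (subst borel_measurable_euclidean_space) (auto simp: Basis_vec_def inner_axis)

lemma S_Suc: "S (Suc n) \<omega> = S n \<omega> + (\<chi> v. of_int (X (Suc n) v \<omega>))"
  by (simp add: erwg_walk_def vec_eq_iff)

lemma drift_measurable [measurable]: "drift n \<in> borel_measurable borel"
  unfolding drift_def transpose_matrix_vector[symmetric]
  by (intro borel_measurable_continuous_onI continuous_intros matrix_vector_mult_linear_continuous_on)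

lemma AE_S_le: "AE \<omega> in M. \<forall>v. \<bar>S n \<omega> $ v\<bar> \<le> n"
  using AE_X_signs
proof eventually_elim
  case (elim \<omega>)
  show ?case
  proof
    fix v
    have "\<bar>S n \<omega> $ v\<bar> \<le> (\<Sum>j=1..n. \<bar>real_of_int (X j v \<omega>)\<bar>)"
      unfolding erwg_walk_def by simp
    also have "\<dots> \<le> (\<Sum>j=1..n. 1)"
    proof (intro sum_mono)
      fix j assume "j \<in> {1..n}"
      then have "X j v \<omega> \<in> signs" using elim by auto
      then show "\<bar>real_of_int (X j v \<omega>)\<bar> \<le> 1" by (auto simp: signs_def)
    qed
    finally show "\<bar>S n \<omega> $ v\<bar> \<le> n" by simp
  qed
qed

text \<open>Column \<open>v\<close> of the memory matrix has absolute sum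
  \<open>\<bar>2 * p v - 1\<bar>\<close>, and each coordinate of the walk is at most
  \<open>n\<close>. The bound makes the weights \<open>(1 + x v * drift n s $ v) / 2\<close> genuine
  probabilities.\<close>

lemma AE_drift_le_1: "n \<ge> 1 \<Longrightarrow> AE \<omega> in M. \<forall>v. \<bar>drift n (S n \<omega>) $ v\<bar> \<le> 1"
  using AE_S_le[of n]
proof eventually_elim
  case (elim \<omega>)
  have S: "\<bar>S n \<omega> $ v\<bar> \<le> n" for v using elim(2) by blast
  show ?case
  proof
    fix v
    have "\<bar>\<Sum>i\<in>UNIV. S n \<omega> $ i * memory_matrix E p $ i $ v\<bar>
        \<le> (\<Sum>i\<in>UNIV. n * \<bar>memory_matrix E p $ i $ v\<bar>)"
      using S by (intro order.trans[OF sum_abs] sum_mono) (auto simp: abs_mult intro!: mult_right_mono)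
    also have "\<dots> = (\<Sum>i\<in>in_nbrs E v. n * \<bar>(2 * p v - 1) / card (in_nbrs E v)\<bar>)"
      by (rule sum.mono_neutral_cong_right) (auto simp: memory_matrix_def in_nbrs_def)
    also have "\<dots> = n * \<bar>2 * p v - 1\<bar>"
      using in_degree[of v] in_nbrs_nonempty[of v] by (simp add: abs_divide)
    also have "\<dots> \<le> n" using p_range[of v] by (intro mult_left_le) auto
    finally show "\<bar>drift n (S n \<omega>) $ v\<bar> \<le> 1"
      using elim(1) by (simp add: drift_def vector_matrix_mult_def abs_mult field_simps)
  qed
qed


section \<open>Expectations over independent signs with prescribed means\<close>

lemma sign_expectation_prod:
  fixes f :: "'v \<Rightarrow> int \<Rightarrow> 'c::real_normed_field" and y :: "'v \<Rightarrow> real"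
  shows "(\<Sum>x\<in>sign_vectors. (\<Prod>v\<in>UNIV. (1 + x v * y v) / 2) *\<^sub>R (\<Prod>v\<in>UNIV. f v (x v)))
    = (\<Prod>v\<in>UNIV. of_real ((1 + y v) / 2) * f v 1 + of_real ((1 - y v) / 2) * f v (-1))"
proof -
  have "(\<Sum>x\<in>sign_vectors. (\<Prod>v\<in>UNIV. (1 + x v * y v) / 2) *\<^sub>R (\<Prod>v\<in>UNIV. f v (x v)))
      = (\<Sum>x\<in>sign_vectors. \<Prod>v\<in>UNIV. of_real ((1 + x v * y v) / 2) * f v (x v))"
    by (simp only: scaleR_conv_of_real of_real_prod prod.distrib)
  \<comment> \<open>The distributive law for a product of sums, read backwards, expresses the
    independence of the coordinates.\<close>
  also have "\<dots> = (\<Prod>v\<in>UNIV. \<Sum>s\<in>signs. of_real ((1 + s * y v) / 2) * f v s)"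
    unfolding sign_vectors_def by (rule prod_sum_PiE[symmetric]) auto
  also have "\<dots> = (\<Prod>v\<in>UNIV. of_real ((1 + y v) / 2) * f v 1 + of_real ((1 - y v) / 2) * f v (-1))"
    by (simp add: signs_def add.commute)
  finally show ?thesis .
qed

lemma sign_expectation_one:
  fixes y :: "'v \<Rightarrow> real"
  shows "(\<Sum>x\<in>sign_vectors. (\<Prod>v\<in>UNIV. (1 + x v * y v) / 2)) = (1::real)"
  using sign_expectation_prod[of y "\<lambda>_ _. 1::real"] by (simp add: field_simps)

lemma sign_expectation_coordinate:
  fixes y :: "'v \<Rightarrow> real"
  shows "(\<Sum>x\<in>sign_vectors. (\<Prod>v\<in>UNIV. (1 + x v * y v) / 2) * of_int (x a)) = (y a :: real)"
proof -
  define f where "f v s = (if v = a then real_of_int s else 1)" for v s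
  have fx: "(\<Prod>v\<in>UNIV. f v (x v)) = of_int (x a)" for x by (simp add: f_def)
  have "(\<Prod>v\<in>UNIV. (1 + y v) / 2 * f v 1 + (1 - y v) / 2 * f v (-1)) = (\<Prod>v\<in>{a}. y v)"
    by (rule prod.mono_neutral_cong_right) (auto simp: f_def field_simps)
  then show ?thesis using sign_expectation_prod[of y f] by (simp add: fx)
qed

lemma sign_expectation_coordinates:
  fixes y :: "'v \<Rightarrow> real"
  shows "(\<Sum>x\<in>sign_vectors. (\<Prod>v\<in>UNIV. (1 + x v * y v) / 2) * (of_int (x a) * of_int (x b)))
    = (if a = b then 1 else y a * y b :: real)"
proof (cases "a = b")
  case True
  have "(\<Sum>x\<in>sign_vectors. (\<Prod>v\<in>UNIV. (1 + x v * y v) / 2) * (real_of_int (x a) * of_int (x b)))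
      = (\<Sum>x\<in>sign_vectors. (\<Prod>v\<in>UNIV. (1 + x v * y v) / 2))"
  proof (rule sum.cong)
    fix x assume "x \<in> sign_vectors"
    then have "x a \<in> signs" by (auto simp: sign_vectors_def)
    then show "(\<Prod>v\<in>UNIV. (1 + x v * y v) / 2) * (real_of_int (x a) * of_int (x b)) = (\<Prod>v\<in>UNIV. (1 + x v * y v) / 2)"
      using True by (auto simp: signs_def)
  qed simp
  then show ?thesis using True sign_expectation_one by simp
next
  case False
  define f where "f v s = (if v = a then real_of_int s else if v = b then real_of_int s else 1)" for v s
  have fx: "(\<Prod>v\<in>UNIV. f v (x v)) = of_int (x a) * of_int (x b)" for x
  proof -
    have "(\<Prod>v\<in>UNIV. f v (x v)) = (\<Prod>v\<in>{a, b}. f v (x v))"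
      by (rule prod.mono_neutral_right) (auto simp: f_def)
    then show ?thesis using False by (simp add: f_def)
  qed
  have "(\<Prod>v\<in>UNIV. (1 + y v) / 2 * f v 1 + (1 - y v) / 2 * f v (-1)) = (\<Prod>v\<in>{a, b}. y v)"
    by (rule prod.mono_neutral_cong_right) (auto simp: f_def field_simps)
  then show ?thesis
    using sign_expectation_prod[of y f] False by (simp add: fx)
qed

text \<open>The exact variance is the sum of \<open>(b v)^2 * (1 - (y v)^2)\<close>; discarding the
  negative part leaves a bound free of \<open>y\<close>.\<close>

lemma sign_expectation_square:
  fixes y :: "'v \<Rightarrow> real"
  shows "(\<Sum>x\<in>sign_vectors. (\<Prod>v\<in>UNIV. (1 + x v * y v) / 2) * (c + (\<Sum>v\<in>UNIV. b v * of_int (x v)))\<^sup>2)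
    \<le> (c + (\<Sum>v\<in>UNIV. b v * y v))\<^sup>2 + (\<Sum>v\<in>UNIV. (b v)\<^sup>2 :: real)"
proof -
  let ?P = "\<lambda>x. \<Prod>v\<in>UNIV. (1 + real_of_int (x v) * y v) / 2"
  have "(\<Sum>x\<in>sign_vectors. ?P x * (c + (\<Sum>v\<in>UNIV. b v * of_int (x v)))\<^sup>2)
      = (\<Sum>x\<in>sign_vectors. c\<^sup>2 * ?P x + 2 * c * (\<Sum>v\<in>UNIV. b v * (?P x * of_int (x v)))
         + (\<Sum>v\<in>UNIV. \<Sum>w\<in>UNIV. b v * b w * (?P x * (of_int (x v) * of_int (x w)))))"
  proof (rule sum.cong)
    fix x :: "'v \<Rightarrow> int"
    let ?s = "\<Sum>v\<in>UNIV. b v * real_of_int (x v)"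
    have "(\<Sum>v\<in>UNIV. b v * (?P x * of_int (x v))) = ?P x * ?s"
      unfolding sum_distrib_left by (intro sum.cong) auto
    moreover have "(\<Sum>v\<in>UNIV. \<Sum>w\<in>UNIV. b v * b w * (?P x * (of_int (x v) * of_int (x w)))) = ?P x * (?s * ?s)"
      unfolding sum_product unfolding sum_distrib_left by (intro sum.cong) auto
    ultimately show "?P x * (c + ?s)\<^sup>2 = c\<^sup>2 * ?P x + 2 * c * (\<Sum>v\<in>UNIV. b v * (?P x * of_int (x v)))
         + (\<Sum>v\<in>UNIV. \<Sum>w\<in>UNIV. b v * b w * (?P x * (of_int (x v) * of_int (x w))))"
      by (simp only:) (simp add: power2_eq_square algebra_simps)
  qed simp
  also have "\<dots> = c\<^sup>2 * (\<Sum>x\<in>sign_vectors. ?P x) + 2 * c * (\<Sum>v\<in>UNIV. b v * (\<Sum>x\<in>sign_vectors. ?P x * of_int (x v)))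
      + (\<Sum>v\<in>UNIV. \<Sum>w\<in>UNIV. b v * b w * (\<Sum>x\<in>sign_vectors. ?P x * (of_int (x v) * of_int (x w))))"
    unfolding sum.distrib sum_distrib_left
    by (subst (2 4 5) sum.swap) (simp only: sum.swap[of _ sign_vectors UNIV])
  also have "\<dots> = c\<^sup>2 + 2 * c * (\<Sum>v\<in>UNIV. b v * y v)
      + (\<Sum>v\<in>UNIV. \<Sum>w\<in>UNIV. b v * b w * (if v = w then 1 else y v * y w))"
    unfolding sign_expectation_one sign_expectation_coordinate sign_expectation_coordinates by simp
  also have "\<dots> \<le> c\<^sup>2 + 2 * c * (\<Sum>v\<in>UNIV. b v * y v)
      + (\<Sum>v\<in>UNIV. \<Sum>w\<in>UNIV. (b v * y v) * (b w * y w) + (if v = w then (b v)\<^sup>2 else 0))"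
    by (intro add_left_mono sum_mono) (auto simp: power2_eq_square)
  also have "\<dots> = (c + (\<Sum>v\<in>UNIV. b v * y v))\<^sup>2 + (\<Sum>v\<in>UNIV. (b v)\<^sup>2)"
    unfolding sum.distrib sum_product[symmetric] by (simp add: power2_eq_square algebra_simps)
  finally show ?thesis .
qed

lemma integrable_inner_S_square: "integrable M (\<lambda>\<omega>. (inner b (S n \<omega>))\<^sup>2)"
proof (rule integrable_const_bound)
  show "AE \<omega> in M. norm ((inner b (S n \<omega>))\<^sup>2) \<le> (\<Sum>v\<in>UNIV. \<bar>b $ v\<bar> * n)\<^sup>2"
    using AE_S_le[of n]
  proof eventually_elim
    case (elim \<omega>)
    have "\<bar>inner b (S n \<omega>)\<bar> \<le> (\<Sum>v\<in>UNIV. \<bar>b $ v\<bar> * n)"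
      unfolding inner_vec_def using elim
      by (intro order.trans[OF sum_abs] sum_mono) (auto simp: abs_mult intro!: mult_left_mono)
    then show ?case by (simp add: power2_eq_square abs_le_square_iff[symmetric] flip: power2_eq_square)
  qed
qed measurable

text \<open>Moving the memory matrix from the row vector \<open>s\<close> to the test vector is what
  turns the forward drift into a backward recursion for test vectors.\<close>

lemma drift_adjoint: "inner b (drift n s) = inner ((1 / n) *\<^sub>R (memory_matrix E p *v b)) s"
proof -
  have "inner b (drift n s) = (1 / n) * inner (s v* memory_matrix E p) b"
    by (simp add: drift_def inner_commute[of b])
  also have "\<dots> = (1 / n) * inner (memory_matrix E p *v b) s"
    unfolding dot_lmul_matrix by (simp add: inner_commute[of s])
  finally show ?thesis by simp
qed

text \<open>By \<open>drift_adjoint\<close>, the conditional mean of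
  \<open>inner b (S (Suc n) \<omega>)\<close> is the inner product of the updated vector with the
  present position, and the conditional variance is at most \<open>(norm b)^2\<close>.\<close>

lemma second_moment_step:
  assumes n: "n \<ge> 1"
  shows "expectation (\<lambda>\<omega>. (inner b (S (Suc n) \<omega>))\<^sup>2)
    \<le> expectation (\<lambda>\<omega>. (inner (b + (1 / n) *\<^sub>R (memory_matrix E p *v b)) (S n \<omega>))\<^sup>2) + (norm b)\<^sup>2"
proof -
  define F where "F s x = (inner b s + (\<Sum>v\<in>UNIV. b $ v * real_of_int (x v)))\<^sup>2" for s and x :: "'v \<Rightarrow> int"
  let ?G = "\<lambda>s. \<Sum>x\<in>sign_vectors. (\<Prod>v\<in>UNIV. (1 + x v * drift n s $ v) / 2) *\<^sub>R F s x"
  have dm [measurable]: "(\<lambda>s. drift n s $ v) \<in> borel_measurable borel" for v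
  proof -
    have "(\<lambda>x :: real ^ 'v. x $ v) \<in> borel_measurable borel"
      by (intro borel_measurable_continuous_onI continuous_intros)
    then show ?thesis by measurable
  qed
  have Gm: "?G \<in> borel_measurable borel" unfolding F_def by measurable
  have FS: "(inner b (S (Suc n) \<omega>))\<^sup>2 = F (S n \<omega>) (\<lambda>v. X (Suc n) v \<omega>)" for \<omega>
    unfolding S_Suc F_def by (simp add: inner_vec_def sum.distrib distrib_left)
  have le: "?G s \<le> (inner (b + (1 / n) *\<^sub>R (memory_matrix E p *v b)) s)\<^sup>2 + (norm b)\<^sup>2" for s
  proof -
    have "?G s \<le> (inner b s + (\<Sum>v\<in>UNIV. b $ v * drift n s $ v))\<^sup>2 + (\<Sum>v\<in>UNIV. (b $ v)\<^sup>2)"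
      unfolding F_def real_scaleR_def by (rule sign_expectation_square)
    also have "(\<Sum>v\<in>UNIV. b $ v * drift n s $ v) = inner b (drift n s)" by (simp add: inner_vec_def)
    also have "(\<Sum>v\<in>UNIV. (b $ v)\<^sup>2) = (norm b)\<^sup>2"
      by (simp add: norm_square_vec)
    finally show ?thesis by (simp add: drift_adjoint inner_add_left)
  qed
  \<comment> \<open>Dominating \<open>?G\<close> also needs a bound from below; it holds because the
    weights are nonnegative.\<close>
  have G0: "0 \<le> ?G (S n \<omega>)" if "\<forall>v. \<bar>drift n (S n \<omega>) $ v\<bar> \<le> 1" for \<omega>
  proof (intro sum_nonneg)
    fix x assume "x \<in> sign_vectors"
    then have "x v \<in> signs" for v by (auto simp: sign_vectors_def)
    have "0 \<le> (1 + x v * drift n (S n \<omega>) $ v) / 2" for v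
      using that[rule_format, of v] \<open>x v \<in> signs\<close> by (auto simp: signs_def abs_le_iff)
    then show "0 \<le> (\<Prod>v\<in>UNIV. (1 + x v * drift n (S n \<omega>) $ v) / 2) *\<^sub>R F (S n \<omega>) x"
      by (simp add: F_def prod_nonneg)
  qed
  have int: "integrable M (\<lambda>\<omega>. (inner (b + (1 / n) *\<^sub>R (memory_matrix E p *v b)) (S n \<omega>))\<^sup>2 + (norm b)\<^sup>2)"
    by (intro Bochner_Integration.integrable_add integrable_inner_S_square) simp
  have intG: "integrable M (\<lambda>\<omega>. ?G (S n \<omega>))"
  proof (rule Bochner_Integration.integrable_bound[OF int])
    show "AE \<omega> in M. norm (?G (S n \<omega>)) \<le> norm ((inner (b + (1 / n) *\<^sub>R (memory_matrix E p *v b)) (S n \<omega>))\<^sup>2 + (norm b)\<^sup>2)"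
      using AE_drift_le_1[OF n]
    proof eventually_elim
      case (elim \<omega>)
      show ?case using G0[OF elim] le[of "S n \<omega>"] unfolding real_norm_def by linarith
    qed
  qed (use Gm in measurable)
  have Fm: "(\<lambda>\<omega>. F (S n \<omega>) (\<lambda>v. X (Suc n) v \<omega>)) \<in> borel_measurable M"
    unfolding FS[symmetric] by measurable
  have "expectation (\<lambda>\<omega>. (inner b (S (Suc n) \<omega>))\<^sup>2) = expectation (\<lambda>\<omega>. ?G (S n \<omega>))"
    unfolding FS by (rule expectation_step[OF n Fm]) (use Gm in measurable)
  also have "\<dots> \<le> expectation (\<lambda>\<omega>. (inner (b + (1 / n) *\<^sub>R (memory_matrix E p *v b)) (S n \<omega>))\<^sup>2 + (norm b)\<^sup>2)"
    using le by (intro integral_mono intG int)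
  also have "\<dots> = expectation (\<lambda>\<omega>. (inner (b + (1 / n) *\<^sub>R (memory_matrix E p *v b)) (S n \<omega>))\<^sup>2) + (norm b)\<^sup>2"
    by (subst Bochner_Integration.integral_add) (auto intro: integrable_inner_S_square simp: prob_space)
  finally show ?thesis .
qed

text \<open>\<open>A\<close> is the exact conditional factor of the step and \<open>C\<close> its
  Gaussian surrogate. In \<open>C\<close> the drift appears as a character, which
  \<open>drift_adjoint\<close> absorbs into the updated test vector, so that only a constant remains
  in front. The two products are compared one coordinate at a time.\<close>

lemma charfun_step:
  assumes n: "n \<ge> 1" and b: "\<And>v. \<bar>b $ v\<bar> \<le> 1"
  shows "cmod ((CLINT \<omega>|M. iexp (inner b (S (Suc n) \<omega>)))
      - complex_of_real (exp (- (norm b)\<^sup>2 / 2)) * (CLINT \<omega>|M. iexp (inner (b + (1 / n) *\<^sub>R (memory_matrix E p *v b)) (S n \<omega>))))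
    \<le> (\<Sum>v\<in>UNIV. 2 * \<bar>b $ v\<bar> ^ 3 + (b $ v)\<^sup>2 * expectation (\<lambda>\<omega>. (drift n (S n \<omega>) $ v)\<^sup>2))"
proof -
  define F where "F s x = iexp (inner b s) * (\<Prod>v\<in>UNIV. iexp (b $ v * real_of_int (x v)))"
    for s and x :: "'v \<Rightarrow> int"
  define A where "A s = (\<Prod>v\<in>UNIV. complex_of_real (cos (b $ v)) + \<i> * of_real (drift n s $ v * sin (b $ v)))" for s
  define C where "C s = (\<Prod>v\<in>UNIV. iexp (b $ v * drift n s $ v) * exp (- (of_real (b $ v))\<^sup>2 / 2))" for s
  let ?G = "\<lambda>s. \<Sum>x\<in>sign_vectors. (\<Prod>v\<in>UNIV. (1 + x v * drift n s $ v) / 2) *\<^sub>R F s x"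
  have dm [measurable]: "(\<lambda>s. drift n s $ v) \<in> borel_measurable borel" for v
  proof -
    have "(\<lambda>x :: real ^ 'v. x $ v) \<in> borel_measurable borel"
      by (intro borel_measurable_continuous_onI continuous_intros)
    then show ?thesis by measurable
  qed
  have Am [measurable]: "A \<in> borel_measurable borel" unfolding A_def by measurable
  have Cm [measurable]: "C \<in> borel_measurable borel" unfolding C_def by measurable
  have FS: "iexp (inner b (S (Suc n) \<omega>)) = F (S n \<omega>) (\<lambda>v. X (Suc n) v \<omega>)" for \<omega>
    unfolding S_Suc F_def
    by (simp add: inner_add_right inner_vec_def exp_add distrib_left sum_distrib_left exp_sum)
  have G: "?G s = iexp (inner b s) * A s" for s
  proof -
    have "?G s = iexp (inner b s) * (\<Sum>x\<in>sign_vectors. (\<Prod>v\<in>UNIV. (1 + x v * drift n s $ v) / 2) *\<^sub>R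
        (\<Prod>v\<in>UNIV. iexp (b $ v * real_of_int (x v))))"
      unfolding F_def sum_distrib_left by (intro sum.cong) auto
    also have "(\<Sum>x\<in>sign_vectors. (\<Prod>v\<in>UNIV. (1 + x v * drift n s $ v) / 2) *\<^sub>R
        (\<Prod>v\<in>UNIV. iexp (b $ v * real_of_int (x v)))) = A s"
      unfolding A_def sign_expectation_prod[of "\<lambda>v. drift n s $ v" "\<lambda>v z. iexp (b $ v * real_of_int z)"]
    proof (rule prod.cong)
      fix v
      have "complex_of_real ((1 + y) / 2) * iexp (b $ v * real_of_int 1) + complex_of_real ((1 - y) / 2) * iexp (b $ v * real_of_int (- 1))
          = complex_of_real (cos (b $ v)) + \<i> * of_real (y * sin (b $ v))" for y
        by (simp add: complex_eq_iff Re_exp Im_exp field_simps)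
      then show "complex_of_real ((1 + drift n s $ v) / 2) * iexp (b $ v * real_of_int 1) +
          complex_of_real ((1 - drift n s $ v) / 2) * iexp (b $ v * real_of_int (- 1))
          = complex_of_real (cos (b $ v)) + \<i> * of_real (drift n s $ v * sin (b $ v))" .
    qed simp
    finally show ?thesis .
  qed
  have C: "iexp (inner b s) * C s
      = complex_of_real (exp (- (norm b)\<^sup>2 / 2)) * iexp (inner (b + (1 / n) *\<^sub>R (memory_matrix E p *v b)) s)" for s
  proof -
    have "(\<Prod>v\<in>UNIV. exp (- (complex_of_real (b $ v))\<^sup>2 / 2)) = (\<Prod>v\<in>UNIV. complex_of_real (exp (- (b $ v)\<^sup>2 / 2)))"
      by (simp flip: exp_of_real)
    also have "\<dots> = complex_of_real (exp (\<Sum>v\<in>UNIV. - (b $ v)\<^sup>2 / 2))" by (simp add: exp_sum)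
    also have "(\<Sum>v\<in>UNIV. - (b $ v)\<^sup>2 / 2) = - (norm b)\<^sup>2 / 2"
      by (simp add: norm_square_vec sum_negf sum_divide_distrib)
    finally have "C s = iexp (inner b (drift n s)) * complex_of_real (exp (- (norm b)\<^sup>2 / 2))"
      unfolding C_def prod.distrib
      by (simp add: exp_sum[symmetric] sum_distrib_left[symmetric] inner_vec_def flip: of_real_sum of_real_mult)
    then show ?thesis
      unfolding drift_adjoint by (simp add: inner_add_left distrib_left exp_add mult_ac)
  qed
  have nA: "AE \<omega> in M. norm (A (S n \<omega>)) \<le> 1 \<and> norm (C (S n \<omega>)) \<le> 1 \<and> norm (A (S n \<omega>) - C (S n \<omega>)) \<le>
      (\<Sum>v\<in>UNIV. 2 * \<bar>b $ v\<bar> ^ 3 + (b $ v)\<^sup>2 * (drift n (S n \<omega>) $ v)\<^sup>2)"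
    using AE_drift_le_1[OF n]
  proof eventually_elim
    case (elim \<omega>)
    define y where "y v = drift n (S n \<omega>) $ v" for v
    have y: "\<bar>y v\<bar> \<le> 1" for v using elim by (simp add: y_def)
    \<comment> \<open>Both kinds of factors lie in the closed unit disc, as required for bounding a
      difference of products by the sum of the differences.\<close>
    have a: "cmod (complex_of_real (cos (b $ v)) + \<i> * of_real (y v * sin (b $ v))) \<le> 1" for v
    proof -
      have "(y v)\<^sup>2 * (sin (b $ v))\<^sup>2 \<le> 1 * (sin (b $ v))\<^sup>2"
        using y[of v] by (intro mult_right_mono) (auto simp: abs_square_le_1)
      then have "(cos (b $ v))\<^sup>2 + (y v * sin (b $ v))\<^sup>2 \<le> 1"
        using sin_cos_squared_add[of "b $ v"] unfolding power_mult_distrib by linarith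
      then show ?thesis by (simp add: cmod_def)
    qed
    have c: "cmod (iexp (b $ v * y v) * exp (- (of_real (b $ v))\<^sup>2 / 2)) \<le> 1" for v
      by (simp add: norm_mult)
    have "norm (A (S n \<omega>) - C (S n \<omega>)) \<le> (\<Sum>v\<in>UNIV. cmod (complex_of_real (cos (b $ v)) + \<i> * of_real (y v * sin (b $ v))
        - iexp (b $ v * y v) * exp (- (of_real (b $ v))\<^sup>2 / 2)))"
      unfolding A_def C_def y_def[symmetric] by (rule norm_prod_diff) (rule a c)+
    also have "\<dots> \<le> (\<Sum>v\<in>UNIV. 2 * \<bar>b $ v\<bar> ^ 3 + (b $ v)\<^sup>2 * (y v)\<^sup>2)"
      using b y by (intro sum_mono charfun_step_bound)
    finally have "norm (A (S n \<omega>) - C (S n \<omega>)) \<le> (\<Sum>v\<in>UNIV. 2 * \<bar>b $ v\<bar> ^ 3 + (b $ v)\<^sup>2 * (y v)\<^sup>2)" .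
    moreover have "norm (A (S n \<omega>)) \<le> 1"
      unfolding A_def y_def[symmetric] prod_norm[symmetric] using a by (intro prod_le_1) auto
    moreover have "norm (C (S n \<omega>)) \<le> 1"
      unfolding C_def y_def[symmetric] prod_norm[symmetric] using c by (intro prod_le_1 conjI norm_ge_zero)
    ultimately show ?case by (simp add: y_def)
  qed
  have Fm: "(\<lambda>\<omega>. F (S n \<omega>) (\<lambda>v. X (Suc n) v \<omega>)) \<in> borel_measurable M"
    unfolding FS[symmetric] by measurable
  have iA: "integrable M (\<lambda>\<omega>. iexp (inner b (S n \<omega>)) * A (S n \<omega>))"
    using nA by (intro integrable_const_bound[where B = 1]) (auto simp: norm_mult)
  have iC: "integrable M (\<lambda>\<omega>. iexp (inner b (S n \<omega>)) * C (S n \<omega>))"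
    using nA by (intro integrable_const_bound[where B = 1]) (auto simp: norm_mult)
  have id: "integrable M (\<lambda>\<omega>. (drift n (S n \<omega>) $ v)\<^sup>2)" for v
  proof (rule integrable_const_bound[where B = 1])
    show "AE \<omega> in M. norm ((drift n (S n \<omega>) $ v)\<^sup>2) \<le> 1"
      using AE_drift_le_1[OF n] by eventually_elim (simp add: abs_square_le_1)
  qed measurable
  have "(CLINT \<omega>|M. iexp (inner b (S (Suc n) \<omega>))) = (CLINT \<omega>|M. ?G (S n \<omega>))"
    unfolding FS by (rule expectation_step[OF n Fm]) (simp add: G)
  then have "cmod ((CLINT \<omega>|M. iexp (inner b (S (Suc n) \<omega>)))
      - complex_of_real (exp (- (norm b)\<^sup>2 / 2)) * (CLINT \<omega>|M. iexp (inner (b + (1 / n) *\<^sub>R (memory_matrix E p *v b)) (S n \<omega>))))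
    = cmod ((CLINT \<omega>|M. iexp (inner b (S n \<omega>)) * A (S n \<omega>)) - (CLINT \<omega>|M. iexp (inner b (S n \<omega>)) * C (S n \<omega>)))"
    unfolding G C by simp
  also have "\<dots> = cmod (CLINT \<omega>|M. iexp (inner b (S n \<omega>)) * (A (S n \<omega>) - C (S n \<omega>)))"
    using iA iC by (simp add: right_diff_distrib)
  also have "\<dots> \<le> expectation (\<lambda>\<omega>. \<Sum>v\<in>UNIV. 2 * \<bar>b $ v\<bar> ^ 3 + (b $ v)\<^sup>2 * (drift n (S n \<omega>) $ v)\<^sup>2)"
  proof (rule order.trans[OF integral_norm_bound integral_mono_AE])
    show "integrable M (\<lambda>\<omega>. norm (iexp (inner b (S n \<omega>)) * (A (S n \<omega>) - C (S n \<omega>))))"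
      using iA iC by (auto simp: right_diff_distrib intro!: integrable_norm)
    show "integrable M (\<lambda>\<omega>. \<Sum>v\<in>UNIV. 2 * \<bar>b $ v\<bar> ^ 3 + (b $ v)\<^sup>2 * (drift n (S n \<omega>) $ v)\<^sup>2)"
      using id by auto
    show "AE \<omega> in M. norm (iexp (inner b (S n \<omega>)) * (A (S n \<omega>) - C (S n \<omega>)))
        \<le> (\<Sum>v\<in>UNIV. 2 * \<bar>b $ v\<bar> ^ 3 + (b $ v)\<^sup>2 * (drift n (S n \<omega>) $ v)\<^sup>2)"
      using nA by eventually_elim (simp add: norm_mult)
  qed
  also have "\<dots> = (\<Sum>v\<in>UNIV. 2 * \<bar>b $ v\<bar> ^ 3 + (b $ v)\<^sup>2 * expectation (\<lambda>\<omega>. (drift n (S n \<omega>) $ v)\<^sup>2))"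
    using id by (simp add: Bochner_Integration.integral_sum Bochner_Integration.integral_add prob_space)
  finally show ?thesis .
qed

end

section \<open>Matrix exponentials\<close>

definition opnorm :: "real ^ 'n ^ 'm \<Rightarrow> real" where
  "opnorm A = onorm ((*v) A)"

lemma opnorm_bound: "norm (A *v x) \<le> opnorm A * norm x"
  unfolding opnorm_def by (rule onorm) simp

lemma opnorm_nonneg: "0 \<le> opnorm A"
  unfolding opnorm_def by (rule onorm_pos_le) simp

lemma opnorm_mult: "opnorm (A ** B) \<le> opnorm A * opnorm B"
proof -
  have "(*v) (A ** B) = (*v) A \<circ> (*v) B" by (auto simp: matrix_vector_mul_assoc)
  then show ?thesis unfolding opnorm_def by (simp add: onorm_compose)
qed

lemma opnorm_triangle: "opnorm (A + B) \<le> opnorm A + opnorm B"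
proof -
  have "(*v) (A + B) = (\<lambda>x. A *v x + B *v x)" by (auto simp: matrix_vector_mult_add_rdistrib)
  then show ?thesis unfolding opnorm_def by (simp add: onorm_triangle)
qed

lemma opnorm_scaleR: "opnorm (c *\<^sub>R A) = \<bar>c\<bar> * opnorm A"
proof -
  have "(*v) (c *\<^sub>R A) = (\<lambda>x. c *\<^sub>R (A *v x))" by (auto simp: scaleR_matrix_vector_assoc)
  then show ?thesis unfolding opnorm_def by (simp add: onorm_scaleR)
qed

lemma opnorm_diff: "opnorm (A - B) \<le> opnorm A + opnorm B"
  using opnorm_triangle[of A "(-1) *\<^sub>R B"] opnorm_scaleR[of "-1" B] by simp

lemma opnorm_one: "opnorm (mat 1 :: real ^ 'n ^ 'n) = 1"
proof -
  have "(*v) (mat 1 :: real ^ 'n ^ 'n) = (\<lambda>x. x)" by auto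
  then show ?thesis unfolding opnorm_def by (simp add: onorm_id)
qed

lemma opnorm_zero [simp]: "opnorm 0 = 0"
  using opnorm_scaleR[of 0 0] by simp

lemma entry_le_opnorm: "\<bar>A $ i $ j\<bar> \<le> opnorm A"
  unfolding opnorm_def by (rule matrix_component_le_onorm)

lemma opnorm_le_sum: "opnorm A \<le> (\<Sum>i\<in>UNIV. \<Sum>j\<in>UNIV. \<bar>A $ i $ j\<bar>)"
  unfolding opnorm_def by (rule onorm_le_matrix_component_sum)

lemma opnorm_le_entries:
  fixes A :: "real ^ 'n ^ 'm"
  assumes "\<And>i j. \<bar>A $ i $ j\<bar> \<le> c"
  shows "opnorm A \<le> of_nat CARD('m) * of_nat CARD('n) * c"
proof -
  have "opnorm A \<le> (\<Sum>i\<in>(UNIV :: 'm set). \<Sum>j\<in>(UNIV :: 'n set). c)"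
    using assms by (intro order.trans[OF opnorm_le_sum] sum_mono)
  then show ?thesis by simp
qed

lemma mm_entry: "(P ** Q) $ i $ j = (\<Sum>k\<in>UNIV. P $ i $ k * Q $ k $ j)"
  by (simp add: matrix_matrix_mult_def)

lemma mm_add_rdistrib: "(P + Q) ** R = P ** R + Q ** (R :: 'a::semiring_1 ^ 'n ^ 'm)"
  by (simp add: vec_eq_iff mm_entry distrib_right sum.distrib)

abbreviation mpow :: "real ^ 'n ^ 'n \<Rightarrow> nat \<Rightarrow> real ^ 'n ^ 'n" where
  "mpow A n \<equiv> ((**) A ^^ n) (mat 1)"

lemma mpow_Suc: "mpow A (Suc n) = A ** mpow A n" by simp

lemma mpow_commute: "mpow A n ** A = A ** mpow A n"
  by (induction n) (simp_all add: matrix_mul_assoc[symmetric])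

lemma mpow_scaleR: "mpow (t *\<^sub>R A) n = t ^ n *\<^sub>R mpow A n"
  by (induction n) (simp_all add: scalar_matrix_assoc[symmetric] matrix_scalar_ac mult.commute)

lemma opnorm_mpow: "opnorm (mpow A n) \<le> opnorm A ^ n"
proof (induction n)
  case (Suc n)
  have "opnorm (mpow A (Suc n)) \<le> opnorm A * opnorm (mpow A n)"
    unfolding mpow_Suc by (rule opnorm_mult)
  also have "\<dots> \<le> opnorm A * opnorm A ^ n"
    by (intro mult_left_mono Suc opnorm_nonneg)
  finally show ?case by simp
qed (simp add: opnorm_one)

lemma matrix_sums_entrywise:
  fixes f :: "nat \<Rightarrow> real ^ 'n ^ 'm"
  assumes "\<And>i j. (\<lambda>n. f n $ i $ j) sums (L $ i $ j)"
  shows "f sums L"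
  using assms unfolding sums_def
  by (intro vec_tendstoI) simp

lemma summable_mexp_entry: "summable (\<lambda>n. (mpow A n $ i $ j / fact n) * t ^ n)"
proof (rule summable_comparison_test)
  have "\<bar>(mpow A n $ i $ j / fact n) * t ^ n\<bar> \<le> (opnorm A * \<bar>t\<bar>) ^ n /\<^sub>R fact n" for n
  proof -
    have "\<bar>mpow A n $ i $ j\<bar> \<le> opnorm A ^ n"
      using entry_le_opnorm opnorm_mpow by (rule order_trans)
    then have "\<bar>mpow A n $ i $ j\<bar> * \<bar>t\<bar> ^ n \<le> opnorm A ^ n * \<bar>t\<bar> ^ n"
      by (intro mult_right_mono) auto
    then show ?thesis
      by (simp add: abs_mult power_mult_distrib power_abs field_simps)
  qed
  then show "\<exists>N. \<forall>n\<ge>N. norm ((mpow A n $ i $ j / fact n) * t ^ n) \<le> (opnorm A * \<bar>t\<bar>) ^ n /\<^sub>R fact n"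
    by auto
qed (rule summable_exp_generic)

text \<open>Each entry becomes a scalar power series in \<open>t\<close>, which reduces
  differentiation and continuity of the matrix exponential to scalar facts.\<close>

lemma mexp_entry: "mexp (t *\<^sub>R A) $ i $ j = (\<Sum>n. (mpow A n $ i $ j / fact n) * t ^ n)"
proof -
  define L where "L = (\<chi> i j. \<Sum>n. (mpow A n $ i $ j / fact n) * t ^ n)"
  have "(\<lambda>n. mpow (t *\<^sub>R A) n /\<^sub>R fact n) sums L"
  proof (rule matrix_sums_entrywise)
    fix i j
    have "(mpow (t *\<^sub>R A) n /\<^sub>R fact n) $ i $ j = (mpow A n $ i $ j / fact n) * t ^ n" for n
      by (simp add: mpow_scaleR field_simps)
    then show "(\<lambda>n. (mpow (t *\<^sub>R A) n /\<^sub>R fact n) $ i $ j) sums (L $ i $ j)"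
      using summable_sums[OF summable_mexp_entry, of A i j t] by (simp add: L_def)
  qed
  then have "mexp (t *\<^sub>R A) = L" unfolding mexp_def by (rule sums_unique[symmetric])
  then show ?thesis by (simp add: L_def)
qed

lemma mexp_zero: "mexp 0 = mat 1"
proof -
  have "mexp ((0::real) *\<^sub>R (0 :: real ^ 'a ^ 'a)) $ i $ j = mat 1 $ i $ j" for i j
  proof -
    have "(\<lambda>n. (mpow (0 :: real ^ 'a ^ 'a) n $ i $ j / fact n) * 0 ^ n) sums (mpow 0 0 $ i $ j / fact 0)"
      by (rule powser_sums_zero)
    then show ?thesis unfolding mexp_entry by (simp add: sums_iff)
  qed
  then show ?thesis by (simp add: vec_eq_iff)
qed

lemma mexp_commute: "mexp (t *\<^sub>R A) ** A = A ** mexp (t *\<^sub>R A)"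
proof -
  have "(mexp (t *\<^sub>R A) ** A) $ i $ j = (A ** mexp (t *\<^sub>R A)) $ i $ j" for i j
  proof -
    have "(mexp (t *\<^sub>R A) ** A) $ i $ j = (\<Sum>k\<in>UNIV. \<Sum>n. (mpow A n $ i $ k / fact n) * t ^ n * A $ k $ j)"
      unfolding mm_entry mexp_entry by (intro sum.cong refl suminf_mult2 summable_mexp_entry)
    also have "\<dots> = (\<Sum>n. \<Sum>k\<in>UNIV. (mpow A n $ i $ k / fact n) * t ^ n * A $ k $ j)"
      by (rule suminf_sum[symmetric]) (intro summable_mult2 summable_mexp_entry)
    also have "(\<lambda>n. \<Sum>k\<in>UNIV. (mpow A n $ i $ k / fact n) * t ^ n * A $ k $ j)
        = (\<lambda>n. \<Sum>k\<in>UNIV. A $ i $ k * ((mpow A n $ k $ j / fact n) * t ^ n))"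
    proof
      fix n
      have "(\<Sum>k\<in>UNIV. (mpow A n $ i $ k / fact n) * t ^ n * A $ k $ j) = (mpow A n ** A) $ i $ j * (t ^ n / fact n)"
        unfolding mm_entry sum_distrib_right by (intro sum.cong refl) simp
      also have "\<dots> = (A ** mpow A n) $ i $ j * (t ^ n / fact n)" by (simp only: mpow_commute)
      also have "\<dots> = (\<Sum>k\<in>UNIV. A $ i $ k * ((mpow A n $ k $ j / fact n) * t ^ n))"
        unfolding mm_entry sum_distrib_right by (intro sum.cong refl) simp
      finally show "(\<Sum>k\<in>UNIV. (mpow A n $ i $ k / fact n) * t ^ n * A $ k $ j)
        = (\<Sum>k\<in>UNIV. A $ i $ k * ((mpow A n $ k $ j / fact n) * t ^ n))" .
    qed
    also have "(\<Sum>n. \<Sum>k\<in>UNIV. A $ i $ k * ((mpow A n $ k $ j / fact n) * t ^ n))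
        = (\<Sum>k\<in>UNIV. \<Sum>n. A $ i $ k * ((mpow A n $ k $ j / fact n) * t ^ n))"
      by (rule suminf_sum) (intro summable_mult summable_mexp_entry)
    also have "\<dots> = (A ** mexp (t *\<^sub>R A)) $ i $ j"
      unfolding mm_entry mexp_entry by (intro sum.cong refl suminf_mult summable_mexp_entry)
    finally show ?thesis .
  qed
  then show ?thesis by (simp add: vec_eq_iff)
qed

lemma mexp_entry_deriv:
  "((\<lambda>t. mexp (t *\<^sub>R A) $ i $ j) has_real_derivative (A ** mexp (t *\<^sub>R A)) $ i $ j) (at t)"
proof -
  let ?c = "\<lambda>i j n. mpow A n $ i $ j / fact n"
  have "((\<lambda>t. \<Sum>n. ?c i j n * t ^ n) has_field_derivative (\<Sum>n. diffs (?c i j) n * t ^ n)) (at t)"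
    by (rule termdiffs_strong_converges_everywhere) (rule summable_mexp_entry)
  moreover have "diffs (?c i j) n = (\<Sum>k\<in>UNIV. A $ i $ k * ?c k j n)" for n
  proof -
    have "diffs (?c i j) n = (A ** mpow A n) $ i $ j / fact n"
      by (simp add: diffs_def divide_simps del: of_nat_Suc)
    then show ?thesis by (simp add: mm_entry sum_divide_distrib)
  qed
  moreover have "(\<Sum>n. (\<Sum>k\<in>UNIV. A $ i $ k * ?c k j n) * t ^ n)
      = (\<Sum>n. \<Sum>k\<in>UNIV. A $ i $ k * (?c k j n * t ^ n))"
    by (simp add: sum_distrib_right mult.assoc)
  moreover have "\<dots> = (\<Sum>k\<in>UNIV. \<Sum>n. A $ i $ k * (?c k j n * t ^ n))"
    by (rule suminf_sum) (intro summable_mult summable_mexp_entry)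
  moreover have "\<dots> = (A ** mexp (t *\<^sub>R A)) $ i $ j"
    unfolding mm_entry mexp_entry by (intro sum.cong refl suminf_mult summable_mexp_entry)
  ultimately show ?thesis by (simp add: mexp_entry)
qed

text \<open>The product \<open>mexp ((- t) *\<^sub>R A) ** Y t\<close> has derivative zero because
  \<open>A\<close> commutes with its exponential. That the first factor is invertible follows from
  the case \<open>Y t = mexp (t *\<^sub>R A)\<close>, so it cannot be moved to the other side
  yet.\<close>

lemma linear_ode_unique_aux:
  fixes Y :: "real \<Rightarrow> real ^ 'n ^ 'n"
  assumes Y: "\<And>t i j. ((\<lambda>t. Y t $ i $ j) has_real_derivative (A ** Y t) $ i $ j) (at t)"
  shows "mexp ((- t) *\<^sub>R A) ** Y t = Y 0"
proof -
  define W where "W t = mexp ((- t) *\<^sub>R A) ** Y t" for t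
  have "((\<lambda>t. W t $ i $ j) has_real_derivative 0) (at t)" for t i j
  proof -
    have E: "((\<lambda>t. mexp ((- t) *\<^sub>R A) $ i $ k) has_real_derivative - (mexp ((- t) *\<^sub>R A) ** A) $ i $ k) (at t)" for k
      using DERIV_chain'[OF DERIV_minus[OF DERIV_ident] mexp_entry_deriv, of A i k t]
      by (simp add: mexp_commute del: scaleR_minus_left)
    have "((\<lambda>t. \<Sum>k\<in>UNIV. mexp ((- t) *\<^sub>R A) $ i $ k * Y t $ k $ j) has_real_derivative
        (\<Sum>k\<in>UNIV. - (mexp ((- t) *\<^sub>R A) ** A) $ i $ k * Y t $ k $ j + (A ** Y t) $ k $ j * mexp ((- t) *\<^sub>R A) $ i $ k)) (at t)"
      by (intro DERIV_sum DERIV_mult E Y)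
    moreover have "(\<Sum>k\<in>UNIV. - (mexp ((- t) *\<^sub>R A) ** A) $ i $ k * Y t $ k $ j + (A ** Y t) $ k $ j * mexp ((- t) *\<^sub>R A) $ i $ k)
        = - (mexp ((- t) *\<^sub>R A) ** A ** Y t) $ i $ j + (mexp ((- t) *\<^sub>R A) ** (A ** Y t)) $ i $ j"
    proof -
      show ?thesis
        unfolding mm_entry[of "mexp ((- t) *\<^sub>R A) ** A" "Y t"] mm_entry[of "mexp ((- t) *\<^sub>R A)" "A ** Y t"]
        by (simp only: sum.distrib sum_negf mult_minus_left mult_minus_right mult.commute)
    qed
    ultimately show ?thesis
      unfolding W_def by (simp add: matrix_mul_assoc) (simp add: mm_entry)
  qed
  then have "W t $ i $ j = W 0 $ i $ j" for i j
    by (intro DERIV_isconst_all[rule_format]) auto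
  then have "W t = W 0" by (simp add: vec_eq_iff)
  then show ?thesis by (simp add: W_def mexp_zero)
qed

lemma mexp_minus: "mexp ((- t) *\<^sub>R A) ** mexp (t *\<^sub>R A) = mat 1" "mexp (t *\<^sub>R A) ** mexp ((- t) *\<^sub>R A) = mat 1"
proof -
  show *: "mexp ((- t) *\<^sub>R A) ** mexp (t *\<^sub>R A) = mat 1" for t
    using linear_ode_unique_aux[of "\<lambda>t. mexp (t *\<^sub>R A)" A t, OF mexp_entry_deriv] by (simp add: mexp_zero)
  show "mexp (t *\<^sub>R A) ** mexp ((- t) *\<^sub>R A) = mat 1"
    using *[of "- t"] by simp
qed

text \<open>Source of the functional equations of the exponential: in \<open>mexp_add\<close> and
  \<open>mexp_shift\<close> both sides solve the same equation with the same initial value.\<close>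

lemma linear_ode_unique:
  fixes Y :: "real \<Rightarrow> real ^ 'n ^ 'n"
  assumes Y: "\<And>t i j. ((\<lambda>t. Y t $ i $ j) has_real_derivative (A ** Y t) $ i $ j) (at t)"
  shows "Y t = mexp (t *\<^sub>R A) ** Y 0"
proof -
  have "mexp (t *\<^sub>R A) ** (mexp ((- t) *\<^sub>R A) ** Y t) = mexp (t *\<^sub>R A) ** Y 0"
    unfolding linear_ode_unique_aux[OF Y] ..
  then show ?thesis by (simp only: matrix_mul_assoc mexp_minus matrix_mul_lid)
qed

lemma mexp_add: "mexp ((s + t) *\<^sub>R A) = mexp (s *\<^sub>R A) ** mexp (t *\<^sub>R A)"
proof -
  have "((\<lambda>s. mexp ((s + t) *\<^sub>R A) $ i $ j) has_real_derivative (A ** mexp ((s + t) *\<^sub>R A)) $ i $ j) (at s)" for s i j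
    using DERIV_chain'[OF DERIV_add[OF DERIV_ident DERIV_const] mexp_entry_deriv, of t A i j s] by simp
  from linear_ode_unique[of "\<lambda>s. mexp ((s + t) *\<^sub>R A)", OF this, of s] show ?thesis by simp
qed

lemma mexp_shift: "mexp (t *\<^sub>R (A + c *\<^sub>R mat 1)) = exp (c * t) *\<^sub>R mexp (t *\<^sub>R A)"
proof -
  define Y where "Y t = exp (c * t) *\<^sub>R mexp (t *\<^sub>R A)" for t
  have "((\<lambda>t. Y t $ i $ j) has_real_derivative ((A + c *\<^sub>R mat 1) ** Y t) $ i $ j) (at t)" for t i j
  proof -
    have "((\<lambda>t. exp (c * t) * mexp (t *\<^sub>R A) $ i $ j) has_real_derivative
        exp (c * t) * (c * 1) * mexp (t *\<^sub>R A) $ i $ j + (A ** mexp (t *\<^sub>R A)) $ i $ j * exp (c * t)) (at t)"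
      by (intro DERIV_mult mexp_entry_deriv DERIV_fun_exp DERIV_cmult DERIV_ident)
    moreover have "(A + c *\<^sub>R mat 1) ** Y t = exp (c * t) *\<^sub>R (A ** mexp (t *\<^sub>R A)) + (c * exp (c * t)) *\<^sub>R mexp (t *\<^sub>R A)"
      unfolding Y_def matrix_scalar_ac scalar_matrix_assoc[symmetric]
      by (simp add: mm_add_rdistrib matrix_scalar_ac scalar_matrix_assoc[symmetric] scaleR_add_right mult.commute)
    ultimately show ?thesis by (simp add: Y_def algebra_simps)
  qed
  from linear_ode_unique[of Y, OF this, of t] show ?thesis by (simp add: Y_def mexp_zero)
qed

lemma mexp_transpose: "mexp (t *\<^sub>R transpose A) = transpose (mexp (t *\<^sub>R A))"
proof -
  have "mpow (transpose A) n = transpose (mpow A n)" for n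
  proof (induction n)
    case (Suc n)
    have "mpow (transpose A) (Suc n) = transpose (mpow A n ** A)"
      by (simp add: Suc matrix_transpose_mul)
    then show ?case unfolding mpow_commute by simp
  qed (simp add: transpose_mat)
  then have "mexp (t *\<^sub>R transpose A) $ i $ j = transpose (mexp (t *\<^sub>R A)) $ i $ j" for i j
    by (simp add: mexp_entry transpose_def)
  then show ?thesis by (simp add: vec_eq_iff)
qed

lemma isCont_mexp_entry: "isCont (\<lambda>t. mexp (t *\<^sub>R A) $ i $ j) t"
  by (rule DERIV_isCont[OF mexp_entry_deriv])

lemma continuous_on_mexp: "continuous_on S (\<lambda>t. mexp (t *\<^sub>R A))"
proof -
  have "continuous_on S (\<lambda>t. \<chi> i j. mexp (t *\<^sub>R A) $ i $ j)"
    by (intro continuous_on_vec_lambda continuous_at_imp_continuous_on ballI isCont_mexp_entry)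
  then show ?thesis by simp
qed

lemma opnorm_mexp_bounded: "\<exists>K\<ge>0. \<forall>t. \<bar>t\<bar> \<le> 1 \<longrightarrow> opnorm (M ** mexp (t *\<^sub>R A)) \<le> K"
proof -
  have "\<exists>K. \<forall>t\<in>{-1..1}. \<bar>mexp (t *\<^sub>R A) $ i $ j\<bar> \<le> K" for i j
  proof -
    have "compact ((\<lambda>t. mexp (t *\<^sub>R A) $ i $ j) ` {-1..1})"
      by (intro compact_continuous_image continuous_at_imp_continuous_on ballI isCont_mexp_entry) simp
    then show ?thesis by (auto dest!: compact_imp_bounded simp: bounded_iff)
  qed
  then obtain K where K: "\<And>i j t. t \<in> {-1..1} \<Longrightarrow> \<bar>mexp (t *\<^sub>R A) $ i $ j\<bar> \<le> K i j" by metis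
  have "opnorm (M ** mexp (t *\<^sub>R A)) \<le> opnorm M * (\<Sum>i\<in>UNIV. \<Sum>j\<in>UNIV. \<bar>K i j\<bar>)" if "\<bar>t\<bar> \<le> 1" for t
  proof -
    have "opnorm (mexp (t *\<^sub>R A)) \<le> (\<Sum>i\<in>UNIV. \<Sum>j\<in>UNIV. \<bar>K i j\<bar>)"
    proof (intro order.trans[OF opnorm_le_sum] sum_mono)
      show "\<bar>mexp (t *\<^sub>R A) $ i $ j\<bar> \<le> \<bar>K i j\<bar>" for i j
        using K[of t i j] that by (simp add: abs_le_iff)
    qed
    then show ?thesis
      by (intro order.trans[OF opnorm_mult] mult_left_mono opnorm_nonneg)
  qed
  then show ?thesis
    by (intro exI[of _ "opnorm M * (\<Sum>i\<in>UNIV. \<Sum>j\<in>UNIV. \<bar>K i j\<bar>)"])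
      (auto intro!: mult_nonneg_nonneg opnorm_nonneg sum_nonneg)
qed

lemma mexp_taylor:
  "\<exists>K\<ge>0. \<forall>h. 0 \<le> h \<and> h \<le> 1 \<longrightarrow> opnorm (mexp (h *\<^sub>R A) - mat 1 - h *\<^sub>R A) \<le> K * h\<^sup>2"
proof -
  obtain K where K: "K \<ge> 0" "\<And>t. \<bar>t\<bar> \<le> 1 \<Longrightarrow> opnorm ((A ** A) ** mexp (t *\<^sub>R A)) \<le> K"
    using opnorm_mexp_bounded by blast
  have "\<bar>(mexp (h *\<^sub>R A) - mat 1 - h *\<^sub>R A) $ i $ j\<bar> \<le> K * h\<^sup>2" if h: "0 < h" "h \<le> 1" for h i j
  proof -
    \<comment> \<open>\<open>d m\<close> is the \<open>m\<close>-th derivative of the entry;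
      \<open>K\<close> bounds the second one on the unit interval.\<close>
    define d where "d m t = (mpow A m ** mexp (t *\<^sub>R A)) $ i $ j" for m t
    have D: "((\<lambda>t. d m t) has_real_derivative d (Suc m) t) (at t)" for m t
    proof -
      have "((\<lambda>t. \<Sum>k\<in>UNIV. mpow A m $ i $ k * mexp (t *\<^sub>R A) $ k $ j) has_real_derivative
          (\<Sum>k\<in>UNIV. mpow A m $ i $ k * (A ** mexp (t *\<^sub>R A)) $ k $ j)) (at t)"
        by (intro DERIV_sum DERIV_cmult mexp_entry_deriv)
      moreover have "mpow A (Suc m) ** mexp (t *\<^sub>R A) = mpow A m ** (A ** mexp (t *\<^sub>R A))"
        unfolding mpow_Suc mpow_commute[symmetric] by (simp add: matrix_mul_assoc)
      ultimately show ?thesis unfolding d_def by (simp add: mm_entry)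
    qed
    obtain t where t: "0 < t" "t < h" "d 0 h = (\<Sum>m<2. (d m 0 / fact m) * h ^ m) + (d 2 t / fact 2) * h ^ 2"
      using Maclaurin[OF h(1), of 2 d "d 0"] D by auto
    have "d 0 h = mexp (h *\<^sub>R A) $ i $ j" "d 0 0 = (mat 1 :: real ^ 'a ^ 'a) $ i $ j" "d 1 0 = A $ i $ j"
      by (simp_all add: d_def mexp_zero)
    with t(3) have "(mexp (h *\<^sub>R A) - mat 1 - h *\<^sub>R A) $ i $ j = d 2 t / 2 * h\<^sup>2"
      by (simp add: numeral_2_eq_2)
    moreover have "\<bar>d 2 t\<bar> \<le> K"
    proof -
      have "d 2 t = ((A ** A) ** mexp (t *\<^sub>R A)) $ i $ j" by (simp add: d_def numeral_2_eq_2)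
      then show ?thesis using entry_le_opnorm K(2)[of t] t h by (metis abs_of_pos less_le_trans order_less_imp_le order_trans)
    qed
    moreover have "\<bar>d 2 t / 2 * h\<^sup>2\<bar> = \<bar>d 2 t\<bar> / 2 * h\<^sup>2" by (simp add: abs_mult)
    moreover have "\<bar>d 2 t\<bar> / 2 * h\<^sup>2 \<le> K * h\<^sup>2"
      using calculation(2) by (intro mult_right_mono) auto
    ultimately show ?thesis by linarith
  qed
  moreover have "\<bar>(mexp (0 *\<^sub>R A) - mat 1 - 0 *\<^sub>R A) $ i $ j\<bar> \<le> K * 0\<^sup>2" for i j
    by (simp add: mexp_zero)
  ultimately have "\<bar>(mexp (h *\<^sub>R A) - mat 1 - h *\<^sub>R A) $ i $ j\<bar> \<le> K * h\<^sup>2" if "0 \<le> h" "h \<le> 1" for h i j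
    using that by (cases "h = 0") auto
  then have "opnorm (mexp (h *\<^sub>R A) - mat 1 - h *\<^sub>R A) \<le> of_nat CARD('a) * of_nat CARD('a) * (K * h\<^sup>2)"
    if "0 \<le> h" "h \<le> 1" for h using that by (intro opnorm_le_entries) auto
  then show ?thesis using K(1)
    by (intro exI[of _ "of_nat CARD('a) * of_nat CARD('a) * K"]) (auto simp: mult.assoc)
qed

text \<open>One step of the recursion against one step of the matrix power \<open>(j + 1)/j\<close>.\<close>

lemma mexp_step:
  "\<exists>K\<ge>0. \<forall>j::nat. j \<ge> 1 \<longrightarrow>
    opnorm (mexp ((- ln ((real j + 1) / real j)) *\<^sub>R B) ** (mat 1 + (1 / real j) *\<^sub>R B) - mat 1) \<le> K / (real j)\<^sup>2"
proof -
  obtain K where K: "K \<ge> 0" "\<And>h. 0 \<le> h \<Longrightarrow> h \<le> 1 \<Longrightarrow> opnorm (mexp (h *\<^sub>R B) - mat 1 - h *\<^sub>R B) \<le> K * h\<^sup>2"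
    using mexp_taylor by blast
  obtain L where L: "L \<ge> 0" "\<And>t. \<bar>t\<bar> \<le> 1 \<Longrightarrow> opnorm (mat 1 ** mexp (t *\<^sub>R B)) \<le> L"
    using opnorm_mexp_bounded by blast
  have "opnorm (mexp ((- ln ((real j + 1) / real j)) *\<^sub>R B) ** (mat 1 + (1 / real j) *\<^sub>R B) - mat 1) \<le> L * (K + opnorm B) / (real j)\<^sup>2"
    if j: "j \<ge> 1" for j :: nat
  proof -
    define h where "h = ln ((real j + 1) / j)"
    have j0: "real j > 0" "1 / real j \<le> 1" using j by auto
    have h_eq: "h = ln (1 + 1 / j)" using j0 by (simp add: h_def field_simps)
    have h: "0 \<le> h" "h \<le> 1 / j" unfolding h_eq using ln_add_one_self_le_self[of "1 / j"] by auto
    have h1: "h \<le> 1" using h j0 by linarith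
    have hl: "1 / j - h \<le> (1 / j)\<^sup>2"
      unfolding h_eq using ln_one_plus_pos_lower_bound[of "1 / j"] j0 by simp
    \<comment> \<open>\<open>mat 1 + (1 / j) *\<^sub>R B\<close> exceeds
      \<open>mexp (h *\<^sub>R B)\<close> by \<open>(1 / j - h) *\<^sub>R B\<close> minus the
      second-order Taylor remainder; both are of order \<open>1 / j^2\<close>.\<close>
    have "mexp ((- h) *\<^sub>R B) ** (mat 1 + (1 / j) *\<^sub>R B) - mat 1
        = mexp ((- h) *\<^sub>R B) ** ((1 / j - h) *\<^sub>R B - (mexp (h *\<^sub>R B) - mat 1 - h *\<^sub>R B))"
    proof -
      have "mat 1 + (1 / j) *\<^sub>R B = ((1 / j - h) *\<^sub>R B - (mexp (h *\<^sub>R B) - mat 1 - h *\<^sub>R B)) + mexp (h *\<^sub>R B)"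
        by (simp add: algebra_simps)
      then show ?thesis by (simp only: matrix_add_ldistrib mexp_minus) simp
    qed
    then have "opnorm (mexp ((- h) *\<^sub>R B) ** (mat 1 + (1 / j) *\<^sub>R B) - mat 1)
        \<le> opnorm (mexp ((- h) *\<^sub>R B)) * opnorm ((1 / j - h) *\<^sub>R B - (mexp (h *\<^sub>R B) - mat 1 - h *\<^sub>R B))"
      using opnorm_mult by simp
    also have "\<dots> \<le> L * (opnorm B * (1 / j)\<^sup>2 + K * (1 / j)\<^sup>2)"
    proof (intro mult_mono)
      show "opnorm (mexp ((- h) *\<^sub>R B)) \<le> L" using L(2)[of "- h"] h h1 by simp
      have "opnorm ((1 / j - h) *\<^sub>R B - (mexp (h *\<^sub>R B) - mat 1 - h *\<^sub>R B))
          \<le> \<bar>1 / j - h\<bar> * opnorm B + opnorm (mexp (h *\<^sub>R B) - mat 1 - h *\<^sub>R B)"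
        using opnorm_diff[of "(1 / j - h) *\<^sub>R B"] by (simp add: opnorm_scaleR)
      also have "\<dots> \<le> (1 / j)\<^sup>2 * opnorm B + K * (1 / j)\<^sup>2"
      proof (intro add_mono mult_right_mono opnorm_nonneg)
        show "\<bar>1 / j - h\<bar> \<le> (1 / j)\<^sup>2" using hl h by simp
        have "K * h\<^sup>2 \<le> K * (1 / j)\<^sup>2" using h K(1) by (intro mult_left_mono power_mono) auto
        then show "opnorm (mexp (h *\<^sub>R B) - mat 1 - h *\<^sub>R B) \<le> K * (1 / j)\<^sup>2"
          using K(2)[OF h(1) h1] by linarith
      qed
      finally show "opnorm ((1 / j - h) *\<^sub>R B - (mexp (h *\<^sub>R B) - mat 1 - h *\<^sub>R B)) \<le> opnorm B * (1 / j)\<^sup>2 + K * (1 / j)\<^sup>2"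
        by (simp add: mult.commute)
    qed (use L(1) opnorm_nonneg in auto)
    also have "\<dots> = L * (K + opnorm B) / (real j)\<^sup>2" by (simp add: power_divide add_divide_distrib algebra_simps)
    finally show ?thesis by (simp add: h_def)
  qed
  then show ?thesis using L(1) K(1) opnorm_nonneg[of B]
    by (intro exI[of _ "L * (K + opnorm B)"]) auto
qed

text \<open>The transition matrix of the recursion from time \<open>j\<close> to time \<open>j + k\<close>.\<close>

primrec transition :: "real ^ 'n ^ 'n \<Rightarrow> nat \<Rightarrow> nat \<Rightarrow> real ^ 'n ^ 'n" where
  "transition B j 0 = mat 1"
| "transition B j (Suc k) = (mat 1 + (1 / j) *\<^sub>R B) ** transition B (Suc j) k"

text \<open>Exponentials of multiples of \<open>B\<close> commute with \<open>B\<close>, so the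
  quotient \<open>W n j\<close> of the transition matrix by the matrix power satisfies
  \<open>W n j = R j ** W n (Suc j)\<close>, with \<open>R j\<close> within
  \<open>O(1 / j^2)\<close> of the identity. The tail of the series of \<open>1 / j^2\<close> is of
  order \<open>1 / j\<close>, uniformly in \<open>n\<close>.\<close>

lemma transition_approx:
  "\<exists>K\<ge>0. \<forall>j n. 1 \<le> j \<and> j \<le> n \<longrightarrow>
    opnorm (mexp ((- ln (real n / real j)) *\<^sub>R B) ** transition B j (n - j) - mat 1) \<le> K / real j"
proof -
  obtain K where K: "K \<ge> 0" "\<And>j::nat. j \<ge> 1 \<Longrightarrow>
    opnorm (mexp ((- ln ((real j + 1) / real j)) *\<^sub>R B) ** (mat 1 + (1 / real j) *\<^sub>R B) - mat 1) \<le> K / (real j)\<^sup>2"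
    using mexp_step by blast
  define W where "W n j = mexp ((- ln (real n / real j)) *\<^sub>R B) ** transition B j (n - j)" for n j
  define R where "R j = mexp ((- ln ((real j + 1) / j)) *\<^sub>R B) ** (mat 1 + (1 / real j) *\<^sub>R B)" for j :: nat
  \<comment> \<open>\<open>2 / j\<close> dominates the tail sum of \<open>1 / j^2\<close> in a form
    suited to backward induction: one step back absorbs the new term. It serves first in an
    exponent, for boundedness, and then for the error itself.\<close>
  have tel: "2 / (real j + 1) + 1 / (real j)\<^sup>2 \<le> 2 / j" if "j \<ge> 1" for j :: nat
  proof -
    have j: "real j \<ge> 1" using that by simp
    have "1 / (real j)\<^sup>2 = 2 / (real j * (2 * real j))" by (simp add: power2_eq_square)
    also have "\<dots> \<le> 2 / (real j * (real j + 1))"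
      using j by (intro divide_left_mono mult_left_mono mult_pos_pos) auto
    also have "\<dots> = 2 / j - 2 / (real j + 1)" using j by (simp add: field_simps)
    finally show ?thesis by simp
  qed
  have W_rec: "W n j = R j ** W n (Suc j)" if j: "1 \<le> j" "j < n" for n j
  proof -
    define U where "U = mexp ((- ln (real n / (real j + 1))) *\<^sub>R B)"
    have ln: "- ln (real n / real j) = - ln (real n / (real j + 1)) + - ln ((real j + 1) / j)"
      using j by (simp add: ln_div)
    have UB: "U ** B = B ** U" unfolding U_def by (rule mexp_commute)
    have UE: "U ** mexp (s *\<^sub>R B) = mexp (s *\<^sub>R B) ** U" for s
      unfolding U_def mexp_add[symmetric] by (simp add: add.commute)
    have UR: "U ** R j = R j ** U"
      unfolding R_def matrix_mul_assoc UE unfolding matrix_mul_assoc[symmetric]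
      by (simp add: matrix_add_ldistrib mm_add_rdistrib matrix_scalar_ac scalar_matrix_assoc[symmetric] UB)
    have tr: "transition B j (n - j) = (mat 1 + (1 / j) *\<^sub>R B) ** transition B (Suc j) (n - Suc j)"
      using j by (simp add: Suc_diff_Suc[symmetric])
    have WS: "W n (Suc j) = U ** transition B (Suc j) (n - Suc j)"
      by (simp add: W_def U_def add.commute)
    have "W n j = U ** R j ** transition B (Suc j) (n - Suc j)"
      unfolding W_def ln mexp_add tr U_def R_def by (simp add: matrix_mul_assoc)
    also have "\<dots> = R j ** W n (Suc j)"
      unfolding UR WS by (simp add: matrix_mul_assoc)
    finally show ?thesis .
  qed
  have W_last: "W n n = mat 1" if "n \<ge> 1" for n
    using that by (simp add: W_def mexp_zero)
  have W_bound: "opnorm (W n j) \<le> exp (K * (2 / j))" if "1 \<le> j" "j \<le> n" for n j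
    using that(2,1)
  proof (induction rule: inc_induct)
    case base
    then show ?case using K(1) by (simp add: W_last opnorm_one)
  next
    case (step j)
    have "opnorm (W n j) \<le> opnorm (R j) * opnorm (W n (Suc j))"
      unfolding W_rec[OF step.prems step.hyps(2)] by (rule opnorm_mult)
    also have "\<dots> \<le> exp (K / (real j)\<^sup>2) * exp (K * (2 / Suc j))"
    proof (intro mult_mono)
      have "opnorm (R j) \<le> opnorm (R j - mat 1) + opnorm (mat 1 :: real ^ 'a ^ 'a)"
        using opnorm_triangle[of "R j - mat 1" "mat 1"] by simp
      also have "\<dots> \<le> 1 + K / (real j)\<^sup>2"
        using K(2)[OF step.prems] by (simp add: R_def opnorm_one)
      also have "\<dots> \<le> exp (K / (real j)\<^sup>2)" by (rule exp_ge_add_one_self)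
      finally show "opnorm (R j) \<le> exp (K / (real j)\<^sup>2)" .
      show "opnorm (W n (Suc j)) \<le> exp (K * (2 / Suc j))" using step by simp
    qed (auto intro: opnorm_nonneg)
    also have "\<dots> = exp (K * (2 / (real j + 1) + 1 / (real j)\<^sup>2))"
      by (simp add: exp_add[symmetric] algebra_simps)
    also have "\<dots> \<le> exp (K * (2 / j))"
      using mult_left_mono[OF tel[OF step.prems] K(1)] by simp
    finally show ?case .
  qed
  define L where "L = K * exp (2 * K)"
  have L0: "L \<ge> 0" using K(1) by (simp add: L_def)
  have "opnorm (W n j - mat 1) \<le> L * (2 / j)" if "1 \<le> j" "j \<le> n" for n j
    using that(2,1)
  proof (induction rule: inc_induct)
    case base
    then show ?case using L0 by (simp add: W_last)
  next
    case (step j)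
    have "W n j - mat 1 = (R j - mat 1) ** W n (Suc j) + (W n (Suc j) - mat 1)"
      unfolding W_rec[OF step.prems step.hyps(2)]
      using mm_add_rdistrib[of "R j - mat 1" "mat 1" "W n (Suc j)"] by simp
    then have "opnorm (W n j - mat 1) \<le> opnorm ((R j - mat 1) ** W n (Suc j)) + opnorm (W n (Suc j) - mat 1)"
      using opnorm_triangle by metis
    also have "\<dots> \<le> K / (real j)\<^sup>2 * exp (2 * K) + L * (2 / Suc j)"
    proof (intro add_mono order.trans[OF opnorm_mult] mult_mono)
      show "opnorm (R j - mat 1) \<le> K / (real j)\<^sup>2" using K(2)[OF step.prems] by (simp add: R_def)
      have "opnorm (W n (Suc j)) \<le> exp (K * (2 / Suc j))"
        using step by (intro W_bound) auto
      also have "\<dots> \<le> exp (2 * K)"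
      proof -
        have "2 / real (Suc j) \<le> 2" by (simp add: divide_simps)
        then show ?thesis using mult_left_mono[OF _ K(1)] by (metis exp_le_cancel_iff mult.commute)
      qed
      finally show "opnorm (W n (Suc j)) \<le> exp (2 * K)" .
    qed (use K(1) step opnorm_nonneg in auto)
    also have "\<dots> = L * (2 / (real j + 1) + 1 / (real j)\<^sup>2)"
      by (simp add: L_def algebra_simps)
    also have "\<dots> \<le> L * (2 / j)" using tel[OF step.prems] L0 by (rule mult_left_mono)
    finally show ?case .
  qed
  then show ?thesis using L0
    by (intro exI[of _ "2 * L"]) (auto simp: W_def mult.commute)
qed

section \<open>Exponential polynomials and the Jordan form\<close>

text \<open>The degree is only restricted on the imaginary axis. Terms with \<open>Re \<mu> < 0\<close> decay and do not
  matter for the growth rate.\<close>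

inductive exp_poly :: "nat \<Rightarrow> (real \<Rightarrow> complex) \<Rightarrow> bool" for N where
  exp_poly_term: "Re \<mu> < 0 \<or> Re \<mu> = 0 \<and> k \<le> N \<Longrightarrow>
     exp_poly N (\<lambda>t. c * of_real t ^ k * exp (\<mu> * of_real t))"
| exp_poly_add: "exp_poly N f \<Longrightarrow> exp_poly N g \<Longrightarrow> exp_poly N (\<lambda>t. f t + g t)"

lemma exp_poly_zero: "exp_poly N (\<lambda>t. 0)"
  using exp_poly_term[of "-1" 0 N 0] by simp

lemma exp_poly_cmult: "exp_poly N f \<Longrightarrow> exp_poly N (\<lambda>t. c * f t)"
proof (induction rule: exp_poly.induct)
  case (exp_poly_term \<mu> k d)
  then show ?case using exp_poly.exp_poly_term[of \<mu> k N "c * d"] by (simp add: mult.assoc)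
next
  case (exp_poly_add f g)
  then show ?case by (simp add: distrib_left exp_poly.exp_poly_add)
qed

lemma exp_poly_sum: "finite I \<Longrightarrow> (\<And>i. i \<in> I \<Longrightarrow> exp_poly N (f i)) \<Longrightarrow> exp_poly N (\<lambda>t. \<Sum>i\<in>I. f i t)"
  by (induction rule: finite_induct) (auto intro: exp_poly_zero exp_poly_add)

text \<open>Degrees add on the imaginary axis, while a decaying factor makes the product decay. This
  doubles the degree when the exponential is paired with its transpose.\<close>

lemma exp_poly_mult:
  assumes "exp_poly N f" "exp_poly N' g"
  shows "exp_poly (N + N') (\<lambda>t. f t * g t)"
  using assms(1)
proof (induction rule: exp_poly.induct)
  case (exp_poly_term \<mu> k c)
  from assms(2) show ?case
  proof (induction rule: exp_poly.induct)
    case inner: (exp_poly_term \<mu>' k' c')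
    have "exp_poly (N + N') (\<lambda>t. c * c' * of_real t ^ (k + k') * exp ((\<mu> + \<mu>') * of_real t))"
      using exp_poly_term inner by (intro exp_poly.exp_poly_term) auto
    moreover have "exp ((\<mu> + \<mu>') * of_real t) = exp (\<mu> * of_real t) * exp (\<mu>' * of_real t)" for t
      by (simp add: distrib_right exp_add)
    ultimately show ?case by (simp only: power_add mult_ac)
  next
    case (exp_poly_add f g)
    then show ?case by (simp add: distrib_left exp_poly.exp_poly_add)
  qed
next
  case (exp_poly_add f g)
  then show ?case by (simp add: distrib_right exp_poly.exp_poly_add)
qed

lemma exp_poly_continuous_on: "exp_poly N f \<Longrightarrow> continuous_on S f"
  by (induction rule: exp_poly.induct) (auto intro!: continuous_intros)

lemma power_le_fact_exp:
  fixes x :: real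
  assumes "x \<ge> 0"
  shows "x ^ k \<le> fact k * exp x"
proof -
  have "(\<Sum>n\<in>{k}. x ^ n /\<^sub>R fact n) \<le> (\<Sum>n. x ^ n /\<^sub>R fact n)"
    using assms by (intro sum_le_suminf summable_exp_generic) auto
  then show ?thesis by (simp add: exp_def field_simps)
qed

text \<open>A decaying exponential absorbs every power of \<open>t\<close> by
  \<open>power_le_fact_exp\<close>, so only the terms on the imaginary axis can grow.\<close>

lemma exp_poly_bound:
  assumes "exp_poly N f"
  shows "\<exists>K\<ge>0. \<forall>t\<ge>0. cmod (f t) \<le> K * (1 + t) ^ N"
  using assms
proof (induction rule: exp_poly.induct)
  case (exp_poly_term \<mu> k c)
  show ?case
  proof (cases "Re \<mu> < 0")
    case True
    define d where "d = - Re \<mu>"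
    have d: "d > 0" using True by (simp add: d_def)
    have "cmod (c * of_real t ^ k * exp (\<mu> * of_real t)) \<le> cmod c * (fact k / d ^ k) * (1 + t) ^ N" if t: "t \<ge> 0" for t
    proof -
      have "(d * t) ^ k * exp (- (d * t)) \<le> fact k * exp (d * t) * exp (- (d * t))"
        using power_le_fact_exp[of "d * t" k] t d by (intro mult_right_mono) auto
      also have "\<dots> = fact k" by (simp add: exp_minus)
      finally have "t ^ k * exp (- (d * t)) \<le> fact k / d ^ k"
        using d by (simp add: power_mult_distrib field_simps)
      moreover have "cmod (c * of_real t ^ k * exp (\<mu> * of_real t)) = cmod c * (t ^ k * exp (- (d * t)))"
        using t by (simp add: norm_mult norm_power d_def)
      ultimately have "cmod (c * of_real t ^ k * exp (\<mu> * of_real t)) \<le> cmod c * (fact k / d ^ k) * 1"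
        using mult_left_mono[of "t ^ k * exp (- (d * t))" "fact k / d ^ k" "cmod c"] by simp
      also have "\<dots> \<le> cmod c * (fact k / d ^ k) * (1 + t) ^ N"
        using t d by (intro mult_left_mono one_le_power) auto
      finally show ?thesis .
    qed
    then show ?thesis using d by (intro exI[of _ "cmod c * (fact k / d ^ k)"]) auto
  next
    case False
    then have mu: "Re \<mu> = 0" and k: "k \<le> N" using exp_poly_term by auto
    have "cmod (c * of_real t ^ k * exp (\<mu> * of_real t)) \<le> cmod c * (1 + t) ^ N" if t: "t \<ge> 0" for t
    proof -
      have "t ^ k \<le> (1 + t) ^ k" using t by (intro power_mono) auto
      also have "\<dots> \<le> (1 + t) ^ N" using t k by (intro power_increasing) auto
      finally show ?thesis using t mu by (simp add: norm_mult norm_power mult_left_mono)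
    qed
    then show ?thesis by (intro exI[of _ "cmod c"]) auto
  qed
next
  case (exp_poly_add f g)
  then obtain K K' where K: "K \<ge> 0" "\<And>t. t \<ge> 0 \<Longrightarrow> cmod (f t) \<le> K * (1 + t) ^ N"
    and K': "K' \<ge> 0" "\<And>t. t \<ge> 0 \<Longrightarrow> cmod (g t) \<le> K' * (1 + t) ^ N" by blast
  have "cmod (f t + g t) \<le> (K + K') * (1 + t) ^ N" if "t \<ge> 0" for t
    using norm_triangle_ineq[of "f t" "g t"] K(2)[OF that] K'(2)[OF that] by (simp add: distrib_right)
  then show ?case using K(1) K'(1) by (intro exI[of _ "K + K'"]) auto
qed

text \<open>Integration by parts lowers \<open>k\<close>. Since \<open>\<mu> \<noteq> 0\<close>, no
  power of \<open>t\<close> is gained, in contrast to the pure polynomial terms.\<close>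

lemma exp_poly_antiderivative:
  assumes "\<mu> \<noteq> 0" "Re \<mu> < 0 \<or> Re \<mu> = 0 \<and> k \<le> N"
  shows "\<exists>G. exp_poly N G \<and> (\<forall>t. (G has_vector_derivative (of_real t ^ k * exp (\<mu> * of_real t))) (at t))"
  using assms(2)
proof (induction k)
  case 0
  have "((\<lambda>t. 1 / \<mu> * exp (\<mu> * of_real t)) has_vector_derivative exp (\<mu> * of_real t)) (at t)" for t :: real
  proof -
    have "((\<lambda>z. 1 / \<mu> * exp (\<mu> * z)) has_field_derivative exp (\<mu> * of_real t)) (at (of_real t))"
      using assms(1) by (auto intro!: derivative_eq_intros)
    from has_vector_derivative_real_field[OF this] show ?thesis .
  qed
  moreover have "exp_poly N (\<lambda>t. 1 / \<mu> * exp (\<mu> * of_real t))"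
    using exp_poly_term[of \<mu> 0 N "1 / \<mu>"] 0 by simp
  ultimately show ?case by (intro exI[of _ "\<lambda>t. 1 / \<mu> * exp (\<mu> * of_real t)"]) simp
next
  case (Suc k)
  then obtain G where G: "exp_poly N G"
    "\<And>t. (G has_vector_derivative (of_real t ^ k * exp (\<mu> * of_real t))) (at t)" by auto
  define F where "F t = 1 / \<mu> * of_real t ^ Suc k * exp (\<mu> * of_real t) + (- (of_nat (Suc k) / \<mu>)) * G t" for t
  have "exp_poly N F"
    unfolding F_def using Suc.prems by (intro exp_poly_add exp_poly_term exp_poly_cmult G(1))
  moreover have "(F has_vector_derivative (of_real t ^ Suc k * exp (\<mu> * of_real t))) (at t)" for t
  proof -
    have "((\<lambda>z. 1 / \<mu> * z ^ Suc k * exp (\<mu> * z)) has_field_derivative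
        of_real t ^ Suc k * exp (\<mu> * of_real t) + (of_nat (Suc k) / \<mu>) * (of_real t ^ k * exp (\<mu> * of_real t))) (at (of_real t))"
    proof -
      have p: "((\<lambda>z. z ^ Suc k) has_field_derivative (1 + of_nat k) * (1 * of_real t ^ k)) (at (complex_of_real t))"
        by (rule DERIV_power_Suc[OF DERIV_ident])
      have e: "((\<lambda>z. exp (\<mu> * z)) has_field_derivative exp (\<mu> * of_real t) * (\<mu> * 1)) (at (complex_of_real t))"
        by (intro DERIV_fun_exp DERIV_cmult DERIV_ident)
      show ?thesis
        by (rule DERIV_cong[OF DERIV_mult[OF DERIV_cmult[OF p, of "1 / \<mu>"] e]])
          (use assms(1) in \<open>simp add: field_simps\<close>)
    qed
    from has_vector_derivative_real_field[OF this]
    have "((\<lambda>t. 1 / \<mu> * of_real t ^ Suc k * exp (\<mu> * of_real t)) has_vector_derivative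
        of_real t ^ Suc k * exp (\<mu> * of_real t) + (of_nat (Suc k) / \<mu>) * (of_real t ^ k * exp (\<mu> * of_real t))) (at t)" .
    from has_vector_derivative_add[OF this has_vector_derivative_mult_right[OF G(2), of "- (of_nat (Suc k) / \<mu>)" t]]
    show ?thesis unfolding F_def by (simp del: of_nat_Suc power_Suc)
  qed
  ultimately show ?case by blast
qed

text \<open>Only a term with \<open>\<mu> = 0\<close> and \<open>k = N\<close> survives the
  normalisation, since its integral is a multiple of \<open>L ^ Suc N\<close>. Lower powers lose at
  least one factor \<open>L\<close>, and for \<open>\<mu> \<noteq> 0\<close> the antiderivative
  grows at most like \<open>L ^ N\<close>.\<close>

lemma exp_poly_mean_tendsto:
  assumes "exp_poly N f"
  shows "\<exists>l. ((\<lambda>L. (1 / L ^ Suc N) *\<^sub>R integral {0..L} f) \<longlongrightarrow> l) at_top"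
  using assms
proof (induction rule: exp_poly.induct)
  case (exp_poly_term \<mu> k c)
  have int: "integral {0..L} (\<lambda>t. c * of_real t ^ k * exp (\<mu> * of_real t)) = G L - G 0"
    if "\<And>t. (G has_vector_derivative (c * of_real t ^ k * exp (\<mu> * of_real t))) (at t)" "L \<ge> 0" for G and L :: real
    by (rule integral_unique[OF fundamental_theorem_of_calculus[OF that(2)]])
      (rule has_vector_derivative_at_within[OF that(1)])
  show ?case
  proof (cases "\<mu> = 0")
    case True
    then have k: "k \<le> N" using exp_poly_term by simp
    define G where "G t = c * of_real t ^ Suc k / of_nat (Suc k)" for t :: real
    have "(G has_vector_derivative (c * of_real t ^ k * exp (\<mu> * of_real t))) (at t)" for t
    proof -
      have "((\<lambda>z. c * z ^ Suc k / of_nat (Suc k)) has_field_derivative c * of_real t ^ k) (at (of_real t))"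
        by (rule derivative_eq_intros refl | simp del: of_nat_Suc)+
      from has_vector_derivative_real_field[OF this] show ?thesis
        unfolding G_def True by simp
    qed
    note I = int[OF this]
    have "((\<lambda>L. (1 / L ^ Suc N) *\<^sub>R G L) \<longlongrightarrow> (if k = N then c / of_nat (Suc k) else 0)) at_top"
    proof (cases "k = N")
      case True
      have "\<forall>\<^sub>F L in at_top. (1 / L ^ Suc N) *\<^sub>R G L = c / of_nat (Suc k)"
        using eventually_gt_at_top[of 0]
        by eventually_elim (simp add: G_def True scaleR_conv_of_real field_simps del: of_nat_Suc power_Suc)
      then show ?thesis using True by (simp add: tendsto_eventually)
    next
      case False
      define m where "m = N - k - 1"
      have N: "Suc N = Suc k + Suc m" using False k by (simp add: m_def)
      have "((\<lambda>L. complex_of_real (1 / L ^ Suc m) * (c / of_nat (Suc k))) \<longlongrightarrow> of_real 0 * (c / of_nat (Suc k))) at_top"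
        by (intro tendsto_intros tendsto_divide_0[OF tendsto_const] filterlim_at_top_imp_at_infinity
            filterlim_pow_at_top filterlim_ident) simp
      moreover have "\<forall>\<^sub>F L in at_top. complex_of_real (1 / L ^ Suc m) * (c / of_nat (Suc k)) = (1 / L ^ Suc N) *\<^sub>R G L"
        using eventually_gt_at_top[of 0]
        by eventually_elim (simp add: G_def N power_add scaleR_conv_of_real field_simps del: of_nat_Suc power_Suc)
      ultimately show ?thesis using False by (simp add: filterlim_cong)
    qed
    note lim = this
    show ?thesis
    proof (rule exI, rule Lim_transform_eventually[OF lim])
      show "\<forall>\<^sub>F L in at_top. (1 / L ^ Suc N) *\<^sub>R G L
        = (1 / L ^ Suc N) *\<^sub>R integral {0..L} (\<lambda>t. c * of_real t ^ k * exp (\<mu> * of_real t))"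
      using eventually_ge_at_top[of 0] by eventually_elim (simp add: I, simp add: G_def)
    qed
  next
    case False
    obtain G0 where G0: "exp_poly N G0"
      "\<And>t. (G0 has_vector_derivative (of_real t ^ k * exp (\<mu> * of_real t))) (at t)"
      using exp_poly_antiderivative[OF False exp_poly_term] by blast
    define G where "G t = c * G0 t" for t
    have G: "exp_poly N G" unfolding G_def by (rule exp_poly_cmult[OF G0(1)])
    have "(G has_vector_derivative (c * of_real t ^ k * exp (\<mu> * of_real t))) (at t)" for t
      using has_vector_derivative_mult_right[OF G0(2), of c t] unfolding G_def by (simp add: mult.assoc)
    note I = int[OF this]
    obtain K where K: "K \<ge> 0" "\<And>t. t \<ge> 0 \<Longrightarrow> cmod (G t) \<le> K * (1 + t) ^ N"
      using exp_poly_bound[OF G] by blast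
    have "((\<lambda>L. (1 / L ^ Suc N) *\<^sub>R integral {0..L} (\<lambda>t. c * of_real t ^ k * exp (\<mu> * of_real t))) \<longlongrightarrow> 0) at_top"
    proof (rule Lim_null_comparison)
      show "\<forall>\<^sub>F L in at_top. norm ((1 / L ^ Suc N) *\<^sub>R integral {0..L} (\<lambda>t. c * of_real t ^ k * exp (\<mu> * of_real t)))
          \<le> 2 * K * 2 ^ N / L"
        using eventually_ge_at_top[of 1]
      proof eventually_elim
        case (elim L)
        have "cmod (G L - G 0) \<le> K * (1 + L) ^ N + K * (1 + 0) ^ N"
          using norm_triangle_ineq4[of "G L" "G 0"] K(2)[of L] K(2)[of 0] elim by linarith
        also have "\<dots> \<le> K * (2 * L) ^ N + K * (2 * L) ^ N"
          using elim K(1) by (intro add_mono mult_left_mono power_mono) auto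
        also have "\<dots> = 2 * K * 2 ^ N * L ^ N" by (simp add: power_mult_distrib)
        finally have "cmod (G L - G 0) \<le> 2 * K * 2 ^ N * L ^ N" .
        then have "cmod (G L - G 0) / L ^ Suc N \<le> 2 * K * 2 ^ N * L ^ N / L ^ Suc N"
          using elim by (intro divide_right_mono) auto
        also have "\<dots> = 2 * K * 2 ^ N / L" using elim by simp
        finally have "norm ((1 / L ^ Suc N) *\<^sub>R (G L - G 0)) \<le> 2 * K * 2 ^ N / L"
          using elim by (simp only: norm_scaleR) simp
        moreover have "0 \<le> L" using elim by simp
        ultimately show ?case by (simp only: I)
      qed
      show "((\<lambda>L. 2 * K * 2 ^ N / L) \<longlongrightarrow> 0) at_top"
        by (intro tendsto_divide_0[OF tendsto_const] filterlim_at_top_imp_at_infinity filterlim_ident)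
    qed
    then show ?thesis by blast
  qed
next
  case (exp_poly_add f g)
  then obtain l l' where "((\<lambda>L. (1 / L ^ Suc N) *\<^sub>R integral {0..L} f) \<longlongrightarrow> l) at_top"
    "((\<lambda>L. (1 / L ^ Suc N) *\<^sub>R integral {0..L} g) \<longlongrightarrow> l') at_top" by blast
  from tendsto_add[OF this]
  have "((\<lambda>L. (1 / L ^ Suc N) *\<^sub>R integral {0..L} f + (1 / L ^ Suc N) *\<^sub>R integral {0..L} g) \<longlongrightarrow> l + l') at_top" .
  moreover have "(1 / L ^ Suc N) *\<^sub>R integral {0..L} f + (1 / L ^ Suc N) *\<^sub>R integral {0..L} g
      = (1 / L ^ Suc N) *\<^sub>R integral {0..L} (\<lambda>t. f t + g t)" for L
    using exp_poly_continuous_on[OF exp_poly_add.hyps(1)] exp_poly_continuous_on[OF exp_poly_add.hyps(2)]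
    by (subst integral_add) (auto intro: integrable_continuous_interval simp: scaleR_add_right)
  ultimately show ?case by auto
qed

section \<open>Entries of powers of a matrix with a Jordan form\<close>

inductive jordan_seq :: "(nat \<times> complex) set \<Rightarrow> (nat \<Rightarrow> complex) \<Rightarrow> bool" for S where
  jordan_seq_zero: "jordan_seq S (\<lambda>r. 0)"
| jordan_seq_term: "(m, a) \<in> S \<Longrightarrow> k < m \<Longrightarrow> jordan_seq S (\<lambda>r. c * (of_nat (r choose k) * a ^ (r - k)))"
| jordan_seq_add: "jordan_seq S f \<Longrightarrow> jordan_seq S g \<Longrightarrow> jordan_seq S (\<lambda>r. f r + g r)"

lemma jordan_seq_cmult: "jordan_seq S f \<Longrightarrow> jordan_seq S (\<lambda>r. c * f r)"
proof (induction rule: jordan_seq.induct)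
  case (jordan_seq_term m a k d)
  then show ?case using jordan_seq.jordan_seq_term[of m a S k "c * d"] by (simp add: mult.assoc)
next
  case (jordan_seq_add f g)
  then show ?case by (simp add: distrib_left jordan_seq.jordan_seq_add)
qed (simp add: jordan_seq_zero)

lemma jordan_seq_sum: "finite I \<Longrightarrow> (\<And>i. i \<in> I \<Longrightarrow> jordan_seq S (f i)) \<Longrightarrow> jordan_seq S (\<lambda>r. \<Sum>i\<in>I. f i r)"
  by (induction rule: finite_induct) (auto intro: jordan_seq_zero jordan_seq_add)

text \<open>The generators of \<open>jordan_seq\<close> are modelled on this case: at distance
  \<open>k\<close> above the diagonal, the \<open>r\<close>-th power of a block has the entry
  \<open>r choose k\<close> times \<open>a ^ (r - k)\<close>. The binomial coefficient vanishes when
  the subtraction is truncated.\<close>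

lemma jordan_seq_block:
  assumes "(m, a) \<in> S" "i < m" "j < m"
  shows "jordan_seq S (\<lambda>r. (jordan_block m a ^\<^sub>m r) $$ (i, j))"
proof (cases "i \<le> j")
  case True
  have "of_nat (r choose (j - i)) * a ^ (r + i - j) = 1 * (of_nat (r choose (j - i)) * a ^ (r - (j - i)))" for r
    using True by simp
  then show ?thesis
    using jordan_seq_term[of m a S "j - i" 1] assms True by (simp add: jordan_block_pow)
next
  case False
  then show ?thesis using assms jordan_seq_zero by (simp add: jordan_block_pow)
qed

lemma jordan_seq_diag_block:
  assumes "set n_as \<subseteq> S" "i < sum_list (map fst n_as)" "j < sum_list (map fst n_as)"
  shows "jordan_seq S (\<lambda>r. diag_block_mat (map (\<lambda>(m, a). jordan_block m a ^\<^sub>m r) n_as) $$ (i, j))"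
  using assms
proof (induction n_as arbitrary: i j)
  case (Cons na n_as)
  obtain m a where na: "na = (m, a)" by force
  let ?D = "\<lambda>r. diag_block_mat (map (\<lambda>(m, a). jordan_block m a ^\<^sub>m r) n_as)"
  have dim: "dim_row (?D r) = sum_list (map fst n_as)" "dim_col (?D r) = sum_list (map fst n_as)" for r
  proof -
    have "dim_row (case x of (m, a) \<Rightarrow> jordan_block m a ^\<^sub>m r) = fst x"
      "dim_col (case x of (m, a) \<Rightarrow> jordan_block m a ^\<^sub>m r) = fst x" for x :: "nat \<times> complex"
      by (cases x; simp only: prod.case jordan_block_pow_dim fst_conv)+
    then show "dim_row (?D r) = sum_list (map fst n_as)" "dim_col (?D r) = sum_list (map fst n_as)"
      by (simp_all only: dim_diag_block_mat map_map o_def)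
  qed
  have eq: "diag_block_mat (map (\<lambda>(m, a). jordan_block m a ^\<^sub>m r) (na # n_as)) $$ (i, j) =
      (if i < m then if j < m then (jordan_block m a ^\<^sub>m r) $$ (i, j) else 0
       else if j < m then 0 else ?D r $$ (i - m, j - m))" for r
    using Cons.prems by (auto simp: na Let_def dim)
  consider "i < m" "j < m" | "i < m" "\<not> j < m" | "\<not> i < m" "j < m" | "\<not> i < m" "\<not> j < m" by blast
  then show ?case
  proof cases
    case 1
    then show ?thesis unfolding eq using jordan_seq_block[of m a S i j] Cons.prems(1) by (simp add: na)
  next
    case 4
    then show ?thesis unfolding eq using Cons.IH[of "i - m" "j - m"] Cons.prems by (simp add: na)
  qed (simp_all only: eq if_True if_False jordan_seq_zero)
qed simp

lemma mat_mult_entry: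
  assumes "A \<in> carrier_mat n n" "B \<in> carrier_mat n n" "i < n" "j < n"
  shows "(A * B) $$ (i, j) = (\<Sum>k<n. A $$ (i, k) * B $$ (k, j))"
  using assms by (auto simp: scalar_prod_def lessThan_atLeast0 intro!: sum.cong)

text \<open>Similarity expresses the entries as combinations of entries of powers of the Jordan
  matrix, with coefficients independent of \<open>r\<close>.\<close>

lemma jordan_seq_power:
  assumes A: "A \<in> carrier_mat n n" and J: "jordan_nf A n_as" and i: "i < n" and j: "j < n"
  shows "jordan_seq (set n_as) (\<lambda>r. (A ^\<^sub>m r) $$ (i, j))"
proof -
  obtain P Q where PQ: "P \<in> carrier_mat n n" "Q \<in> carrier_mat n n"
    "\<And>r. A ^\<^sub>m r = P * (jordan_matrix n_as) ^\<^sub>m r * Q"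
    using jordan_nf_powE[OF A J] by metis
  have "similar_mat A (jordan_matrix n_as)" using J by (simp add: jordan_nf_def)
  then have Jn: "jordan_matrix n_as \<in> carrier_mat n n"
    using A unfolding similar_mat_def by (meson similar_mat_witD2(5))
  then have n: "sum_list (map fst n_as) = n" by (metis carrier_matD(1) jordan_matrix_dim(1))
  have "(A ^\<^sub>m r) $$ (i, j) = (\<Sum>k<n. \<Sum>l<n. (P $$ (i, l) * Q $$ (k, j)) * (jordan_matrix n_as ^\<^sub>m r) $$ (l, k))" for r
  proof -
    have Jr: "jordan_matrix n_as ^\<^sub>m r \<in> carrier_mat n n" using Jn by (rule pow_carrier_mat)
    have PJ: "P * jordan_matrix n_as ^\<^sub>m r \<in> carrier_mat n n" using PQ(1) Jr by (rule mult_carrier_mat)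
    have "(A ^\<^sub>m r) $$ (i, j) = (\<Sum>k<n. (P * jordan_matrix n_as ^\<^sub>m r) $$ (i, k) * Q $$ (k, j))"
      unfolding PQ(3) by (rule mat_mult_entry[OF PJ PQ(2) i j])
    also have "\<dots> = (\<Sum>k<n. (\<Sum>l<n. P $$ (i, l) * (jordan_matrix n_as ^\<^sub>m r) $$ (l, k)) * Q $$ (k, j))"
      using mat_mult_entry[OF PQ(1) Jr i] by (intro sum.cong refl arg_cong2[where f = "(*)"]) auto
    finally show ?thesis by (simp add: sum_distrib_left sum_distrib_right mult_ac)
  qed
  moreover have "jordan_seq (set n_as) (\<lambda>r. (jordan_matrix n_as ^\<^sub>m r) $$ (l, k))" if "l < n" "k < n" for l k
    unfolding jordan_matrix_pow using that n by (intro jordan_seq_diag_block) auto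
  ultimately show ?thesis
    by (simp only:) (intro jordan_seq_sum jordan_seq_cmult; simp)
qed

text \<open>The terms below \<open>k\<close> vanish, and after an index shift the binomial
  coefficient cancels against the factorial, which leaves the exponential series of
  \<open>a * z\<close>. The position inside a Jordan block thus becomes a power of the time
  variable.\<close>

lemma choose_exp_sums:
  "(\<lambda>r. of_nat (r choose k) * a ^ (r - k) * (z ^ r / fact r)) sums (z ^ k / fact k * exp (a * z :: complex))"
proof -
  have "(\<lambda>n. z ^ k / fact k * ((a * z) ^ n /\<^sub>R fact n)) sums (z ^ k / fact k * exp (a * z))"
    by (intro sums_mult exp_converges)
  moreover have "of_nat ((n + k) choose k) * a ^ ((n + k) - k) * (z ^ (n + k) / fact (n + k))
      = z ^ k / fact k * ((a * z) ^ n /\<^sub>R fact n)" for n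
  proof -
    have "(of_nat ((n + k) choose k) :: complex) = fact (n + k) / (fact k * fact n)"
      using binomial_fact[of k "n + k"] by simp
    then show ?thesis
      by (simp add: power_mult_distrib power_add scaleR_conv_of_real field_simps)
  qed
  ultimately have "(\<lambda>n. of_nat ((n + k) choose k) * a ^ ((n + k) - k) * (z ^ (n + k) / fact (n + k))) sums
      (z ^ k / fact k * exp (a * z))" by simp
  then show ?thesis
    by (subst (asm) sums_iff_shift) (simp add: binomial_eq_0)
qed

text \<open>The argument \<open>- t\<close> fits \<open>H = I - B\<close>, from whose Jordan form
  \<nu> is defined: an eigenvalue \<open>a\<close> of \<open>H\<close> contributes the exponent
  \<open>c - a\<close> once the factor \<open>exp (- c * of_real t)\<close> is split off.\<close>

lemma jordan_seq_exp_poly: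
  assumes "jordan_seq S s"
    and S: "\<And>m a k. (m, a) \<in> S \<Longrightarrow> k < m \<Longrightarrow> Re (c - a) < 0 \<or> Re (c - a) = 0 \<and> k \<le> N"
  shows "\<exists>f. exp_poly N f \<and> (\<forall>t. (\<lambda>r. s r * (of_real (- t) ^ r / fact r)) sums (exp (- c * of_real t) * f t))"
  using assms(1)
proof (induction rule: jordan_seq.induct)
  case jordan_seq_zero
  show ?case by (intro exI[of _ "\<lambda>t. 0"]) (simp add: exp_poly_zero)
next
  case (jordan_seq_term m a k d)
  let ?f = "\<lambda>t. d * (-1) ^ k / fact k * of_real t ^ k * exp ((c - a) * of_real t)"
  have "exp_poly N ?f" by (rule exp_poly_term[OF S[OF jordan_seq_term]])
  moreover have "(\<lambda>r. d * (of_nat (r choose k) * a ^ (r - k)) * (of_real (- t) ^ r / fact r)) sums (exp (- c * of_real t) * ?f t)" for t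
  proof -
    have s: "(\<lambda>r. d * (of_nat (r choose k) * a ^ (r - k) * (of_real (- t) ^ r / fact r))) sums
        (d * (of_real (- t) ^ k / fact k * exp (a * of_real (- t))))"
      by (intro sums_mult choose_exp_sums)
    have e: "d * (of_real (- t) ^ k / fact k * exp (a * of_real (- t))) = exp (- c * of_real t) * ?f t"
    proof -
      have "exp (a * of_real (- t)) = exp (- c * of_real t) * exp ((c - a) * of_real t)"
        by (simp add: exp_add[symmetric] algebra_simps)
      moreover have "complex_of_real (- t) ^ k = (-1) ^ k * of_real t ^ k"
        using power_minus[of "complex_of_real t" k] by simp
      ultimately show ?thesis by (simp only:) simp
    qed
    show ?thesis using s unfolding e by (simp only: mult.assoc)
  qed
  ultimately show ?case by (intro exI[of _ ?f]) simp
next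
  case (jordan_seq_add s s')
  then obtain f g where fg: "exp_poly N f" "\<And>t. (\<lambda>r. s r * (of_real (- t) ^ r / fact r)) sums (exp (- c * of_real t) * f t)"
    "exp_poly N g" "\<And>t. (\<lambda>r. s' r * (of_real (- t) ^ r / fact r)) sums (exp (- c * of_real t) * g t)" by blast
  show ?case
  proof (intro exI[of _ "\<lambda>t. f t + g t"] conjI exp_poly_add fg(1,3) allI)
    show "(\<lambda>r. (s r + s' r) * (of_real (- t) ^ r / fact r)) sums (exp (- c * of_real t) * (f t + g t))" for t
      unfolding distrib_left distrib_right by (rule sums_add[OF fg(2,4)])
  qed
qed

section \<open>Passage from real matrices to indexed complex matrices\<close>

definition index_of :: "'v::finite \<Rightarrow> nat" where
  "index_of v = the_inv_into {..<CARD('v)} (from_nat_into (UNIV :: 'v set)) v"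

lemma bij_index: "bij_betw (from_nat_into (UNIV :: 'v::finite set)) {..<CARD('v)} UNIV"
  by (rule bij_betw_from_nat_into_finite) simp_all

lemma index_of: "index_of (v :: 'v::finite) < CARD('v)" "from_nat_into UNIV (index_of v) = v"
proof -
  have "v \<in> from_nat_into (UNIV :: 'v set) ` {..<CARD('v)}" using bij_index[where 'v = 'v] by (simp add: bij_betw_def)
  then show "index_of v < CARD('v)" "from_nat_into UNIV (index_of v) = v"
    using the_inv_into_into[of "from_nat_into (UNIV :: 'v set)" "{..<CARD('v)}" v "{..<CARD('v)}"]
      f_the_inv_into_f[of "from_nat_into (UNIV :: 'v set)" "{..<CARD('v)}" v] bij_index[where 'v = 'v]
    by (auto simp: index_of_def bij_betw_def)
qed

lemma complex_mat_carrier: "complex_mat (A :: real ^ 'v ^ 'v) \<in> carrier_mat CARD('v::finite) CARD('v)"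
  by (simp add: complex_mat_def)

lemma complex_mat_mult: "complex_mat (A ** B) = complex_mat A * complex_mat (B :: real ^ 'v::finite ^ 'v)"
proof (rule eq_matI)
  fix i j assume "i < dim_row (complex_mat A * complex_mat B)" "j < dim_col (complex_mat A * complex_mat B)"
  then have ij: "i < CARD('v)" "j < CARD('v)" by (simp_all add: complex_mat_def)
  let ?e = "from_nat_into (UNIV :: 'v set)"
  have "complex_mat (A ** B) $$ (i, j) = (\<Sum>k\<in>UNIV. complex_of_real (A $ ?e i $ k * B $ k $ ?e j))"
    using ij by (simp add: complex_mat_def mm_entry)
  also have "\<dots> = (\<Sum>k<CARD('v). complex_of_real (A $ ?e i $ ?e k * B $ ?e k $ ?e j))"
    by (rule sum.reindex_bij_betw[OF bij_index, symmetric])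
  also have "\<dots> = (complex_mat A * complex_mat B) $$ (i, j)"
    using ij by (simp add: complex_mat_def scalar_prod_def lessThan_atLeast0)
  finally show "complex_mat (A ** B) $$ (i, j) = (complex_mat A * complex_mat B) $$ (i, j)" .
qed (simp_all add: complex_mat_def)

lemma complex_mat_one: "complex_mat (mat 1 :: real ^ 'v::finite ^ 'v) = 1\<^sub>m CARD('v)"
proof (rule eq_matI)
  fix i j assume "i < dim_row (1\<^sub>m CARD('v) :: complex Matrix.mat)" "j < dim_col (1\<^sub>m CARD('v) :: complex Matrix.mat)"
  then have ij: "i < CARD('v)" "j < CARD('v)" by simp_all
  then have "from_nat_into (UNIV :: 'v set) i = from_nat_into UNIV j \<longleftrightarrow> i = j"
    using bij_index[where 'v = 'v] by (auto simp: bij_betw_def inj_on_def)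
  then show "complex_mat (mat 1 :: real ^ 'v ^ 'v) $$ (i, j) = 1\<^sub>m CARD('v) $$ (i, j)"
    using ij by (simp add: complex_mat_def mat_def)
qed (simp_all add: complex_mat_def)

lemma complex_mat_diff: "complex_mat (A - B) = complex_mat A - complex_mat B"
  by (rule eq_matI) (simp_all add: complex_mat_def)

lemma complex_mat_mpow: "complex_mat (mpow A n) = complex_mat (A :: real ^ 'v::finite ^ 'v) ^\<^sub>m n"
proof (induction n)
  case 0
  show ?case by (simp add: complex_mat_one carrier_matD(1)[OF complex_mat_carrier])
next
  case (Suc n)
  have "complex_mat (mpow A (Suc n)) = complex_mat (mpow A n ** A)" by (simp only: mpow_Suc mpow_commute)
  then show ?case by (simp only: complex_mat_mult Suc pow_mat.simps)
qed

lemma complex_mat_index: "complex_of_real (A $ v $ w) = complex_mat A $$ (index_of v, index_of w)"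
  by (simp add: complex_mat_def index_of)

text \<open>The matrix is written as \<open>c *\<^sub>R mat 1 - H\<close> so that the Jordan form of
  \<open>mat 1 - B\<close> applies directly. At the critical point \<open>c = 1/2\<close>; below it
  a slightly larger \<open>c\<close> leaves room for exponential decay.\<close>

lemma mexp_exp_poly:
  fixes H :: "real ^ 'v::finite ^ 'v"
  assumes J: "jordan_nf (complex_mat H) n_as"
    and S: "\<And>m a k. (m, a) \<in> set n_as \<Longrightarrow> k < m \<Longrightarrow> Re (of_real c - a) < 0 \<or> Re (of_real c - a) = 0 \<and> k \<le> N"
  shows "exp_poly N (\<lambda>t. of_real (mexp (t *\<^sub>R (c *\<^sub>R mat 1 - H)) $ v $ w))"
proof -
  have "jordan_seq (set n_as) (\<lambda>r. complex_of_real (mpow H r $ v $ w))"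
    unfolding complex_mat_index complex_mat_mpow
    by (rule jordan_seq_power[OF complex_mat_carrier J]) (rule index_of)+
  then have "\<exists>f. exp_poly N f \<and> (\<forall>t. (\<lambda>r. complex_of_real (mpow H r $ v $ w) * (of_real (- t) ^ r / fact r))
      sums (exp (- of_real c * of_real t) * f t))"
    by (rule jordan_seq_exp_poly) (rule S)
  then obtain f where f: "exp_poly N f" and s: "\<And>t. (\<lambda>r. complex_of_real (mpow H r $ v $ w) * (of_real (- t) ^ r / fact r))
      sums (exp (- of_real c * of_real t) * f t)"
    by blast
  have "complex_of_real (mexp (t *\<^sub>R (c *\<^sub>R mat 1 - H)) $ v $ w) = f t" for t
  proof -
    have "(\<lambda>r. (mpow H r $ v $ w / fact r) * (- t) ^ r) sums (mexp ((- t) *\<^sub>R H) $ v $ w)"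
      unfolding mexp_entry by (rule summable_sums[OF summable_mexp_entry])
    then have "(\<lambda>r. complex_of_real ((mpow H r $ v $ w / fact r) * (- t) ^ r)) sums of_real (mexp ((- t) *\<^sub>R H) $ v $ w)"
      by (rule sums_of_real)
    then have "(\<lambda>r. complex_of_real (mpow H r $ v $ w) * (of_real (- t) ^ r / fact r)) sums of_real (mexp ((- t) *\<^sub>R H) $ v $ w)"
      by simp
    from sums_unique2[OF this s[of t]]
    have E: "complex_of_real (mexp ((- t) *\<^sub>R H) $ v $ w) = exp (- of_real c * of_real t) * f t" .
    have "mexp (t *\<^sub>R (c *\<^sub>R mat 1 - H)) = exp (c * t) *\<^sub>R mexp ((- t) *\<^sub>R H)"
      using mexp_shift[of t "- H" c] by simp
    then have "complex_of_real (mexp (t *\<^sub>R (c *\<^sub>R mat 1 - H)) $ v $ w)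
        = exp (of_real c * of_real t) * complex_of_real (mexp ((- t) *\<^sub>R H) $ v $ w)"
      by (simp flip: exp_of_real)
    also have "\<dots> = (exp (of_real c * of_real t) * exp (- of_real c * of_real t)) * f t"
      unfolding E by (rule mult.assoc[symmetric])
    also have "exp (of_real c * of_real t) * exp (- complex_of_real c * of_real t) = 1"
      by (simp flip: exp_add)
    finally show ?thesis by simp
  qed
  then show ?thesis using f by simp
qed


section \<open>The spectrum of a matrix B through the Jordan form of I - B\<close>

lemma jordan_nf_complex_mat: "jordan_nf (complex_mat A) (SOME n_as. jordan_nf (complex_mat A) n_as)"
proof (rule someI_ex)
  \<comment> \<open>Over the complex numbers the characteristic polynomial splits, so a Jordan form
    exists and the choice operator returns one.\<close>
  obtain as where "char_poly (complex_mat A) = (\<Prod>a\<leftarrow>as. [:- a, 1:])"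
    using char_poly_factorized[OF complex_mat_carrier] by blast
  then show "\<exists>n_as. jordan_nf (complex_mat A) n_as"
    by (rule jordan_nf_exists[OF complex_mat_carrier])
qed

lemma eigenvalue_jordan_nf:
  fixes A :: "complex Matrix.mat"
  assumes A: "A \<in> carrier_mat n n" and J: "jordan_nf A n_as"
  shows "eigenvalue A z \<longleftrightarrow> (\<exists>m. (m, z) \<in> set n_as)"
proof -
  \<comment> \<open>A block of size 0 would list a number that is not an eigenvalue; the notion of a
    Jordan form excludes such blocks.\<close>
  have m: "m \<noteq> 0" if "(m, a) \<in> set n_as" for m a
    using J that unfolding jordan_nf_def by force
  have "eigenvalue A z \<longleftrightarrow> (\<Prod>(m, a)\<leftarrow>n_as. (z - a) ^ m) = 0"
  proof -
    have "poly (\<Prod>(m, a)\<leftarrow>xs. [:- a, 1:] ^ m) z = (\<Prod>(m, a)\<leftarrow>xs. (z - a) ^ m)" for xs :: "(nat \<times> complex) list"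
      by (induction xs) (auto simp: poly_power)
    then show ?thesis unfolding eigenvalue_root_char_poly[OF A] jordan_nf_char_poly[OF J] by simp
  qed
  also have "\<dots> \<longleftrightarrow> (\<exists>(m, a)\<in>set n_as. (z - a) ^ m = 0)"
    unfolding prod_list_zero_iff by (force simp: image_iff)
  also have "\<dots> \<longleftrightarrow> (\<exists>m. (m, z) \<in> set n_as)"
    using m by fastforce
  finally show ?thesis .
qed

lemma eigenvalue_one_minus:
  fixes B :: "real ^ 'v::finite ^ 'v"
  shows "eigenvalue (complex_mat (mat 1 - B)) (1 - z) \<longleftrightarrow> eigenvalue (complex_mat B) z"
proof -
  have *: "(1\<^sub>m CARD('v) - complex_mat B) *\<^sub>v x = (1 - z) \<cdot>\<^sub>v x \<longleftrightarrow> complex_mat B *\<^sub>v x = z \<cdot>\<^sub>v x"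
    if x: "x \<in> carrier_vec CARD('v)" for x
  proof -
    have "(1\<^sub>m CARD('v) - complex_mat B) *\<^sub>v x = x - complex_mat B *\<^sub>v x"
      using x by (simp add: minus_mult_distrib_mat_vec[OF one_carrier_mat complex_mat_carrier x])
    moreover have "x - complex_mat B *\<^sub>v x = (1 - z) \<cdot>\<^sub>v x \<longleftrightarrow> complex_mat B *\<^sub>v x = z \<cdot>\<^sub>v x"
    proof -
      have d: "dim_vec (complex_mat B *\<^sub>v x) = CARD('v)" "dim_vec x = CARD('v)"
        using x by (simp_all add: complex_mat_def)
      have "p - q = (1 - z) * p \<longleftrightarrow> q = z * p" for p q
        by (auto simp: algebra_simps)
      then show ?thesis using d by (simp add: Matrix.vec_eq_iff)
    qed
    ultimately show ?thesis by simp
  qed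
  show ?thesis
    unfolding eigenvalue_def eigenvector_def complex_mat_diff complex_mat_one
    using * by (auto simp: complex_mat_def)
qed

lemma finite_eigenvalues:
  fixes B :: "real ^ 'v::finite ^ 'v"
  shows "finite {z. eigenvalue (complex_mat B) z}" "{z. eigenvalue (complex_mat B) z} \<noteq> {}"
  using card_finite_spectrum(1)[OF complex_mat_carrier[of B]] spectrum_non_empty[OF complex_mat_carrier[of B]]
  by (auto simp: spectrum_def)

lemma eigenvalue_le_max: "eigenvalue (complex_mat B) z \<Longrightarrow> Re z \<le> max_Re_eigenvalue B"
  unfolding max_Re_eigenvalue_def using finite_eigenvalues[of B] by (intro Max_ge) auto

lemma max_Re_eigenvalue_attained: "\<exists>z. eigenvalue (complex_mat B) z \<and> Re z = max_Re_eigenvalue B"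
proof -
  have "max_Re_eigenvalue B \<in> Re ` {z. eigenvalue (complex_mat B) z}"
    unfolding max_Re_eigenvalue_def using finite_eigenvalues[of B] by (intro Max_in) auto
  then show ?thesis by auto
qed

text \<open>The growth of the exponential is governed by single blocks, whereas \<nu> counts the
  whole Jordan part. This inequality is where the two meet.\<close>

lemma jordan_block_le_part:
  assumes "(m, a) \<in> set (SOME n_as. jordan_nf A n_as)"
  shows "m \<le> jordan_part_size A a"
proof -
  have "(m, a) \<in> set xs \<Longrightarrow> m \<le> (\<Sum>(n, b)\<leftarrow>xs. if b = a then n else 0)" for xs :: "(nat \<times> complex) list"
    by (induction xs) auto
  then show ?thesis using assms unfolding jordan_part_size_def by blast
qed

lemma jordan_part_le_max:
  assumes "eigenvalue (complex_mat B) z" "Re z = max_Re_eigenvalue B"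
  shows "jordan_part_size (complex_mat (mat 1 - B)) (1 - z) \<le> max_jordan_part B"
  unfolding max_jordan_part_def
proof (rule Max_ge)
  have "{jordan_part_size (complex_mat (mat 1 - B)) (1 - z) | z.
     eigenvalue (complex_mat B) z \<and> Re z = max_Re_eigenvalue B}
    \<subseteq> (\<lambda>z. jordan_part_size (complex_mat (mat 1 - B)) (1 - z)) ` {z. eigenvalue (complex_mat B) z}" by auto
  then show "finite {jordan_part_size (complex_mat (mat 1 - B)) (1 - z) | z.
     eigenvalue (complex_mat B) z \<and> Re z = max_Re_eigenvalue B}"
    by (rule finite_subset) (simp add: finite_eigenvalues)
qed (use assms in auto)

lemma jordan_spectrum:
  fixes B :: "real ^ 'v::finite ^ 'v"
  defines "n_as \<equiv> SOME n_as. jordan_nf (complex_mat (mat 1 - B)) n_as"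
  assumes "(m, a) \<in> set n_as"
  shows "Re (1 - a) \<le> max_Re_eigenvalue B" "Re (1 - a) = max_Re_eigenvalue B \<Longrightarrow> m \<le> max_jordan_part B"
proof -
  have "eigenvalue (complex_mat (mat 1 - B)) a"
    using eigenvalue_jordan_nf[OF complex_mat_carrier jordan_nf_complex_mat, of "mat 1 - B"] assms by blast
  then have ev: "eigenvalue (complex_mat B) (1 - a)"
    using eigenvalue_one_minus[of B "1 - a"] by simp
  then show "Re (1 - a) \<le> max_Re_eigenvalue B" by (rule eigenvalue_le_max)
  assume "Re (1 - a) = max_Re_eigenvalue B"
  from jordan_part_le_max[OF ev this] jordan_block_le_part[of m a "complex_mat (mat 1 - B)"] assms(2)
  show "m \<le> max_jordan_part B" unfolding n_as_def by simp
qed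

text \<open>Keeps the natural-number differences \<open>\<nu> - 1\<close> and
  \<open>2 * \<nu> - 1\<close> of the critical scaling from being truncated.\<close>

lemma max_jordan_part_pos: "max_jordan_part B \<ge> 1"
proof -
  obtain z where z: "eigenvalue (complex_mat B) z" "Re z = max_Re_eigenvalue B"
    using max_Re_eigenvalue_attained by blast
  then have "eigenvalue (complex_mat (mat 1 - B)) (1 - z)" using eigenvalue_one_minus by blast
  then obtain m where m: "(m, 1 - z) \<in> set (SOME n_as. jordan_nf (complex_mat (mat 1 - B)) n_as)"
    using eigenvalue_jordan_nf[OF complex_mat_carrier jordan_nf_complex_mat] by blast
  moreover have "m \<noteq> 0"
    using jordan_nf_complex_mat[of "mat 1 - B"] m unfolding jordan_nf_def by force
  ultimately show ?thesis
    using jordan_block_le_part jordan_part_le_max[OF z] by fastforce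
qed

lemma mexp_exp_poly_critical:
  assumes "max_Re_eigenvalue B = 1/2"
  shows "exp_poly (max_jordan_part B - 1) (\<lambda>t. of_real (mexp (t *\<^sub>R (B - (1/2) *\<^sub>R mat 1)) $ v $ w))"
proof -
  let ?J = "SOME n_as. jordan_nf (complex_mat (mat 1 - B)) n_as"
  have "exp_poly (max_jordan_part B - 1) (\<lambda>t. of_real (mexp (t *\<^sub>R ((1/2) *\<^sub>R mat 1 - (mat 1 - B))) $ v $ w))"
  proof (rule mexp_exp_poly[OF jordan_nf_complex_mat])
    fix m a k assume "(m, a) \<in> set ?J" "k < m"
    then show "Re (of_real (1/2) - a) < 0 \<or> Re (of_real (1/2) - a) = 0 \<and> k \<le> max_jordan_part B - 1"
      using jordan_spectrum[of m a B] assms by fastforce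
  qed
  moreover have "(1/2) *\<^sub>R mat 1 - (mat 1 - B) = B - (1/2) *\<^sub>R mat 1"
    by (simp add: vec_eq_iff)
  ultimately show ?thesis by simp
qed

lemma mexp_decay_subcritical:
  assumes "max_Re_eigenvalue B < 1/2"
  obtains K d where "K \<ge> 0" "d > 0" "\<And>t. t \<ge> 0 \<Longrightarrow> opnorm (mexp (t *\<^sub>R (B - (1/2) *\<^sub>R mat 1))) \<le> K * exp (- d * t)"
proof -
  let ?J = "SOME n_as. jordan_nf (complex_mat (mat 1 - B)) n_as"
  \<comment> \<open>Half of the spectral gap: after multiplication by \<open>exp (d * t)\<close> all
    exponents still have negative real part, so boundedness of the product yields decay at rate
    \<open>d\<close>.\<close>
  define d where "d = (1/2 - max_Re_eigenvalue B) / 2"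
  have d: "d > 0" using assms by (simp add: d_def)
  have "exp_poly 0 (\<lambda>t. of_real (mexp (t *\<^sub>R ((1/2 + d) *\<^sub>R mat 1 - (mat 1 - B))) $ v $ w))" for v w
  proof (rule mexp_exp_poly[OF jordan_nf_complex_mat])
    fix m a and k :: nat assume "(m, a) \<in> set ?J" "k < m"
    then show "Re (of_real (1/2 + d) - a) < 0 \<or> Re (of_real (1/2 + d) - a) = 0 \<and> k \<le> 0"
      using jordan_spectrum(1)[of m a B] assms by (simp add: d_def field_simps)
  qed
  moreover have "mexp (t *\<^sub>R ((1/2 + d) *\<^sub>R mat 1 - (mat 1 - B))) = exp (d * t) *\<^sub>R mexp (t *\<^sub>R (B - (1/2) *\<^sub>R mat 1))" for t
  proof -
    have "(1/2 + d) *\<^sub>R mat 1 - (mat 1 - B) = (B - (1/2) *\<^sub>R mat 1) + d *\<^sub>R mat 1"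
      by (simp add: vec_eq_iff algebra_simps)
    then show ?thesis by (simp only: mexp_shift)
  qed
  ultimately have "\<exists>K\<ge>0. \<forall>t\<ge>0. cmod (of_real ((exp (d * t) *\<^sub>R mexp (t *\<^sub>R (B - (1/2) *\<^sub>R mat 1))) $ v $ w)) \<le> K * (1 + t) ^ 0" for v w
    using exp_poly_bound by (metis (no_types, lifting))
  then obtain K where K: "\<And>v w. K v w \<ge> 0"
    "\<And>v w t. t \<ge> 0 \<Longrightarrow> exp (d * t) * \<bar>mexp (t *\<^sub>R (B - (1/2) *\<^sub>R mat 1)) $ v $ w\<bar> \<le> K v w"
    by (simp add: abs_mult norm_mult) metis
  show ?thesis
  proof
    show "0 \<le> (\<Sum>v\<in>UNIV. \<Sum>w\<in>UNIV. K v w)" by (intro sum_nonneg K)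
    show "opnorm (mexp (t *\<^sub>R (B - (1/2) *\<^sub>R mat 1))) \<le> (\<Sum>v\<in>UNIV. \<Sum>w\<in>UNIV. K v w) * exp (- d * t)" if "t \<ge> 0" for t
    proof -
      have "\<bar>mexp (t *\<^sub>R (B - (1/2) *\<^sub>R mat 1)) $ v $ w\<bar> \<le> K v w * exp (- d * t)" for v w
        using K(2)[OF that, of v w] by (simp add: exp_minus field_simps)
      then show ?thesis unfolding sum_distrib_right
        by (intro order.trans[OF opnorm_le_sum] sum_mono)
    qed
  qed (rule d)
qed

lemma mexp_bound_critical:
  assumes "max_Re_eigenvalue B = 1/2"
  obtains K where "K \<ge> 0" "\<And>t. t \<ge> 0 \<Longrightarrow>
    opnorm (mexp (t *\<^sub>R (B - (1/2) *\<^sub>R mat 1))) \<le> K * (1 + t) ^ (max_jordan_part B - 1)"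
proof -
  have "\<exists>K\<ge>0. \<forall>t\<ge>0. cmod (of_real (mexp (t *\<^sub>R (B - (1/2) *\<^sub>R mat 1)) $ v $ w)) \<le> K * (1 + t) ^ (max_jordan_part B - 1)" for v w
    using exp_poly_bound[OF mexp_exp_poly_critical[OF assms]] .
  then obtain K where K: "\<And>v w. K v w \<ge> 0"
    "\<And>v w t. t \<ge> 0 \<Longrightarrow> \<bar>mexp (t *\<^sub>R (B - (1/2) *\<^sub>R mat 1)) $ v $ w\<bar> \<le> K v w * (1 + t) ^ (max_jordan_part B - 1)"
    by (simp only: norm_of_real) metis
  show ?thesis
  proof
    show "0 \<le> (\<Sum>v\<in>UNIV. \<Sum>w\<in>UNIV. K v w)" by (intro sum_nonneg K)
    show "opnorm (mexp (t *\<^sub>R (B - (1/2) *\<^sub>R mat 1))) \<le> (\<Sum>v\<in>UNIV. \<Sum>w\<in>UNIV. K v w) * (1 + t) ^ (max_jordan_part B - 1)"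
      if "t \<ge> 0" for t
      unfolding sum_distrib_right by (intro order.trans[OF opnorm_le_sum] sum_mono K(2)[OF that])
  qed
qed

section \<open>Transition matrices on the scale of the limit theorem\<close>

text \<open>Each weight vanishes as \<open>n\<close> grows while the row sums stay bounded, so the
  weight moves to large \<open>j\<close>, where \<open>\<delta>\<close> is small. Positivity and
  boundedness are only eventual because \<open>w n\<close> may fail to be positive for small
  \<open>n\<close>.\<close>

lemma toeplitz_null:
  fixes \<beta> :: "nat \<Rightarrow> nat \<Rightarrow> real"
  assumes nonneg: "\<forall>\<^sub>F n in sequentially. \<forall>j\<in>{1..n}. \<beta> n j \<ge> 0"
    and null: "\<And>j. j \<ge> 1 \<Longrightarrow> (\<lambda>n. \<beta> n j) \<longlonglongrightarrow> 0"
    and bound: "\<forall>\<^sub>F n in sequentially. (\<Sum>j=1..n. \<beta> n j) \<le> K"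
    and \<delta>: "\<delta> \<longlonglongrightarrow> 0"
  shows "(\<lambda>n. \<Sum>j=1..n. \<beta> n j * \<delta> j) \<longlonglongrightarrow> 0"
proof (rule LIMSEQ_I)
  fix e :: real assume e: "e > 0"
  \<comment> \<open>\<open>\<bar>K\<bar> + 1\<close> keeps the denominator positive for every real
    \<open>K\<close>.\<close>
  define d where "d = e / (2 * (\<bar>K\<bar> + 1))"
  have d: "d > 0" using e by (simp add: d_def)
  obtain J where J: "\<And>j. j \<ge> J \<Longrightarrow> \<bar>\<delta> j\<bar> < d"
    using LIMSEQ_D[OF \<delta> d] by auto
  have "(\<lambda>n. \<Sum>j\<in>{1..J}. \<bar>\<beta> n j\<bar> * \<bar>\<delta> j\<bar>) \<longlonglongrightarrow> (\<Sum>j\<in>{1..J}. \<bar>0\<bar> * \<bar>\<delta> j\<bar>)"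
    by (intro tendsto_intros null) simp
  then have "\<forall>\<^sub>F n in sequentially. (\<Sum>j\<in>{1..J}. \<bar>\<beta> n j\<bar> * \<bar>\<delta> j\<bar>) < e / 2"
    using e by (intro order_tendstoD(2)[where a = "e / 2"]) auto
  then have "\<forall>\<^sub>F n in sequentially. \<bar>\<Sum>j=1..n. \<beta> n j * \<delta> j\<bar> < e"
    using nonneg bound
  proof eventually_elim
    case (elim n)
    have "\<bar>\<Sum>j=1..n. \<beta> n j * \<delta> j\<bar> \<le> (\<Sum>j=1..n. \<beta> n j * \<bar>\<delta> j\<bar>)"
      using elim(2) by (intro order.trans[OF sum_abs] sum_mono) (auto simp: abs_mult)
    also have "\<dots> \<le> (\<Sum>j=1..n. (if j \<le> J then \<bar>\<beta> n j\<bar> * \<bar>\<delta> j\<bar> else 0) + \<beta> n j * d)"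
    proof (intro sum_mono)
      fix j assume j: "j \<in> {1..n}"
      show "\<beta> n j * \<bar>\<delta> j\<bar> \<le> (if j \<le> J then \<bar>\<beta> n j\<bar> * \<bar>\<delta> j\<bar> else 0) + \<beta> n j * d"
      proof (cases "j \<le> J")
        case True
        then show ?thesis using elim(2) j d by simp
      next
        case False
        then have "\<bar>\<delta> j\<bar> \<le> d" using J[of j] by simp
        then show ?thesis using False elim(2) j by (simp add: mult_left_mono)
      qed
    qed
    also have "\<dots> = (\<Sum>j\<in>{1..n} \<inter> {1..J}. \<bar>\<beta> n j\<bar> * \<bar>\<delta> j\<bar>) + (\<Sum>j=1..n. \<beta> n j) * d"
    proof -
      have "(\<Sum>j=1..n. if j \<le> J then \<bar>\<beta> n j\<bar> * \<bar>\<delta> j\<bar> else 0) = (\<Sum>j\<in>{1..n} \<inter> {1..J}. \<bar>\<beta> n j\<bar> * \<bar>\<delta> j\<bar>)"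
        by (rule sum.mono_neutral_cong_right) auto
      then show ?thesis by (simp add: sum.distrib sum_distrib_right)
    qed
    also have "\<dots> \<le> (\<Sum>j\<in>{1..J}. \<bar>\<beta> n j\<bar> * \<bar>\<delta> j\<bar>) + (\<bar>K\<bar> + 1) * d"
      using elim(3) d by (intro add_mono sum_mono2 mult_right_mono) auto
    also have "(\<bar>K\<bar> + 1) * d = e / 2" by (simp add: d_def add_pos_nonneg field_simps)
    finally show ?case using elim(1) by linarith
  qed
  then show "\<exists>no. \<forall>n\<ge>no. norm ((\<Sum>j=1..n. \<beta> n j * \<delta> j) - 0) < e"
    by (simp add: eventually_sequentially)
qed

text \<open>At \<open>t = ln (n / j)\<close> the scalar factor is \<open>sqrt (n / j)\<close>, the
  source of the \<open>sqrt n\<close> in the normalisation.\<close>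

lemma mexp_half_shift:
  "mexp (t *\<^sub>R B) = exp (t / 2) *\<^sub>R mexp (t *\<^sub>R (B - (1/2) *\<^sub>R mat 1))"
  using mexp_shift[of t "B - (1/2) *\<^sub>R mat 1" "1/2"] by simp

lemma ln_step:
  assumes "j \<ge> 1"
  shows "0 \<le> ln ((real j + 1) / real j)" "ln ((real j + 1) / real j) \<le> 1 / j" "1 / j - ln ((real j + 1) / real j) \<le> 1 / (real j)\<^sup>2"
proof -
  have j: "real j > 0" "1 / real j \<le> 1" using assms by auto
  have eq: "ln ((real j + 1) / real j) = ln (1 + 1 / j)" using j by (simp add: field_simps)
  show "0 \<le> ln ((real j + 1) / real j)" "ln ((real j + 1) / real j) \<le> 1 / j"
    unfolding eq using ln_add_one_self_le_self[of "1 / j"] by auto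
  show "1 / j - ln ((real j + 1) / real j) \<le> 1 / (real j)\<^sup>2"
    unfolding eq using ln_one_plus_pos_lower_bound[of "1 / j"] j by (simp add: power_divide)
qed

text \<open>The walk is normalised by \<open>sqrt (n * w n)\<close>: below the critical point \<open>w n = 1\<close>, and at the
  critical point \<open>w n = ln n ^ (2 * \<nu> - 1)\<close>.\<close>

locale regular_scale =
  fixes B :: "real ^ 'v ^ 'v" and w :: "nat \<Rightarrow> real" and K :: real
  assumes w_pos: "\<forall>\<^sub>F n in sequentially. w n > 0"
    and bound: "\<forall>\<^sub>F n in sequentially. \<forall>j\<in>{1..n}.
      (opnorm (mexp (ln (real n / real j) *\<^sub>R (B - (1/2) *\<^sub>R mat 1))))\<^sup>2 \<le> K * w n"
    and vanish: "\<And>j. j \<ge> 1 \<Longrightarrow>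
      (\<lambda>n. (opnorm (mexp (ln (real n / real j) *\<^sub>R (B - (1/2) *\<^sub>R mat 1))))\<^sup>2 / w n) \<longlonglongrightarrow> 0"
    and sublinear: "(\<lambda>n. w n / n) \<longlonglongrightarrow> 0"
begin

definition U :: "real \<Rightarrow> real ^ 'v ^ 'v" where
  "U t = mexp (t *\<^sub>R (B - (1/2) *\<^sub>R mat 1))"

text \<open>Weight of time \<open>j\<close> in units of the normalisation: the squared norm of
  \<open>scaled a n j\<close> is at most a constant times \<open>z n j / j\<close>, and the error
  sums below pair these weights with powers of \<open>j\<close>.\<close>

definition z :: "nat \<Rightarrow> nat \<Rightarrow> real" where
  "z n j = (opnorm (U (ln (real n / real j))))\<^sup>2 / w n"

lemma z_null: "j \<ge> 1 \<Longrightarrow> (\<lambda>n. z n j) \<longlonglongrightarrow> 0"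
  unfolding z_def U_def by (rule vanish)

lemma z_bounds: "\<forall>\<^sub>F n in sequentially. w n > 0 \<and> (\<forall>j\<in>{1..n}. 0 \<le> z n j \<and> z n j \<le> K)"
  using w_pos bound by eventually_elim (auto simp: z_def U_def field_simps)

lemma K_nonneg: "K \<ge> 0"
proof -
  have "\<forall>\<^sub>F n in sequentially. K \<ge> 0"
    using z_bounds eventually_ge_at_top[of 1] by eventually_elim force
  then show ?thesis by simp
qed

lemma sum_z_null: "(\<lambda>n. \<Sum>j=1..n. z n j * real j powr (- 3/2)) \<longlonglongrightarrow> 0"
proof -
  \<comment> \<open>The exponent 3/2 is split: 5/4 exceeds 1 and gives bounded row sums, and the
    remaining 1/4 supplies the null sequence.\<close>
  have "(\<lambda>n. \<Sum>j=1..n. (z n j * real j powr (- 5/4)) * real j powr (- 1/4)) \<longlonglongrightarrow> 0"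
  proof (rule toeplitz_null)
    show "\<forall>\<^sub>F n in sequentially. \<forall>j\<in>{1..n}. 0 \<le> z n j * real j powr (- 5/4)"
      using z_bounds by eventually_elim auto
    show "(\<lambda>n. z n j * real j powr (- 5/4)) \<longlonglongrightarrow> 0" if "j \<ge> 1" for j
      using tendsto_mult_right[OF z_null[OF that], of "real j powr (- 5/4)"] by simp
    have s: "summable (\<lambda>j. real j powr (- 5/4))" by (simp add: summable_real_powr_iff)
    show "\<forall>\<^sub>F n in sequentially. (\<Sum>j=1..n. z n j * real j powr (- 5/4)) \<le> K * (\<Sum>j. real j powr (- 5/4))"
      using z_bounds
    proof eventually_elim
      case (elim n)
      have "(\<Sum>j=1..n. z n j * real j powr (- 5/4)) \<le> (\<Sum>j=1..n. K * real j powr (- 5/4))"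
        using elim by (intro sum_mono mult_right_mono) auto
      also have "\<dots> = K * (\<Sum>j=1..n. real j powr (- 5/4))" by (simp add: sum_distrib_left)
      also have "\<dots> \<le> K * (\<Sum>j. real j powr (- 5/4))"
        using s by (intro mult_left_mono sum_le_suminf K_nonneg) auto
      finally show ?case .
    qed
    show "(\<lambda>j. real j powr (- 1/4)) \<longlonglongrightarrow> 0"
      by (intro tendsto_neg_powr filterlim_real_sequentially) simp
  qed
  then show ?thesis by (simp add: mult.assoc flip: powr_add)
qed

lemma sum_z_square_null: "(\<lambda>n. \<Sum>j=1..n. z n j / (real j)\<^sup>2) \<longlonglongrightarrow> 0"
proof (rule tendsto_sandwich[OF _ _ tendsto_const sum_z_null])
  show "\<forall>\<^sub>F n in sequentially. 0 \<le> (\<Sum>j=1..n. z n j / (real j)\<^sup>2)"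
    using z_bounds by eventually_elim (auto intro!: sum_nonneg)
  show "\<forall>\<^sub>F n in sequentially. (\<Sum>j=1..n. z n j / (real j)\<^sup>2) \<le> (\<Sum>j=1..n. z n j * real j powr (- 3/2))"
    using z_bounds
  proof eventually_elim
    case (elim n)
    have "1 / (real j)\<^sup>2 \<le> real j powr (- 3/2)" if "j \<in> {1..n}" for j
    proof -
      have "1 / (real j)\<^sup>2 = real j powr (- 2)" using that by (simp add: powr_minus_divide)
      also have "\<dots> \<le> real j powr (- 3/2)" using that by (intro powr_mono) auto
      finally show ?thesis .
    qed
    then have "z n j * (1 / (real j)\<^sup>2) \<le> z n j * real j powr (- 3/2)" if "j \<in> {1..n}" for j
      using elim that by (intro mult_left_mono) auto
    then show ?case by (intro sum_mono) simp
  qed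
qed

text \<open>With \<open>t = ln (n / j)\<close> the transition matrix is
  \<open>sqrt (n / j) *\<^sub>R (U t ** W)\<close>, where \<open>W\<close> is within
  \<open>O(1 / j)\<close> of the identity by \<open>transition_approx\<close>. The error of
  replacing \<open>W\<close> by the identity therefore carries an extra factor
  \<open>1 / j\<close>.\<close>

lemma transition_bounds:
  "\<exists>L\<ge>0. \<forall>n j a. 1 \<le> j \<and> j \<le> n \<longrightarrow>
    norm (transition B j (n - j) *v a) \<le> L * sqrt (n / j) * opnorm (U (ln (real n / real j))) * norm a \<and>
    norm (transition B j (n - j) *v a - sqrt (n / j) *\<^sub>R (U (ln (real n / real j)) *v a))
      \<le> L / j * sqrt (n / j) * opnorm (U (ln (real n / real j))) * norm a"
proof -
  obtain L where L: "L \<ge> 0" "\<And>j n. 1 \<le> j \<Longrightarrow> j \<le> n \<Longrightarrow>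
    opnorm (mexp ((- ln (real n / real j)) *\<^sub>R B) ** transition B j (n - j) - mat 1) \<le> L / real j"
    using transition_approx[of B] by blast
  have "norm (transition B j (n - j) *v a) \<le> (L + 1) * sqrt (n / j) * opnorm (U (ln (real n / real j))) * norm a \<and>
    norm (transition B j (n - j) *v a - sqrt (n / j) *\<^sub>R (U (ln (real n / real j)) *v a))
      \<le> (L + 1) / j * sqrt (n / j) * opnorm (U (ln (real n / real j))) * norm a" if j: "1 \<le> j" "j \<le> n" for n j a
  proof -
    define t where "t = ln (real n / real j)"
    define W where "W = mexp ((- t) *\<^sub>R B) ** transition B j (n - j)"
    have j0: "real j > 0" "real n > 0" "1 / real j \<le> 1" using j by auto
    have E: "exp (t / 2) = sqrt (n / j)"
    proof -
      have "sqrt (n / j) = (n / j) powr (1/2)" by (simp add: powr_half_sqrt)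
      then show ?thesis using j0 by (simp add: t_def powr_def)
    qed
    have tr: "transition B j (n - j) = sqrt (n / j) *\<^sub>R (U t ** W)"
    proof -
      have "mexp (t *\<^sub>R B) ** W = transition B j (n - j)"
        unfolding W_def matrix_mul_assoc mexp_minus by simp
      then show ?thesis unfolding mexp_half_shift[of t B] E U_def by (simp only: scalar_matrix_assoc)
    qed
    have W: "opnorm (W - mat 1) \<le> L / j" using L(2)[OF j] by (simp add: W_def t_def)
    have d: "transition B j (n - j) *v a - sqrt (n / j) *\<^sub>R (U t *v a) = sqrt (n / j) *\<^sub>R (U t *v ((W - mat 1) *v a))"
      unfolding tr by (simp add: scaleR_matrix_vector_assoc[symmetric] matrix_vector_mul_assoc[symmetric]
          matrix_vector_mult_diff_rdistrib matrix_vector_mult_diff_distrib algebra_simps)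
    have "norm (U t *v ((W - mat 1) *v a)) \<le> opnorm (U t) * (opnorm (W - mat 1) * norm a)"
      by (intro order.trans[OF opnorm_bound] mult_left_mono opnorm_bound opnorm_nonneg)
    also have "\<dots> \<le> opnorm (U t) * (L / j * norm a)"
      by (intro mult_left_mono mult_right_mono W opnorm_nonneg norm_ge_zero)
    finally have "norm (U t *v ((W - mat 1) *v a)) \<le> L / j * (opnorm (U t) * norm a)" by (simp add: mult_ac)
    then have d': "norm (transition B j (n - j) *v a - sqrt (n / j) *\<^sub>R (U t *v a))
        \<le> sqrt (n / j) * (L / j * (opnorm (U t) * norm a))"
      unfolding d norm_scaleR by (simp add: mult_left_mono del: times_divide_eq_left)
    have "norm (transition B j (n - j) *v a) \<le> norm (transition B j (n - j) *v a - sqrt (n / j) *\<^sub>R (U t *v a))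
        + sqrt (n / j) * norm (U t *v a)"
      using norm_triangle_sub[of "transition B j (n - j) *v a" "sqrt (n / j) *\<^sub>R (U t *v a)"] by simp
    also have "\<dots> \<le> sqrt (n / j) * (L / j * (opnorm (U t) * norm a)) + sqrt (n / j) * (opnorm (U t) * norm a)"
      by (intro add_mono d' mult_left_mono opnorm_bound) auto
    also have "\<dots> = sqrt (n / j) * ((L / j + 1) * (opnorm (U t) * norm a))" by (simp add: algebra_simps)
    also have "\<dots> \<le> sqrt (n / j) * ((L + 1) * (opnorm (U t) * norm a))"
      using mult_left_mono[OF j0(3) L(1)]
      by (intro mult_left_mono mult_right_mono mult_nonneg_nonneg opnorm_nonneg) auto
    finally have 1: "norm (transition B j (n - j) *v a) \<le> sqrt (n / j) * ((L + 1) * (opnorm (U t) * norm a))" .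
    have "sqrt (n / j) * (L / j * (opnorm (U t) * norm a)) \<le> sqrt (n / j) * ((L + 1) / j * (opnorm (U t) * norm a))"
      by (intro mult_left_mono mult_right_mono divide_right_mono mult_nonneg_nonneg opnorm_nonneg) auto
    with d' 1 show ?thesis by (simp add: t_def mult_ac)
  qed
  then show ?thesis using L(1) by (intro exI[of _ "L + 1"]) auto
qed

text \<open>The vectors \<open>b j\<close> of the backward recursion with the terminal vector
  \<open>a / sqrt (n * w n)\<close>, so that the last one tests the normalised walk against
  \<open>a\<close>.\<close>

definition scaled :: "real ^ 'v \<Rightarrow> nat \<Rightarrow> nat \<Rightarrow> real ^ 'v" where
  "scaled a n j = (1 / sqrt (n * w n)) *\<^sub>R (transition B j (n - j) *v a)"

lemma scaled_bound:
  "\<exists>L\<ge>0. \<forall>\<^sub>F n in sequentially. \<forall>j\<in>{1..n}. (norm (scaled a n j))\<^sup>2 \<le> L * (z n j / j)"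
proof -
  obtain L where L: "L \<ge> 0" "\<And>n j a. 1 \<le> j \<Longrightarrow> j \<le> n \<Longrightarrow>
    norm (transition B j (n - j) *v a) \<le> L * sqrt (n / j) * opnorm (U (ln (real n / real j))) * norm a"
    using transition_bounds by blast
  have "\<forall>\<^sub>F n in sequentially. \<forall>j\<in>{1..n}. (norm (scaled a n j))\<^sup>2 \<le> (L * norm a)\<^sup>2 * (z n j / j)"
    using z_bounds eventually_gt_at_top[of 0]
  proof eventually_elim
    case (elim n)
    show ?case
    proof
      fix j assume j: "j \<in> {1..n}"
      have "(norm (transition B j (n - j) *v a))\<^sup>2 \<le> (L * sqrt (n / j) * opnorm (U (ln (real n / real j))) * norm a)\<^sup>2"
        using j by (intro power_mono L(2)) auto
      also have "\<dots> = (L * norm a)\<^sup>2 * (n * w n) * (z n j / j)"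
        using elim j by (simp add: z_def power_mult_distrib power_divide field_simps)
      finally have "(norm (transition B j (n - j) *v a))\<^sup>2 / (n * w n) \<le> (L * norm a)\<^sup>2 * (z n j / j)"
        using elim by (simp add: field_simps)
      then show "(norm (scaled a n j))\<^sup>2 \<le> (L * norm a)\<^sup>2 * (z n j / j)"
        using elim by (simp add: scaled_def power_mult_distrib power_divide)
    qed
  qed
  then show ?thesis by (intro exI[of _ "(L * norm a)\<^sup>2"]) simp
qed

lemma scaled_null:
  assumes j: "j \<ge> 1"
  shows "(\<lambda>n. norm (scaled a n j)) \<longlonglongrightarrow> 0"
proof -
  obtain L where L: "\<forall>\<^sub>F n in sequentially. \<forall>j\<in>{1..n}. (norm (scaled a n j))\<^sup>2 \<le> L * (z n j / j)"
    using scaled_bound by blast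
  have "(\<lambda>n. L * (z n j / j)) \<longlonglongrightarrow> L * (0 / j)" using j by (intro tendsto_intros z_null) auto
  then have lim: "(\<lambda>n. L * (z n j / j)) \<longlonglongrightarrow> 0" by simp
  have ev: "\<forall>\<^sub>F n in sequentially. (norm (scaled a n j))\<^sup>2 \<le> L * (z n j / j)"
    using L eventually_ge_at_top[of j] by eventually_elim (use j in auto)
  have "(\<lambda>n. (norm (scaled a n j))\<^sup>2) \<longlonglongrightarrow> 0"
    by (rule tendsto_sandwich[OF _ ev tendsto_const lim]) simp
  from tendsto_real_sqrt[OF this] show ?thesis by simp
qed

text \<open>The cube is split into a square, bounded by \<open>L * (z n j / j)\<close>, and a single
  factor, bounded by \<open>sqrt (L * K / j)\<close>; together they give the exponent 3/2 of
  \<open>sum_z_null\<close>.\<close>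

lemma scaled_cube_null: "(\<lambda>n. \<Sum>j=1..n. norm (scaled a n j) ^ 3) \<longlonglongrightarrow> 0"
proof -
  obtain L where L: "L \<ge> 0" "\<forall>\<^sub>F n in sequentially. \<forall>j\<in>{1..n}. (norm (scaled a n j))\<^sup>2 \<le> L * (z n j / j)"
    using scaled_bound by blast
  have lim: "(\<lambda>n. (L * sqrt (L * K)) * (\<Sum>j=1..n. z n j * real j powr (- 3/2))) \<longlonglongrightarrow> 0"
    using tendsto_mult_left[OF sum_z_null, of "L * sqrt (L * K)"] by simp
  show ?thesis
  proof (rule tendsto_sandwich[OF _ _ tendsto_const lim])
    show "\<forall>\<^sub>F n in sequentially. 0 \<le> (\<Sum>j=1..n. norm (scaled a n j) ^ 3)"
      by (intro always_eventually allI sum_nonneg) simp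
    show "\<forall>\<^sub>F n in sequentially. (\<Sum>j=1..n. norm (scaled a n j) ^ 3) \<le> (L * sqrt (L * K)) * (\<Sum>j=1..n. z n j * real j powr (- 3/2))"
      using L(2) z_bounds
    proof eventually_elim
      case (elim n)
      have "norm (scaled a n j) ^ 3 \<le> (L * sqrt (L * K)) * (z n j * real j powr (- 3/2))" if j: "j \<in> {1..n}" for j
      proof -
        define r where "r = norm (scaled a n j)"
        have r: "r \<ge> 0" "r\<^sup>2 \<le> L * (z n j / j)" using elim j by (auto simp: r_def)
        have "r\<^sup>2 \<le> L * K / j"
          using r(2) elim j L(1) by (smt (verit) divide_right_mono mult_left_mono of_nat_0_le_iff times_divide_eq_right)
        then have "r \<le> sqrt (L * K / j)" by (simp add: real_le_rsqrt)
        then have "r\<^sup>2 * r \<le> (L * (z n j / j)) * sqrt (L * K / j)"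
          using r by (intro mult_mono) (auto intro: order_trans[OF zero_le_power2])
        also have "\<dots> = (L * sqrt (L * K)) * (z n j * (1 / (real j * sqrt j)))"
          using j by (simp add: real_sqrt_divide)
        also have "1 / (real j * sqrt j) = real j powr (- 3/2)"
        proof -
          have "real j powr (3/2) = real j powr (1 + 1/2)" by simp
          also have "\<dots> = real j * sqrt j" using j by (subst powr_add) (auto simp: powr_half_sqrt)
          finally show ?thesis using j by (simp add: powr_minus_divide)
        qed
        finally show ?thesis by (simp add: r_def power3_eq_cube power2_eq_square)
      qed
      then show ?case unfolding sum_distrib_left by (intro sum_mono)
    qed
  qed
qed

section \<open>The Riemann sum for the quadratic form of the covariance\<close>

definition g :: "real ^ 'v \<Rightarrow> real \<Rightarrow> real" where
  "g a t = (norm (U t *v a))\<^sup>2"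

lemma g_deriv:
  "(g a has_real_derivative 2 * inner (U t *v a) ((B - (1/2) *\<^sub>R mat 1) *v (U t *v a))) (at t)"
proof -
  let ?C = "B - (1/2) *\<^sub>R mat 1"
  have mv: "(M *v x) $ i = (\<Sum>k\<in>UNIV. M $ i $ k * x $ k)" for M :: "real ^ 'v ^ 'v" and x i
    by (simp add: matrix_vector_mult_def)
  have comp: "((\<lambda>t. (U t *v a) $ i) has_real_derivative (?C *v (U t *v a)) $ i) (at t)" for i
  proof -
    have "((\<lambda>t. \<Sum>k\<in>UNIV. U t $ i $ k * a $ k) has_real_derivative (\<Sum>k\<in>UNIV. (?C ** U t) $ i $ k * a $ k)) (at t)"
      unfolding U_def by (intro DERIV_sum DERIV_cmult_right mexp_entry_deriv)
    then show ?thesis unfolding matrix_vector_mul_assoc by (simp only: mv)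
  qed
  have "((\<lambda>t. \<Sum>i\<in>UNIV. (U t *v a) $ i * (U t *v a) $ i) has_real_derivative
      (\<Sum>i\<in>UNIV. (?C *v (U t *v a)) $ i * (U t *v a) $ i + (?C *v (U t *v a)) $ i * (U t *v a) $ i)) (at t)"
    by (intro DERIV_sum DERIV_mult comp)
  moreover have "(\<lambda>t. \<Sum>i\<in>UNIV. (U t *v a) $ i * (U t *v a) $ i) = g a"
    by (simp add: fun_eq_iff g_def power2_norm_eq_inner inner_vec_def)
  moreover have "(\<Sum>i\<in>UNIV. (?C *v (U t *v a)) $ i * (U t *v a) $ i + (?C *v (U t *v a)) $ i * (U t *v a) $ i)
      = 2 * inner (U t *v a) (?C *v (U t *v a))"
    by (simp add: inner_vec_def sum_distrib_left mult_ac)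
  ultimately show ?thesis by simp
qed

lemma g_continuous: "continuous_on S (g a)"
  using g_deriv by (meson DERIV_isCont continuous_at_imp_continuous_on)

text \<open>The error is measured by \<open>opnorm (U t)\<close> at the right endpoint, so that it
  can be summed in terms of the weights \<open>z\<close>. This works because \<open>U s\<close> is
  \<open>U t\<close> times an exponential over a time of length at most 1, which is uniformly
  bounded.\<close>

lemma g_local:
  "\<exists>L\<ge>0. \<forall>t h. 0 \<le> h \<and> h \<le> 1 \<longrightarrow>
    \<bar>integral {t - h..t} (g a) - h * g a t\<bar> \<le> L * (h\<^sup>2 * (opnorm (U t))\<^sup>2)"
proof -
  let ?C = "B - (1/2) *\<^sub>R mat 1"
  obtain M where M: "M \<ge> 0" "\<And>s. \<bar>s\<bar> \<le> 1 \<Longrightarrow> opnorm (mat 1 ** mexp (s *\<^sub>R ?C)) \<le> M"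
    using opnorm_mexp_bounded by blast
  define L where "L = 2 * opnorm ?C * M\<^sup>2 * (norm a)\<^sup>2"
  have L0: "L \<ge> 0" unfolding L_def by (intro mult_nonneg_nonneg opnorm_nonneg) auto
  have deriv: "\<bar>2 * inner (U s *v a) (?C *v (U s *v a))\<bar> \<le> L * (opnorm (U t))\<^sup>2" if s: "t - 1 \<le> s" "s \<le> t" for s t
  proof -
    have "U s = U t ** mexp ((s - t) *\<^sub>R ?C)"
      unfolding U_def mexp_add[symmetric] by simp
    then have "opnorm (U s) \<le> opnorm (U t) * M"
      using M(2)[of "s - t"] s by (auto intro!: order.trans[OF opnorm_mult] mult_left_mono opnorm_nonneg)
    then have "norm (U s *v a) \<le> opnorm (U t) * M * norm a"
      by (intro order.trans[OF opnorm_bound] mult_right_mono) auto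
    then have n: "(norm (U s *v a))\<^sup>2 \<le> (opnorm (U t) * M * norm a)\<^sup>2"
      by (intro power_mono) auto
    have "\<bar>inner (U s *v a) (?C *v (U s *v a))\<bar> \<le> norm (U s *v a) * (opnorm ?C * norm (U s *v a))"
      by (intro order.trans[OF Cauchy_Schwarz_ineq2] mult_left_mono opnorm_bound) auto
    also have "\<dots> = opnorm ?C * (norm (U s *v a))\<^sup>2" by (simp add: power2_eq_square)
    also have "\<dots> \<le> opnorm ?C * (opnorm (U t) * M * norm a)\<^sup>2"
      by (intro mult_left_mono n opnorm_nonneg)
    finally show ?thesis by (simp add: L_def power_mult_distrib abs_mult mult_ac)
  qed
  have "\<bar>integral {t - h..t} (g a) - h * g a t\<bar> \<le> L * (h\<^sup>2 * (opnorm (U t))\<^sup>2)" if h: "0 \<le> h" "h \<le> 1" for t h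
  proof -
    have diff: "\<bar>g a s - g a t\<bar> \<le> L * (opnorm (U t))\<^sup>2 * h" if s: "s \<in> {t - h..t}" for s
    proof -
      have "norm (g a s - g a t) \<le> L * (opnorm (U t))\<^sup>2 * norm (s - t)"
      proof (rule field_differentiable_bound[where S = "{t - h..t}"])
        fix x assume x: "x \<in> {t - h..t}"
        show "(g a has_field_derivative 2 * inner (U x *v a) (?C *v (U x *v a))) (at x within {t - h..t})"
          by (rule has_field_derivative_at_within[OF g_deriv])
        show "norm (2 * inner (U x *v a) (?C *v (U x *v a))) \<le> L * (opnorm (U t))\<^sup>2"
          using deriv[of t x] x h by simp
      qed (use s h in auto)
      also have "\<dots> \<le> L * (opnorm (U t))\<^sup>2 * h"
        using s L0 by (intro mult_left_mono) auto
      finally show ?thesis by simp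
    qed
    have "norm (integral {t - h..t} (\<lambda>s. g a s - g a t)) \<le> L * (opnorm (U t))\<^sup>2 * h * (t - (t - h))"
      using diff h g_continuous by (intro integral_bound continuous_intros) auto
    moreover have "integral {t - h..t} (\<lambda>s. g a s - g a t) = integral {t - h..t} (g a) - h * g a t"
      using h g_continuous by (subst integral_diff) (auto intro: integrable_continuous_interval)
    ultimately show ?thesis by (simp add: power2_eq_square mult_ac)
  qed
  then show ?thesis using L0 by blast
qed

text \<open>Backward induction over the mesh points \<open>ln (n / l)\<close>; the interval that
  \<open>j\<close> adds has length \<open>ln ((j + 1) / j)\<close>, which is within
  \<open>1 / j^2\<close> of the weight \<open>1 / j\<close>.\<close>

lemma g_riemann:
  "\<exists>L\<ge>0. \<forall>n j. 1 \<le> j \<and> j \<le> n \<longrightarrow>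
    \<bar>integral {0..ln (real n / real j)} (g a) - (\<Sum>l=j..<n. g a (ln (real n / real l)) / l)\<bar>
      \<le> L * (\<Sum>l=j..<n. (opnorm (U (ln (real n / real l))))\<^sup>2 / (real l)\<^sup>2)"
proof -
  obtain L where L: "L \<ge> 0" "\<And>t h. 0 \<le> h \<Longrightarrow> h \<le> 1 \<Longrightarrow>
    \<bar>integral {t - h..t} (g a) - h * g a t\<bar> \<le> L * (h\<^sup>2 * (opnorm (U t))\<^sup>2)"
    using g_local[of a] by blast
  \<comment> \<open>\<open>L\<close> pays for freezing \<open>g\<close> on a mesh interval,
    \<open>(norm a)^2\<close> for replacing the mesh length \<open>h\<close> by
    \<open>1 / j\<close>.\<close>
  define L' where "L' = L + (norm a)\<^sup>2"
  have "\<bar>integral {0..ln (real n / real j)} (g a) - (\<Sum>l=j..<n. g a (ln (real n / real l)) / l)\<bar>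
      \<le> L' * (\<Sum>l=j..<n. (opnorm (U (ln (real n / real l))))\<^sup>2 / (real l)\<^sup>2)" if "1 \<le> j" "j \<le> n" for n j
    using that(2,1)
  proof (induction rule: inc_induct)
    case base
    then show ?case by simp
  next
    case (step j)
    define t where "t = ln (real n / real j)"
    define h where "h = ln ((real j + 1) / real j)"
    have j: "real j > 0" "1 / real j \<le> 1" using step.prems by auto
    have h: "0 \<le> h" "h \<le> 1 / j" "1 / j - h \<le> 1 / (real j)\<^sup>2"
      using ln_step[OF step.prems] by (simp_all add: h_def)
    have h1: "h \<le> 1" using h(2) j(2) by linarith
    have t': "ln (real n / real (Suc j)) = t - h"
      using step by (simp add: t_def h_def ln_div add.commute)
    have t0: "0 \<le> t - h" unfolding t'[symmetric] using step by (intro ln_ge_zero) simp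
    have split: "integral {0..t} (g a) = integral {0..t - h} (g a) + integral {t - h..t} (g a)"
      by (rule Henstock_Kurzweil_Integration.integral_combine[symmetric])
        (use t0 h in \<open>auto intro: integrable_continuous_interval g_continuous\<close>)
    have gt: "g a t \<le> (opnorm (U t))\<^sup>2 * (norm a)\<^sup>2"
      unfolding g_def power_mult_distrib[symmetric] by (intro power_mono opnorm_bound) auto
    have "\<bar>integral {t - h..t} (g a) - g a t / j\<bar> \<le> \<bar>integral {t - h..t} (g a) - h * g a t\<bar> + \<bar>(1 / j - h) * g a t\<bar>"
      by (simp add: algebra_simps)
    also have "\<dots> \<le> L * ((1 / real j)\<^sup>2 * (opnorm (U t))\<^sup>2) + 1 / (real j)\<^sup>2 * ((opnorm (U t))\<^sup>2 * (norm a)\<^sup>2)"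
    proof (intro add_mono)
      have "L * (h\<^sup>2 * (opnorm (U t))\<^sup>2) \<le> L * ((1 / real j)\<^sup>2 * (opnorm (U t))\<^sup>2)"
        using h L(1) by (intro mult_left_mono mult_right_mono power_mono) auto
      then show "\<bar>integral {t - h..t} (g a) - h * g a t\<bar> \<le> L * ((1 / real j)\<^sup>2 * (opnorm (U t))\<^sup>2)"
        using L(2)[OF h(1) h1, of t] by linarith
      have "0 \<le> g a t" by (simp add: g_def)
      then show "\<bar>(1 / j - h) * g a t\<bar> \<le> 1 / (real j)\<^sup>2 * ((opnorm (U t))\<^sup>2 * (norm a)\<^sup>2)"
        unfolding abs_mult using h gt by (intro mult_mono) auto
    qed
    also have "\<dots> = L' * ((opnorm (U t))\<^sup>2 / (real j)\<^sup>2)"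
      by (simp add: L'_def power_divide add_divide_distrib algebra_simps)
    finally have loc: "\<bar>integral {t - h..t} (g a) - g a t / j\<bar> \<le> L' * ((opnorm (U t))\<^sup>2 / (real j)\<^sup>2)" .
    have IH: "\<bar>integral {0..t - h} (g a) - (\<Sum>l=Suc j..<n. g a (ln (real n / real l)) / l)\<bar>
      \<le> L' * (\<Sum>l=Suc j..<n. (opnorm (U (ln (real n / real l))))\<^sup>2 / (real l)\<^sup>2)"
      using step.IH unfolding t' by simp
    have s: "(\<Sum>l=j..<n. f l) = f j + (\<Sum>l=Suc j..<n. f l)" for f :: "nat \<Rightarrow> real"
      using step.hyps by (simp add: sum.atLeast_Suc_lessThan)
    show ?case
      unfolding t_def[symmetric] s split distrib_left using loc IH unfolding t_def by linarith
  qed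
  then show ?thesis using L(1) by (intro exI[of _ L']) (auto simp: L'_def)
qed

text \<open>Two errors of the form \<open>z n j / j^2\<close> are added up, from replacing the
  transition matrix by \<open>U\<close> and from the Riemann sum. The term \<open>j = n\<close>,
  which the Riemann sum leaves out, is \<open>O(1 / n)\<close>.\<close>

lemma scaled_square_sum:
  assumes "(\<lambda>n. (1 / w n) * integral {0..ln (real n)} (g a)) \<longlonglongrightarrow> s"
  shows "(\<lambda>n. \<Sum>j=1..n. (norm (scaled a n j))\<^sup>2) \<longlonglongrightarrow> s"
proof -
  obtain L where L: "L \<ge> 0" "\<And>n j. 1 \<le> j \<Longrightarrow> j \<le> n \<Longrightarrow>
    \<bar>integral {0..ln (real n / real j)} (g a) - (\<Sum>l=j..<n. g a (ln (real n / real l)) / l)\<bar>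
      \<le> L * (\<Sum>l=j..<n. (opnorm (U (ln (real n / real l))))\<^sup>2 / (real l)\<^sup>2)"
    using g_riemann[of a] by blast
  obtain M where M: "M \<ge> 0" "\<And>n j a. 1 \<le> j \<Longrightarrow> j \<le> n \<Longrightarrow>
    norm (transition B j (n - j) *v a) \<le> M * sqrt (n / j) * opnorm (U (ln (real n / real j))) * norm a \<and>
    norm (transition B j (n - j) *v a - sqrt (n / j) *\<^sub>R (U (ln (real n / real j)) *v a))
      \<le> M / j * sqrt (n / j) * opnorm (U (ln (real n / real j))) * norm a"
    using transition_bounds by blast
  define L' where "L' = M * (M + 1) * (norm a)\<^sup>2 + L"
  have le: "\<forall>\<^sub>F n in sequentially. norm ((\<Sum>j=1..n. (norm (scaled a n j))\<^sup>2) - (1 / w n) * integral {0..ln (real n)} (g a))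
      \<le> L' * (\<Sum>j=1..n. z n j / (real j)\<^sup>2) + K * (norm a)\<^sup>2 * (1 / n)"
    using z_bounds eventually_gt_at_top[of 0]
  proof eventually_elim
    case (elim n)
    define t where "t j = ln (real n / real j)" for j :: nat
    have A: "\<bar>(norm (scaled a n j))\<^sup>2 - (1 / w n) * (g a (t j) / j)\<bar> \<le> M * (M + 1) * (norm a)\<^sup>2 * (z n j / (real j)\<^sup>2)"
      if j: "j \<in> {1..n}" for j
    proof -
      define x where "x = transition B j (n - j) *v a"
      define y where "y = sqrt (n / j) *\<^sub>R (U (t j) *v a)"
      define c where "c = sqrt (n / j) * opnorm (U (t j)) * norm a"
      have c0: "c \<ge> 0" by (auto simp: c_def opnorm_nonneg)
      have x: "norm x \<le> M * c" "norm (x - y) \<le> M / j * c"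
        using M(2)[of j n a] j by (auto simp: x_def y_def c_def t_def mult_ac)
      have y: "norm y \<le> c"
        using opnorm_bound[of "U (t j)" a] by (simp add: y_def c_def mult_left_mono mult.assoc)
      have c2: "c\<^sup>2 = n / j * (opnorm (U (t j)))\<^sup>2 * (norm a)\<^sup>2"
        by (simp add: c_def power_mult_distrib)
      \<comment> \<open>Difference of squares: the first factor carries the extra
        \<open>1 / j\<close> of \<open>transition_bounds\<close>, the second is only bounded by a
        multiple of \<open>c\<close>.\<close>
      have "\<bar>(norm x)\<^sup>2 - (norm y)\<^sup>2\<bar> = \<bar>norm x - norm y\<bar> * (norm x + norm y)"
        by (simp add: power2_eq_square square_diff_square_factored abs_mult)
      also have "\<dots> \<le> (M / j * c) * (M * c + c)"
        using norm_triangle_ineq3[of x y] x y M(1) c0 by (intro mult_mono add_mono) auto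
      also have "\<dots> = M * (M + 1) / j * c\<^sup>2"
        by (simp add: power2_eq_square algebra_simps add_divide_distrib)
      also have "\<dots> = M * (M + 1) * (norm a)\<^sup>2 * (n * w n) * (z n j / (real j)\<^sup>2)"
        unfolding c2 z_def t_def using elim by (simp add: power2_eq_square[of "real j"])
      finally have "\<bar>(norm x)\<^sup>2 - (norm y)\<^sup>2\<bar> / (n * w n) \<le> M * (M + 1) * (norm a)\<^sup>2 * (z n j / (real j)\<^sup>2)"
        using elim by (simp add: field_simps)
      moreover have "\<bar>(norm x)\<^sup>2 - (norm y)\<^sup>2\<bar> / (n * w n) = \<bar>(norm x)\<^sup>2 / (n * w n) - (norm y)\<^sup>2 / (n * w n)\<bar>"
        using elim by (simp add: diff_divide_distrib[symmetric] abs_divide)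
      moreover have "(norm x)\<^sup>2 / (n * w n) = (norm (scaled a n j))\<^sup>2"
        using elim by (simp add: scaled_def x_def power_mult_distrib power_divide)
      moreover have "(norm y)\<^sup>2 / (n * w n) = (1 / w n) * (g a (t j) / j)"
        using elim by (simp add: y_def g_def power_mult_distrib)
      ultimately show ?thesis by simp
    qed
    have "\<bar>integral {0..ln (real n)} (g a) - (\<Sum>j=1..<n. g a (t j) / j)\<bar>
        \<le> L * (\<Sum>j=1..<n. (opnorm (U (t j)))\<^sup>2 / (real j)\<^sup>2)"
      using L(2)[of 1 n] elim(2) by (simp add: t_def)
    then have "(1 / w n) * \<bar>integral {0..ln (real n)} (g a) - (\<Sum>j=1..<n. g a (t j) / j)\<bar>
        \<le> (1 / w n) * (L * (\<Sum>j=1..<n. (opnorm (U (t j)))\<^sup>2 / (real j)\<^sup>2))"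
      using elim by (intro mult_left_mono) auto
    also have "\<dots> = L * (\<Sum>j=1..<n. z n j / (real j)\<^sup>2)"
      by (simp add: z_def t_def sum_distrib_left)
    also have "\<dots> \<le> L * (\<Sum>j=1..n. z n j / (real j)\<^sup>2)"
      using elim L(1) by (intro mult_left_mono sum_mono2) auto
    finally have R: "\<bar>(1 / w n) * integral {0..ln (real n)} (g a) - (1 / w n) * (\<Sum>j=1..<n. g a (t j) / j)\<bar>
        \<le> L * (\<Sum>j=1..n. z n j / (real j)\<^sup>2)"
      using elim by (simp add: diff_divide_distrib[symmetric] abs_divide)
    have last: "\<bar>(1 / w n) * (g a (t n) / n)\<bar> \<le> K * (norm a)\<^sup>2 * (1 / n)"
    proof -
      have "t n = 0" using elim by (simp add: t_def)
      then have "g a (t n) \<le> (norm a)\<^sup>2" by (simp add: g_def U_def mexp_zero)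
      \<comment> \<open>At \<open>j = n\<close> the exponential is the identity, so
        \<open>z n n\<close> equals \<open>1 / w n\<close>.\<close>
      moreover have "1 / w n \<le> K" 
        using elim(1) elim(2) by (auto simp: z_def U_def mexp_zero opnorm_one dest!: bspec[of _ _ n])
      ultimately have "1 / w n * g a (t n) \<le> K * (norm a)\<^sup>2"
        using elim by (intro mult_mono) (auto simp: g_def intro: K_nonneg)
      moreover have "0 \<le> (1 / w n) * (g a (t n) / n)" using elim by (simp add: g_def)
      ultimately show ?thesis using elim by (simp add: field_simps)
    qed
    have "(\<Sum>j=1..n. (1 / w n) * (g a (t j) / j)) = (1 / w n) * (\<Sum>j=1..<n. g a (t j) / j) + (1 / w n) * (g a (t n) / n)"
    proof -
      have "{1..n} = insert n {1..<n}" using elim(2) by auto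
      then show ?thesis by (simp add: sum_distrib_left)
    qed
    moreover have "\<bar>(\<Sum>j=1..n. (norm (scaled a n j))\<^sup>2) - (\<Sum>j=1..n. (1 / w n) * (g a (t j) / j))\<bar>
        \<le> M * (M + 1) * (norm a)\<^sup>2 * (\<Sum>j=1..n. z n j / (real j)\<^sup>2)"
      unfolding sum_subtractf[symmetric] sum_distrib_left
      by (intro order.trans[OF sum_abs] sum_mono A)
    ultimately show ?case using R last unfolding L'_def distrib_right real_norm_def by linarith
  qed
  have lim: "(\<lambda>n. L' * (\<Sum>j=1..n. z n j / (real j)\<^sup>2) + K * (norm a)\<^sup>2 * (1 / real n)) \<longlonglongrightarrow> L' * 0 + K * (norm a)\<^sup>2 * 0"
    by (intro tendsto_intros sum_z_square_null lim_1_over_n)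
  have "(\<lambda>n. (\<Sum>j=1..n. (norm (scaled a n j))\<^sup>2) - (1 / w n) * integral {0..ln (real n)} (g a)) \<longlonglongrightarrow> 0"
    by (rule Lim_null_comparison[OF le]) (use lim in simp)
  from tendsto_add[OF this assms] show ?thesis by simp
qed

end

section \<open>The central limit theorem\<close>

lemma cov_integrand_eq:
  "cov_integrand B t = transpose (mexp (t *\<^sub>R (B - (1/2) *\<^sub>R mat 1))) ** mexp (t *\<^sub>R (B - (1/2) *\<^sub>R mat 1))"
  by (simp add: cov_integrand_def Let_def mexp_transpose)

lemma inner_transpose: "inner x (A *v y) = inner (transpose A *v x) (y :: real ^ 'n)"
  by (simp only: transpose_matrix_vector dot_lmul_matrix)

text \<open>Moving the transpose across the inner product identifies the quadratic form of the
  covariance integrand with the function \<open>g\<close>.\<close>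

lemma cov_integrand_form: "inner a (cov_integrand B t *v a) = (norm (mexp (t *\<^sub>R (B - (1/2) *\<^sub>R mat 1)) *v a))\<^sup>2"
  unfolding cov_integrand_eq matrix_vector_mul_assoc[symmetric]
  by (subst inner_transpose) (simp only: transpose_transpose power2_norm_eq_inner)

lemma transpose_cov_integrand: "transpose (cov_integrand B t) = cov_integrand B t"
  by (simp add: cov_integrand_eq matrix_transpose_mul)

lemma continuous_on_matrix_mult:
  fixes f :: "real \<Rightarrow> real ^ 'n ^ 'm" and g :: "real \<Rightarrow> real ^ 'k ^ 'n"
  assumes "continuous_on S f" "continuous_on S g"
  shows "continuous_on S (\<lambda>t. f t ** g t)"
  unfolding matrix_matrix_mult_def
  by (intro continuous_on_vec_lambda continuous_intros continuous_on_component assms)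

lemma continuous_on_cov_integrand: "continuous_on S (cov_integrand B)"
proof -
  have "continuous_on S (\<lambda>t. mexp (t *\<^sub>R transpose (B - (1/2) *\<^sub>R mat 1)) ** mexp (t *\<^sub>R (B - (1/2) *\<^sub>R mat 1)))"
    by (intro continuous_on_matrix_mult continuous_on_mexp)
  then show ?thesis by (simp add: cov_integrand_def Let_def cong: continuous_on_cong)
qed

lemma bounded_linear_quadratic_form: "bounded_linear (\<lambda>A :: real ^ 'n ^ 'n. inner a (A *v a))"
  unfolding linear_conv_bounded_linear[symmetric]
  by (rule linearI) (simp_all add: matrix_vector_mult_add_rdistrib inner_add_right scaleR_matrix_vector_assoc[symmetric])

lemma bounded_linear_transpose: "bounded_linear (transpose :: real ^ 'n ^ 'm \<Rightarrow> real ^ 'm ^ 'n)"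
  unfolding linear_conv_bounded_linear[symmetric]
  by (rule linearI) (simp_all add: transpose_def vec_eq_iff)

lemma bounded_linear_entry: "bounded_linear (\<lambda>A :: real ^ 'n ^ 'm. A $ i $ j)"
  by (rule bounded_linear_compose[OF bounded_linear_vec_nth bounded_linear_vec_nth])

lemma cov_integral_eq:
  "(LINT t:{0..L}|lborel. cov_integrand B t) = integral {0..L} (cov_integrand B)"
  by (rule set_borel_integral_eq_integral(2)) (rule borel_integrable_atLeastAtMost'[OF continuous_on_cov_integrand])

text \<open>Serves for quadratic forms, for the transpose and for single entries, so that the
  matrix-valued integral is handled through linear images.\<close>

lemma cov_integral_linear:
  assumes "bounded_linear h"
  shows "h (LINT t:{0..L}|lborel. cov_integrand B t) = integral {0..L} (\<lambda>t. h (cov_integrand B t))"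
  using integral_linear[OF integrable_continuous_interval[OF continuous_on_cov_integrand] assms, of 0 L B]
  by (simp add: cov_integral_eq o_def)

lemma cov_integral_form:
  "inner a ((LINT t:{0..L}|lborel. cov_integrand B t) *v a)
    = integral {0..L} (\<lambda>t. (norm (mexp (t *\<^sub>R (B - (1/2) *\<^sub>R mat 1)) *v a))\<^sup>2)"
  unfolding cov_integral_linear[OF bounded_linear_quadratic_form] cov_integrand_form ..

lemma transpose_cov_integral:
  "transpose (LINT t:{0..L}|lborel. cov_integrand B t) = (LINT t:{0..L}|lborel. cov_integrand B t)"
  using cov_integral_linear[OF bounded_linear_transpose, of L B]
  by (simp only: transpose_cov_integrand cov_integral_eq)

section \<open>Iterating the one-step estimates along the backward recursion\<close>

context erwg
begin

lemma AE_inner_S_1: "AE \<omega> in M. \<bar>inner b (S 1 \<omega>)\<bar> \<le> norm b * real CARD('v)"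
  using AE_S_le[of 1]
proof eventually_elim
  case (elim \<omega>)
  have "norm (S 1 \<omega>) \<le> (\<Sum>v\<in>UNIV. \<bar>S 1 \<omega> $ v\<bar>)" by (rule norm_le_l1_cart)
  also have "\<dots> \<le> (\<Sum>v\<in>(UNIV :: 'v set). 1)" using elim by (intro sum_mono) simp
  finally have "norm (S 1 \<omega>) \<le> real CARD('v)" by simp
  then show ?case by (intro order.trans[OF Cauchy_Schwarz_ineq2] mult_left_mono) auto
qed

lemma second_moment_init: "expectation (\<lambda>\<omega>. (inner b (S 1 \<omega>))\<^sup>2) \<le> (real CARD('v))\<^sup>2 * (norm b)\<^sup>2"
proof -
  have "expectation (\<lambda>\<omega>. (inner b (S 1 \<omega>))\<^sup>2) \<le> expectation (\<lambda>\<omega>. (real CARD('v))\<^sup>2 * (norm b)\<^sup>2)"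
  proof (rule integral_mono_AE)
    show "AE \<omega> in M. (inner b (S 1 \<omega>))\<^sup>2 \<le> (real CARD('v))\<^sup>2 * (norm b)\<^sup>2"
      using AE_inner_S_1[of b]
    proof eventually_elim
      case (elim \<omega>)
      then have "\<bar>inner b (S 1 \<omega>)\<bar>\<^sup>2 \<le> (norm b * real CARD('v))\<^sup>2" by (intro power_mono) auto
      then show ?case by (simp add: power_mult_distrib mult.commute)
    qed
  qed (auto intro: integrable_inner_S_square)
  then show ?thesis by (simp add: prob_space)
qed

lemma charfun_init: "cmod ((CLINT \<omega>|M. iexp (inner b (S 1 \<omega>))) - 1) \<le> norm b * real CARD('v)"
proof -
  have ae: "AE \<omega> in M. norm (iexp (inner b (S 1 \<omega>)) - 1) \<le> norm b * real CARD('v)"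
    using AE_inner_S_1[of b]
  proof eventually_elim
    case (elim \<omega>)
    have "norm (iexp (inner b (S 1 \<omega>)) - 1) \<le> \<bar>inner b (S 1 \<omega>)\<bar>"
      using iexp_approx1[of "inner b (S 1 \<omega>)" 0] by simp
    then show ?case using elim by linarith
  qed
  have int: "integrable M (\<lambda>\<omega>. iexp (inner b (S 1 \<omega>)))"
    by (intro integrable_const_bound[where B = 1]) auto
  have "(CLINT \<omega>|M. iexp (inner b (S 1 \<omega>))) - 1 = (CLINT \<omega>|M. iexp (inner b (S 1 \<omega>)) - 1)"
    by (subst Bochner_Integration.integral_diff[OF int]) (simp_all add: prob_space)
  also have "cmod \<dots> \<le> expectation (\<lambda>\<omega>. norm (iexp (inner b (S 1 \<omega>)) - 1))"
    by (rule integral_norm_bound)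
  also have "\<dots> \<le> expectation (\<lambda>\<omega>. norm b * real CARD('v))"
    using int ae by (intro integral_mono_AE integrable_norm) auto
  finally show ?thesis by (simp add: prob_space)
qed

text \<open>Along the recursion the updated vector of \<open>second_moment_step\<close> at time
  \<open>m\<close> is \<open>b m\<close> again, so the steps chain. The dimension enters through the
  crude estimate at time 1.\<close>

lemma second_moment_bound:
  assumes rec: "\<And>j. 1 \<le> j \<Longrightarrow> j < n \<Longrightarrow> b j = b (Suc j) + (1 / j) *\<^sub>R (memory_matrix E p *v b (Suc j))"
    and n: "n \<ge> 1"
  shows "expectation (\<lambda>\<omega>. (inner (b n) (S n \<omega>))\<^sup>2) \<le> (real CARD('v))\<^sup>2 * (\<Sum>j=1..n. (norm (b j))\<^sup>2)"
proof -
  have "m \<le> n \<Longrightarrow> expectation (\<lambda>\<omega>. (inner (b m) (S m \<omega>))\<^sup>2) \<le> (real CARD('v))\<^sup>2 * (\<Sum>j=1..m. (norm (b j))\<^sup>2)"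
    if "1 \<le> m" for m
    using that
  proof (induction m rule: dec_induct)
    case base
    then show ?case using second_moment_init[of "b 1"] by simp
  next
    case (step m)
    have C: "1 \<le> (real CARD('v))\<^sup>2" by (intro one_le_power) simp
    have "expectation (\<lambda>\<omega>. (inner (b (Suc m)) (S (Suc m) \<omega>))\<^sup>2)
        \<le> expectation (\<lambda>\<omega>. (inner (b m) (S m \<omega>))\<^sup>2) + (norm (b (Suc m)))\<^sup>2"
      using second_moment_step[OF step.hyps(1), of "b (Suc m)"] rec[of m] step by simp
    also have "\<dots> \<le> (real CARD('v))\<^sup>2 * (\<Sum>j=1..m. (norm (b j))\<^sup>2) + (real CARD('v))\<^sup>2 * (norm (b (Suc m)))\<^sup>2"
      using step mult_right_mono[OF C, of "(norm (b (Suc m)))\<^sup>2"] by (intro add_mono) auto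
    finally show ?case using step.hyps by (simp add: distrib_left)
  qed
  then show ?thesis using n by blast
qed

text \<open>The Gaussian factors have modulus at most 1, so the one-step errors add up without
  amplification. The sum begins at 2 because the recursion of the walk is followed back to time 1
  only; step \<open>j\<close> is driven by the drift at time \<open>j - 1\<close>.\<close>

lemma charfun_telescope:
  assumes rec: "\<And>j. 1 \<le> j \<Longrightarrow> j < n \<Longrightarrow> b j = b (Suc j) + (1 / j) *\<^sub>R (memory_matrix E p *v b (Suc j))"
    and n: "n \<ge> 1" and b: "\<And>j. 1 \<le> j \<Longrightarrow> j \<le> n \<Longrightarrow> norm (b j) \<le> 1"
  shows "cmod ((CLINT \<omega>|M. iexp (inner (b n) (S n \<omega>)))
      - of_real (exp (- (\<Sum>j=2..n. (norm (b j))\<^sup>2) / 2)) * (CLINT \<omega>|M. iexp (inner (b 1) (S 1 \<omega>))))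
    \<le> (\<Sum>j=2..n. 2 * real CARD('v) * norm (b j) ^ 3
        + (norm (b j))\<^sup>2 * (\<Sum>v\<in>UNIV. expectation (\<lambda>\<omega>. (drift (j - 1) (S (j - 1) \<omega>) $ v)\<^sup>2)))"
proof -
  define \<phi> where "\<phi> m = (CLINT \<omega>|M. iexp (inner (b m) (S m \<omega>)))" for m
  define e where "e j = 2 * real CARD('v) * norm (b j) ^ 3
        + (norm (b j))\<^sup>2 * (\<Sum>v\<in>UNIV. expectation (\<lambda>\<omega>. (drift (j - 1) (S (j - 1) \<omega>) $ v)\<^sup>2))" for j
  have "m \<le> n \<Longrightarrow> cmod (\<phi> m - of_real (exp (- (\<Sum>j=2..m. (norm (b j))\<^sup>2) / 2)) * \<phi> 1) \<le> (\<Sum>j=2..m. e j)"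
    if "1 \<le> m" for m
    using that
  proof (induction m rule: dec_induct)
    case base
    then show ?case by simp
  next
    case (step m)
    let ?E = "\<lambda>m. complex_of_real (exp (- (\<Sum>j=2..m. (norm (b j))\<^sup>2) / 2))"
    let ?s = "complex_of_real (exp (- (norm (b (Suc m)))\<^sup>2 / 2))"
    have E: "?E (Suc m) = ?s * ?E m"
      using step.hyps by (simp add: exp_add[symmetric] add_divide_distrib flip: of_real_mult)
    have b1: "\<bar>b (Suc m) $ v\<bar> \<le> norm (b (Suc m))" for v by (rule component_le_norm_cart)
    have "cmod (\<phi> (Suc m) - ?s * \<phi> m)
        \<le> (\<Sum>v\<in>UNIV. 2 * \<bar>b (Suc m) $ v\<bar> ^ 3 + (b (Suc m) $ v)\<^sup>2 * expectation (\<lambda>\<omega>. (drift m (S m \<omega>) $ v)\<^sup>2))"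
      using charfun_step[OF step.hyps(1), of "b (Suc m)"] b1 b[of "Suc m"] rec[of m] step
      unfolding \<phi>_def by (simp add: order_trans[OF b1])
    also have "\<dots> \<le> (\<Sum>v\<in>(UNIV :: 'v set). 2 * norm (b (Suc m)) ^ 3 + (norm (b (Suc m)))\<^sup>2 * expectation (\<lambda>\<omega>. (drift m (S m \<omega>) $ v)\<^sup>2))"
    proof (rule sum_mono)
      fix v
      have "\<bar>b (Suc m) $ v\<bar> ^ 3 \<le> norm (b (Suc m)) ^ 3" "(b (Suc m) $ v)\<^sup>2 \<le> (norm (b (Suc m)))\<^sup>2"
        using power_mono[OF b1[of v], of 3] power_mono[OF b1[of v], of 2] by simp_all
      then show "2 * \<bar>b (Suc m) $ v\<bar> ^ 3 + (b (Suc m) $ v)\<^sup>2 * expectation (\<lambda>\<omega>. (drift m (S m \<omega>) $ v)\<^sup>2)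
          \<le> 2 * norm (b (Suc m)) ^ 3 + (norm (b (Suc m)))\<^sup>2 * expectation (\<lambda>\<omega>. (drift m (S m \<omega>) $ v)\<^sup>2)"
        by (intro add_mono mult_right_mono) auto
    qed
    also have "\<dots> = e (Suc m)" by (simp add: e_def sum.distrib sum_distrib_left)
    finally have 1: "cmod (\<phi> (Suc m) - ?s * \<phi> m) \<le> e (Suc m)" .
    have "cmod (?s * (\<phi> m - ?E m * \<phi> 1)) \<le> 1 * cmod (\<phi> m - ?E m * \<phi> 1)"
      unfolding norm_mult by (intro mult_right_mono) auto
    then have 2: "cmod (?s * (\<phi> m - ?E m * \<phi> 1)) \<le> (\<Sum>j=2..m. e j)"
      using step by simp
    have eq: "\<phi> (Suc m) - ?E (Suc m) * \<phi> 1 = (\<phi> (Suc m) - ?s * \<phi> m) + ?s * (\<phi> m - ?E m * \<phi> 1)"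
      unfolding E by (simp add: algebra_simps)
    have "cmod (\<phi> (Suc m) - ?E (Suc m) * \<phi> 1) \<le> e (Suc m) + (\<Sum>j=2..m. e j)"
      unfolding eq by (rule order.trans[OF norm_triangle_ineq add_mono[OF 1 2]])
    also have "\<dots> = (\<Sum>j=2..Suc m. e j)" using step.hyps by simp
    finally show ?case .
  qed
  then show ?thesis using n unfolding \<phi>_def e_def by blast
qed

end

text \<open>Common frame of both regimes. The normalisation \<open>c\<close> is tied to
  \<open>w\<close> only eventually: in the critical case the two expressions are compared once
  \<open>ln n\<close> is at least 1.\<close>

locale erwg_scaled = erwg M E p q \<sigma> \<xi> D u + regular_scale "memory_matrix E p" w K
  for M :: "'a measure" and E :: "('v::finite \<times> 'v) set" and p q \<sigma> \<xi> D u w K +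
  fixes c :: "nat \<Rightarrow> real" and \<Sigma> :: "real ^ 'v ^ 'v"
  assumes scale: "\<forall>\<^sub>F n in sequentially. c n = 1 / sqrt (n * w n)"
    and covariance: "(\<lambda>n. (1 / w n) *\<^sub>R (LINT t:{0..ln (real n)}|lborel. cov_integrand (memory_matrix E p) t)) \<longlonglongrightarrow> \<Sigma>"
begin

lemma quadratic_form_limit: "(\<lambda>n. (1 / w n) * integral {0..ln (real n)} (g a)) \<longlonglongrightarrow> inner a (\<Sigma> *v a)"
  using bounded_linear.tendsto[OF bounded_linear_quadratic_form covariance, of a]
  by (simp add: scaleR_matrix_vector_assoc[symmetric] cov_integral_form g_def[abs_def] U_def)

lemma transpose_covariance: "transpose \<Sigma> = \<Sigma>"
proof (rule LIMSEQ_unique[OF _ covariance])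
  have "(\<lambda>n. transpose ((1 / w n) *\<^sub>R (LINT t:{0..ln (real n)}|lborel. cov_integrand (memory_matrix E p) t))) \<longlonglongrightarrow> transpose \<Sigma>"
    by (rule bounded_linear.tendsto[OF bounded_linear_transpose covariance])
  then show "(\<lambda>n. (1 / w n) *\<^sub>R (LINT t:{0..ln (real n)}|lborel. cov_integrand (memory_matrix E p) t)) \<longlonglongrightarrow> transpose \<Sigma>"
    by (simp add: linear_cmul[OF bounded_linear.linear[OF bounded_linear_transpose]] transpose_cov_integral)
qed

lemma covariance_psd: "0 \<le> inner a (\<Sigma> *v a)"
proof (rule LIMSEQ_le_const[OF quadratic_form_limit])
  have "\<forall>\<^sub>F n in sequentially. 0 \<le> (1 / w n) * integral {0..ln (real n)} (g a)"
    using w_pos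
  proof eventually_elim
    case (elim n)
    have "0 \<le> integral {0..ln (real n)} (g a)"
      by (rule integral_nonneg) (auto intro: integrable_continuous_interval g_continuous simp: g_def)
    then show ?case using elim by simp
  qed
  then show "\<exists>N. \<forall>n\<ge>N. 0 \<le> (1 / w n) * integral {0..ln (real n)} (g a)"
    by (simp add: eventually_sequentially)
qed

lemma scaled_rec:
  "1 \<le> j \<Longrightarrow> j < n \<Longrightarrow> scaled a n j = scaled a n (Suc j) + (1 / j) *\<^sub>R (memory_matrix E p *v scaled a n (Suc j))"
  unfolding scaled_def
  by (simp add: Suc_diff_Suc[symmetric] matrix_vector_mul_assoc[symmetric] matrix_vector_mult_add_rdistrib
      scaleR_matrix_vector_assoc[symmetric] matrix_vector_mult_scaleR scaleR_add_right mult.commute)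

lemma scaled_last: "scaled a n n = (1 / sqrt (n * w n)) *\<^sub>R a"
  by (simp add: scaled_def)

lemma scaled_sum_bounded: "\<exists>C\<ge>0. \<forall>\<^sub>F n in sequentially. (\<Sum>j=1..n. (norm (scaled a n j))\<^sup>2) \<le> C"
proof -
  have "\<forall>\<^sub>F n in sequentially. (\<Sum>j=1..n. (norm (scaled a n j))\<^sup>2) < inner a (\<Sigma> *v a) + 1"
    using scaled_square_sum[OF quadratic_form_limit, of a] by (rule order_tendstoD) simp
  then show ?thesis using covariance_psd[of a]
    by (intro exI[of _ "inner a (\<Sigma> *v a) + 1"]) (auto elim: eventually_mono)
qed

lemma second_moment_scaled: "\<exists>C\<ge>0. \<forall>\<^sub>F n in sequentially. expectation (\<lambda>\<omega>. (inner (scaled a n n) (S n \<omega>))\<^sup>2) \<le> C"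
proof -
  obtain C where C: "C \<ge> 0" "\<forall>\<^sub>F n in sequentially. (\<Sum>j=1..n. (norm (scaled a n j))\<^sup>2) \<le> C"
    using scaled_sum_bounded by blast
  have "\<forall>\<^sub>F n in sequentially. expectation (\<lambda>\<omega>. (inner (scaled a n n) (S n \<omega>))\<^sup>2) \<le> (real CARD('v))\<^sup>2 * C"
    using C(2) eventually_ge_at_top[of 1]
  proof eventually_elim
    case (elim n)
    have "expectation (\<lambda>\<omega>. (inner (scaled a n n) (S n \<omega>))\<^sup>2) \<le> (real CARD('v))\<^sup>2 * (\<Sum>j=1..n. (norm (scaled a n j))\<^sup>2)"
      by (rule second_moment_bound) (use scaled_rec elim in auto)
    also have "\<dots> \<le> (real CARD('v))\<^sup>2 * C" using elim by (intro mult_left_mono) auto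
    finally show ?case .
  qed
  then show ?thesis using C(1) by (intro exI[of _ "(real CARD('v))\<^sup>2 * C"]) auto
qed

text \<open>Coordinate \<open>v\<close> of the drift is \<open>inner a (S n \<omega>) / n\<close>
  with \<open>a\<close> the image of a unit vector, that is, \<open>sqrt (w n / n)\<close> times a
  normalised quantity with bounded second moment. Sublinearity of \<open>w\<close> does the
  rest.\<close>

lemma drift_second_moment_null: "(\<lambda>n. expectation (\<lambda>\<omega>. (drift n (S n \<omega>) $ v)\<^sup>2)) \<longlonglongrightarrow> 0"
proof -
  define a where "a = memory_matrix E p *v axis v 1"
  obtain C where C: "\<forall>\<^sub>F n in sequentially. expectation (\<lambda>\<omega>. (inner (scaled a n n) (S n \<omega>))\<^sup>2) \<le> C"
    using second_moment_scaled by blast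
  have le: "\<forall>\<^sub>F n in sequentially. norm (expectation (\<lambda>\<omega>. (drift n (S n \<omega>) $ v)\<^sup>2)) \<le> C * (w n / n)"
    using C w_pos eventually_gt_at_top[of 0]
  proof eventually_elim
    case (elim n)
    have "(drift n s $ v)\<^sup>2 = (w n / n) * (inner (scaled a n n) s)\<^sup>2" for s
    proof -
      have "drift n s $ v = inner (axis v 1) (drift n s)" by (simp add: inner_axis')
      also have "\<dots> = (1 / n) * inner a s" unfolding drift_adjoint by (simp add: a_def)
      finally have "(drift n s $ v)\<^sup>2 = (1 / n)\<^sup>2 * (inner a s)\<^sup>2" by (simp add: power_divide)
      moreover have "(inner (scaled a n n) s)\<^sup>2 = (inner a s)\<^sup>2 / (n * w n)"
        using elim by (simp add: scaled_last power_divide)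
      ultimately show ?thesis using elim by (simp add: power2_eq_square)
    qed
    then have "expectation (\<lambda>\<omega>. (drift n (S n \<omega>) $ v)\<^sup>2) = (w n / n) * expectation (\<lambda>\<omega>. (inner (scaled a n n) (S n \<omega>))\<^sup>2)"
      by simp
    then have "norm (expectation (\<lambda>\<omega>. (drift n (S n \<omega>) $ v)\<^sup>2)) = (w n / n) * expectation (\<lambda>\<omega>. (inner (scaled a n n) (S n \<omega>))\<^sup>2)"
      using elim by (simp add: abs_mult)
    also have "\<dots> \<le> (w n / n) * C" using elim by (intro mult_left_mono) auto
    finally show ?case by (simp add: mult.commute)
  qed
  have "(\<lambda>n. C * (w n / real n)) \<longlonglongrightarrow> C * 0" by (intro tendsto_intros sublinear)
  then show ?thesis by (intro Lim_null_comparison[OF le]) simp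
qed

text \<open>The telescoped error splits into cubes, which vanish by \<open>scaled_cube_null\<close>,
  and squared norms against drift moments, where \<open>toeplitz_null\<close> applies: the squares
  have bounded sums and vanish for each fixed \<open>j\<close>. The Gaussian factor converges by
  \<open>scaled_square_sum\<close>, and the initial factor tends to 1 because the test vector at
  time 1 tends to zero.\<close>

lemma charfun_limit:
  "(\<lambda>n. CLINT \<omega>|M. iexp (inner (scaled a n n) (S n \<omega>))) \<longlonglongrightarrow> of_real (exp (- (inner a (\<Sigma> *v a)) / 2))"
proof -
  let ?r = "\<lambda>n j. norm (scaled a n j)"
  define \<delta> where "\<delta> j = (\<Sum>v\<in>UNIV. expectation (\<lambda>\<omega>. (drift (j - 1) (S (j - 1) \<omega>) $ v)\<^sup>2))" for j
  have \<delta>: "\<delta> \<longlonglongrightarrow> 0"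
  proof -
    have "(\<lambda>j. \<delta> (Suc j)) \<longlonglongrightarrow> (\<Sum>v\<in>(UNIV :: 'v set). 0)"
      unfolding \<delta>_def diff_Suc_1 by (intro tendsto_sum drift_second_moment_null)
    then show ?thesis by (subst (asm) filterlim_sequentially_Suc) simp
  qed
  have \<delta>0: "\<delta> j \<ge> 0" for j unfolding \<delta>_def by (intro sum_nonneg integral_nonneg_AE) auto
  obtain C where C: "\<forall>\<^sub>F n in sequentially. (\<Sum>j=1..n. (?r n j)\<^sup>2) \<le> C"
    using scaled_sum_bounded by blast
  have null2: "(\<lambda>n. (?r n j)\<^sup>2) \<longlonglongrightarrow> 0" if "j \<ge> 1" for j
    using tendsto_power[OF scaled_null[OF that, of a], of 2] by simp
  have err: "(\<lambda>n. 2 * real CARD('v) * (\<Sum>j=1..n. ?r n j ^ 3) + (\<Sum>j=1..n. (?r n j)\<^sup>2 * \<delta> j)) \<longlonglongrightarrow> 2 * real CARD('v) * 0 + 0"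
  proof (intro tendsto_add tendsto_mult tendsto_const scaled_cube_null toeplitz_null)
    show "\<forall>\<^sub>F n in sequentially. \<forall>j\<in>{1..n}. 0 \<le> (?r n j)\<^sup>2" by simp
    show "(\<lambda>n. (?r n j)\<^sup>2) \<longlonglongrightarrow> 0" if "1 \<le> j" for j by (rule null2[OF that])
    show "\<forall>\<^sub>F n in sequentially. (\<Sum>j=1..n. (?r n j)\<^sup>2) \<le> C" by (rule C)
    show "\<delta> \<longlonglongrightarrow> 0" by (rule \<delta>)
  qed
  have "\<forall>\<^sub>F n in sequentially. (\<Sum>j=1..n. ?r n j ^ 3) < 1"
    using scaled_cube_null by (rule order_tendstoD) simp
  then have le: "\<forall>\<^sub>F n in sequentially. norm ((CLINT \<omega>|M. iexp (inner (scaled a n n) (S n \<omega>)))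
      - of_real (exp (- (\<Sum>j=2..n. (?r n j)\<^sup>2) / 2)) * (CLINT \<omega>|M. iexp (inner (scaled a n 1) (S 1 \<omega>))))
    \<le> 2 * real CARD('v) * (\<Sum>j=1..n. ?r n j ^ 3) + (\<Sum>j=1..n. (?r n j)\<^sup>2 * \<delta> j)"
    using eventually_ge_at_top[of 1]
  proof eventually_elim
    case (elim n)
    \<comment> \<open>The telescoped estimate requires vectors of norm at most 1; a sum of cubes
      below 1 enforces this for all \<open>j\<close> at once.\<close>
    have small: "?r n j \<le> 1" if "1 \<le> j" "j \<le> n" for j
    proof -
      have "?r n j ^ 3 \<le> (\<Sum>j=1..n. ?r n j ^ 3)"
        using that by (intro member_le_sum) auto
      then have "?r n j ^ 3 < 1 ^ 3" using elim by simp
      then show ?thesis by (meson less_imp_le power_less_imp_less_base zero_le_one)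
    qed
    have "norm ((CLINT \<omega>|M. iexp (inner (scaled a n n) (S n \<omega>)))
      - of_real (exp (- (\<Sum>j=2..n. (?r n j)\<^sup>2) / 2)) * (CLINT \<omega>|M. iexp (inner (scaled a n 1) (S 1 \<omega>))))
      \<le> (\<Sum>j=2..n. 2 * real CARD('v) * ?r n j ^ 3 + (?r n j)\<^sup>2 * \<delta> j)"
      unfolding \<delta>_def by (rule charfun_telescope) (use scaled_rec small elim in auto)
    also have "\<dots> \<le> (\<Sum>j=1..n. 2 * real CARD('v) * ?r n j ^ 3 + (?r n j)\<^sup>2 * \<delta> j)"
      using \<delta>0 by (intro sum_mono2) auto
    also have "\<dots> = 2 * real CARD('v) * (\<Sum>j=1..n. ?r n j ^ 3) + (\<Sum>j=1..n. (?r n j)\<^sup>2 * \<delta> j)"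
      by (simp add: sum.distrib sum_distrib_left)
    finally show ?case .
  qed
  have diff: "(\<lambda>n. (CLINT \<omega>|M. iexp (inner (scaled a n n) (S n \<omega>)))
      - of_real (exp (- (\<Sum>j=2..n. (?r n j)\<^sup>2) / 2)) * (CLINT \<omega>|M. iexp (inner (scaled a n 1) (S 1 \<omega>)))) \<longlonglongrightarrow> 0"
    by (rule Lim_null_comparison[OF le]) (use err in simp)
  have init: "(\<lambda>n. CLINT \<omega>|M. iexp (inner (scaled a n 1) (S 1 \<omega>))) \<longlonglongrightarrow> 1"
  proof -
    have "(\<lambda>n. ?r n 1 * real CARD('v)) \<longlonglongrightarrow> 0 * real CARD('v)"
      by (intro tendsto_intros scaled_null) simp
    then have l: "(\<lambda>n. ?r n 1 * real CARD('v)) \<longlonglongrightarrow> 0" by simp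
    have "(\<lambda>n. (CLINT \<omega>|M. iexp (inner (scaled a n 1) (S 1 \<omega>))) - 1) \<longlonglongrightarrow> 0"
      by (rule Lim_null_comparison[OF _ l]) (rule always_eventually, rule allI, rule charfun_init)
    from tendsto_add[OF this tendsto_const[of 1]] show ?thesis by simp
  qed
  \<comment> \<open>The Gaussian factor starts at \<open>j = 2\<close>, but the missing first term
    tends to zero.\<close>
  have sum: "(\<lambda>n. \<Sum>j=2..n. (?r n j)\<^sup>2) \<longlonglongrightarrow> inner a (\<Sigma> *v a)"
  proof -
    have "(\<lambda>n. (\<Sum>j=1..n. (?r n j)\<^sup>2) - (?r n 1)\<^sup>2) \<longlonglongrightarrow> inner a (\<Sigma> *v a) - 0"
      by (intro tendsto_diff scaled_square_sum[OF quadratic_form_limit] null2) simp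
    then have l: "(\<lambda>n. (\<Sum>j=1..n. (?r n j)\<^sup>2) - (?r n 1)\<^sup>2) \<longlonglongrightarrow> inner a (\<Sigma> *v a)" by simp
    have ev: "\<forall>\<^sub>F n in sequentially. (\<Sum>j=1..n. (?r n j)\<^sup>2) - (?r n 1)\<^sup>2 = (\<Sum>j=2..n. (?r n j)\<^sup>2)"
      using eventually_ge_at_top[of 1]
    proof eventually_elim
      case (elim n)
      then show ?case by (simp add: sum.atLeast_Suc_atMost numeral_2_eq_2)
    qed
    show ?thesis by (rule Lim_transform_eventually[OF l ev])
  qed
  have "(\<lambda>n. of_real (exp (- (\<Sum>j=2..n. (?r n j)\<^sup>2) / 2)) * (CLINT \<omega>|M. iexp (inner (scaled a n 1) (S 1 \<omega>))))
      \<longlonglongrightarrow> of_real (exp (- (inner a (\<Sigma> *v a)) / 2)) * 1"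
    by (intro tendsto_intros sum init) simp
  from tendsto_add[OF diff this] show ?thesis by simp
qed

lemma scaled_walk: "\<forall>\<^sub>F n in sequentially. \<forall>a \<omega>. inner a (c n *\<^sub>R S n \<omega>) = inner (scaled a n n) (S n \<omega>)"
  using scale by eventually_elim (simp add: scaled_last)

lemma walk_tight:
  assumes d: "d > 0"
  shows "\<exists>R. \<forall>\<^sub>F n in sequentially. prob {\<omega> \<in> space M. norm (c n *\<^sub>R S n \<omega>) > R} \<le> d"
proof -
  have "\<exists>C. \<forall>v. C v \<ge> 0 \<and> (\<forall>\<^sub>F n in sequentially. expectation (\<lambda>\<omega>. (inner (scaled (axis v 1) n n) (S n \<omega>))\<^sup>2) \<le> C v)"
    using second_moment_scaled by (intro choice allI) blast
  then obtain C where C: "\<And>v. C v \<ge> 0" "\<And>v. \<forall>\<^sub>F n in sequentially. expectation (\<lambda>\<omega>. (inner (scaled (axis v 1) n n) (S n \<omega>))\<^sup>2) \<le> C v"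
    by blast
  define T where "T = (\<Sum>v\<in>UNIV. C v)"
  have T: "T \<ge> 0" unfolding T_def by (intro sum_nonneg C(1))
  \<comment> \<open>Markov's inequality for the squared norm then gives
    \<open>T / R^2 \<le> d\<close>; the added 1 keeps \<open>R\<close> positive.\<close>
  define R where "R = sqrt ((T + 1) / d)"
  have R: "R > 0" "R\<^sup>2 = (T + 1) / d" using T d by (simp_all add: R_def)
  have "\<forall>\<^sub>F n in sequentially. \<forall>v\<in>UNIV. expectation (\<lambda>\<omega>. (inner (scaled (axis v 1) n n) (S n \<omega>))\<^sup>2) \<le> C v"
    using C(2) by (intro eventually_ball_finite) auto
  then have "\<forall>\<^sub>F n in sequentially. prob {\<omega> \<in> space M. norm (c n *\<^sub>R S n \<omega>) > R} \<le> d"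
    using scaled_walk
  proof eventually_elim
    case (elim n)
    have sq: "(norm (c n *\<^sub>R S n \<omega>))\<^sup>2 = (\<Sum>v\<in>UNIV. (inner (scaled (axis v 1) n n) (S n \<omega>))\<^sup>2)" for \<omega>
    proof -
      have "(c n *\<^sub>R S n \<omega>) $ v = inner (scaled (axis v 1) n n) (S n \<omega>)" for v
        using elim(2)[rule_format, of "axis v 1" \<omega>] by (simp add: inner_axis')
      then show ?thesis by (simp only: norm_square_vec)
    qed
    have int: "integrable M (\<lambda>\<omega>. (norm (c n *\<^sub>R S n \<omega>))\<^sup>2)"
      unfolding sq by (intro Bochner_Integration.integrable_sum integrable_inner_S_square)
    have "prob {\<omega> \<in> space M. norm (c n *\<^sub>R S n \<omega>) > R} \<le> prob {\<omega> \<in> space M. (norm (c n *\<^sub>R S n \<omega>))\<^sup>2 \<ge> R\<^sup>2}"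
      using R(1) by (intro finite_measure_mono) (auto intro: power_mono)
    also have "\<dots> \<le> expectation (\<lambda>\<omega>. (norm (c n *\<^sub>R S n \<omega>))\<^sup>2) / R\<^sup>2"
      using R(1) by (intro integral_Markov_inequality_measure[OF int, where A = "{}"]) auto
    also have "expectation (\<lambda>\<omega>. (norm (c n *\<^sub>R S n \<omega>))\<^sup>2) = (\<Sum>v\<in>UNIV. expectation (\<lambda>\<omega>. (inner (scaled (axis v 1) n n) (S n \<omega>))\<^sup>2))"
      unfolding sq by (intro Bochner_Integration.integral_sum integrable_inner_S_square)
    also have "\<dots> / R\<^sup>2 \<le> T / R\<^sup>2"
      unfolding T_def using elim(1) R(1) by (intro divide_right_mono sum_mono) auto
    also have "\<dots> \<le> d" using T d unfolding R(2) by (simp add: field_simps)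
    finally show ?case .
  qed
  then show ?thesis by blast
qed

theorem walk_clt: "\<exists>\<mu>. centered_normal \<Sigma> \<mu> \<and> converges_in_distr M (\<lambda>n \<omega>. c n *\<^sub>R S n \<omega>) \<mu>"
proof -
  have sym: "inner x (\<Sigma> *v y) = inner (\<Sigma> *v x) y" for x y
    unfolding inner_transpose transpose_covariance ..
  obtain \<mu> where mu: "prob_space \<mu>" "sets \<mu> = sets borel"
    "\<And>a. (CLINT x|\<mu>. iexp (inner a x)) = complex_of_real (exp (- (inner a (\<Sigma> *v a)) / 2))"
    using gaussian_exists[OF matrix_vector_mul_linear sym covariance_psd] by blast
  have "converges_in_distr M (\<lambda>n \<omega>. c n *\<^sub>R S n \<omega>) \<mu>"
  proof (rule converges_in_distr_charfun[OF prob_space_axioms _ mu(1,2)])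
    show "(\<lambda>\<omega>. c n *\<^sub>R S n \<omega>) \<in> borel_measurable M" for n by measurable
    show "(\<lambda>n. CLINT \<omega>|M. iexp (inner a (c n *\<^sub>R S n \<omega>))) \<longlonglongrightarrow> (CLINT x|\<mu>. iexp (inner a x))" for a
    proof (rule Lim_transform_eventually)
      show "(\<lambda>n. CLINT \<omega>|M. iexp (inner (scaled a n n) (S n \<omega>))) \<longlonglongrightarrow> (CLINT x|\<mu>. iexp (inner a x))"
        unfolding mu(3) by (rule charfun_limit)
      show "\<forall>\<^sub>F n in sequentially. (CLINT \<omega>|M. iexp (inner (scaled a n n) (S n \<omega>))) = (CLINT \<omega>|M. iexp (inner a (c n *\<^sub>R S n \<omega>)))"
        using scaled_walk by eventually_elim (simp only:)
    qed
  qed (rule walk_tight)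
  moreover have "centered_normal \<Sigma> \<mu>"
    unfolding centered_normal_def using mu transpose_covariance by blast
  ultimately show ?thesis by blast
qed

end


section \<open>Scale conditions and limiting covariances in both regimes\<close>

lemma norm_matrix_le_opnorm:
  fixes A :: "real ^ 'n ^ 'm"
  shows "norm A \<le> real CARD('m) * real CARD('n) * opnorm A"
proof -
  have "norm A \<le> (\<Sum>i\<in>UNIV. norm (A $ i))" by (simp add: norm_vec_def L2_set_le_sum)
  also have "\<dots> \<le> (\<Sum>i\<in>(UNIV :: 'm set). \<Sum>j\<in>(UNIV :: 'n set). opnorm A)"
    by (intro sum_mono order.trans[OF norm_le_l1_cart]) (rule entry_le_opnorm)
  finally show ?thesis by simp
qed

lemma opnorm_transpose_le:
  fixes A :: "real ^ 'n ^ 'm"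
  shows "opnorm (transpose A) \<le> real CARD('n) * real CARD('m) * opnorm A"
  by (rule opnorm_le_entries) (simp add: transpose_def entry_le_opnorm)

lemma set_integrable_cov_integrand:
  fixes B :: "real ^ 'v::finite ^ 'v"
  assumes "max_Re_eigenvalue B < 1/2"
  shows "set_integrable lborel {0..} (cov_integrand B)"
proof -
  obtain K d where K: "K \<ge> 0" "d > 0"
    "\<And>t. t \<ge> 0 \<Longrightarrow> opnorm (mexp (t *\<^sub>R (B - (1/2) *\<^sub>R mat 1))) \<le> K * exp (- d * t)"
    using mexp_decay_subcritical[OF assms] by blast
  define k where "k = real CARD('v)"
  have k: "k \<ge> 0" by (simp add: k_def)
  \<comment> \<open>\<open>k ^ 4\<close> collects a factor \<open>k^2\<close> for passing from the
    operator norm to the Euclidean norm and another \<open>k^2\<close> for the transpose.\<close>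
  have bound: "norm (cov_integrand B t) \<le> k ^ 4 * K\<^sup>2 * exp (- (2 * d) * t)" if t: "t \<ge> 0" for t
  proof -
    define U where "U = mexp (t *\<^sub>R (B - (1/2) *\<^sub>R mat 1))"
    have "norm (cov_integrand B t) \<le> k * k * opnorm (transpose U ** U)"
      unfolding cov_integrand_eq U_def[symmetric] k_def by (rule norm_matrix_le_opnorm)
    also have "\<dots> \<le> k * k * ((k * k * opnorm U) * opnorm U)"
      using opnorm_transpose_le[of U] k
      by (intro mult_left_mono order.trans[OF opnorm_mult] mult_right_mono opnorm_nonneg) (auto simp: k_def)
    also have "\<dots> = k ^ 4 * (opnorm U)\<^sup>2" by (simp add: power2_eq_square eval_nat_numeral)
    also have "\<dots> \<le> k ^ 4 * (K * exp (- d * t))\<^sup>2"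
      using K(3)[OF t] k by (intro mult_left_mono power_mono opnorm_nonneg) (auto simp: U_def)
    also have "(K * exp (- d * t))\<^sup>2 = K\<^sup>2 * exp (- (2 * d) * t)"
      by (simp add: power_mult_distrib power2_eq_square exp_add[symmetric])
    finally show ?thesis by (simp add: mult.assoc)
  qed
  have "(\<lambda>t. exp (- (2 * d) * t)) absolutely_integrable_on {0..}"
    using K(2) by (intro nonnegative_absolutely_integrable_1 integrable_on_exp_minus_to_infinity) auto
  then have "set_integrable lborel {0..} (\<lambda>t. exp (- (2 * d) * t))"
    unfolding set_integrable_def by (subst (asm) integrable_completion) measurable
  then have i: "set_integrable lborel {0..} (\<lambda>t. k ^ 4 * K\<^sup>2 * exp (- (2 * d) * t))"
    by (rule set_integrable_mult_right)
  have m: "cov_integrand B \<in> borel_measurable borel"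
    by (rule borel_measurable_continuous_onI[OF continuous_on_cov_integrand])
  show ?thesis
    unfolding set_integrable_def
  proof (rule Bochner_Integration.integrable_bound[OF i[unfolded set_integrable_def]])
    show "(\<lambda>t. indicat_real {0..} t *\<^sub>R cov_integrand B t) \<in> borel_measurable lborel"
      using m by measurable
    have "norm (indicat_real {0..} t *\<^sub>R cov_integrand B t) \<le> norm (indicat_real {0..} t *\<^sub>R (k ^ 4 * K\<^sup>2 * exp (- (2 * d) * t)))" for t
      using bound[of t] by (auto simp: indicator_def abs_mult)
    then show "AE t in lborel. norm (indicat_real {0..} t *\<^sub>R cov_integrand B t) \<le> norm (indicat_real {0..} t *\<^sub>R (k ^ 4 * K\<^sup>2 * exp (- (2 * d) * t)))"
      by simp
  qed
qed

lemma filterlim_ln_nat: "filterlim (\<lambda>n. ln (real n)) at_top sequentially"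
  by (rule filterlim_compose[OF ln_at_top filterlim_real_sequentially])

lemma Sigma1_limit:
  assumes "max_Re_eigenvalue B < 1/2"
  shows "(\<lambda>n. LINT t:{0..ln (real n)}|lborel. cov_integrand B t) \<longlonglongrightarrow> Sigma1 B"
  unfolding Sigma1_def
  by (rule filterlim_compose[OF tendsto_set_lebesgue_integral_at_top filterlim_ln_nat])
    (simp_all add: set_integrable_cov_integrand[OF assms])

text \<open>Exponential decay in \<open>ln (n / j)\<close> is a negative power of
  \<open>n / j\<close>, so for fixed \<open>j\<close> the weights vanish even with the constant
  scale \<open>w n = 1\<close>.\<close>

lemma regular_scale_subcritical:
  assumes "max_Re_eigenvalue B < 1/2"
  shows "\<exists>K. regular_scale B (\<lambda>n. 1) K"
proof -
  obtain K d where K: "K \<ge> 0" "d > 0"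
    "\<And>t. t \<ge> 0 \<Longrightarrow> opnorm (mexp (t *\<^sub>R (B - (1/2) *\<^sub>R mat 1))) \<le> K * exp (- d * t)"
    using mexp_decay_subcritical[OF assms] by blast
  let ?U = "\<lambda>n j. opnorm (mexp (ln (real n / real j) *\<^sub>R (B - (1/2) *\<^sub>R mat 1)))"
  have bound: "(?U n j)\<^sup>2 \<le> (K * exp (- d * ln (real n / real j)))\<^sup>2" if "1 \<le> j" "j \<le> n" for n j
    using that by (intro power_mono K(3) opnorm_nonneg ln_ge_zero) auto
  have "regular_scale B (\<lambda>n. 1) (K\<^sup>2)"
  proof
    show "\<forall>\<^sub>F n in sequentially. \<forall>j\<in>{1..n}. (?U n j)\<^sup>2 \<le> K\<^sup>2 * 1"
    proof (intro always_eventually allI ballI)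
      fix n j :: nat assume j: "j \<in> {1..n}"
      have "0 \<le> ln (real n / real j)" using j by (intro ln_ge_zero) auto
      then have "K * exp (- d * ln (real n / real j)) \<le> K * 1"
        using K(1,2) by (intro mult_left_mono) auto
      then have "(K * exp (- d * ln (real n / real j)))\<^sup>2 \<le> (K * 1)\<^sup>2"
        using K(1) by (intro power_mono) auto
      then show "(?U n j)\<^sup>2 \<le> K\<^sup>2 * 1" using bound[of j n] j by auto
    qed
    fix j :: nat assume j: "1 \<le> j"
    have "filterlim (\<lambda>n. ln (real n / real j)) at_top sequentially"
    proof -
      have "filterlim (\<lambda>n. (1 / real j) * real n) at_top sequentially"
        using j by (intro filterlim_tendsto_pos_mult_at_top[OF tendsto_const] filterlim_real_sequentially) simp
      then have "filterlim (\<lambda>n. ln ((1 / real j) * real n)) at_top sequentially"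
        by (rule filterlim_compose[OF ln_at_top])
      then show ?thesis by simp
    qed
    then have "filterlim (\<lambda>n. - d * ln (real n / real j)) at_bot sequentially"
      using K(2) by (intro filterlim_tendsto_neg_mult_at_bot[OF tendsto_const]) auto
    then have e: "(\<lambda>n. exp (- d * ln (real n / real j))) \<longlonglongrightarrow> 0"
      by (rule filterlim_compose[OF exp_at_bot])
    have "(\<lambda>n. (K * exp (- d * ln (real n / real j)))\<^sup>2) \<longlonglongrightarrow> (K * 0)\<^sup>2"
      by (intro tendsto_intros e)
    then have lim: "(\<lambda>n. (K * exp (- d * ln (real n / real j)))\<^sup>2) \<longlonglongrightarrow> 0" by simp
    have "(\<lambda>n. (?U n j)\<^sup>2) \<longlonglongrightarrow> 0"
    proof (rule tendsto_sandwich[OF _ _ tendsto_const lim])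
      show "\<forall>\<^sub>F n in sequentially. (?U n j)\<^sup>2 \<le> (K * exp (- d * ln (real n / real j)))\<^sup>2"
        using eventually_ge_at_top[of j] by eventually_elim (rule bound[OF j])
    qed simp
    then show "(\<lambda>n. (?U n j)\<^sup>2 / 1) \<longlonglongrightarrow> 0" by simp
  qed (simp_all add: lim_1_over_n)
  then show ?thesis by blast
qed

text \<open>The squared norm grows at most like \<open>ln n ^ (2 * \<nu> - 2)\<close>, one power
  below the scale; this spare factor \<open>1 / ln n\<close> makes the weights vanish for fixed
  \<open>j\<close>.\<close>

lemma regular_scale_critical:
  assumes "max_Re_eigenvalue B = 1/2"
  shows "\<exists>K. regular_scale B (\<lambda>n. ln (real n) ^ (2 * max_jordan_part B - 1)) K"
proof -
  define m where "m = max_jordan_part B - 1"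
  have nu: "2 * max_jordan_part B - 1 = Suc (2 * m)"
    using max_jordan_part_pos[of B] by (simp add: m_def)
  obtain K where K: "K \<ge> 0"
    "\<And>t. t \<ge> 0 \<Longrightarrow> opnorm (mexp (t *\<^sub>R (B - (1/2) *\<^sub>R mat 1))) \<le> K * (1 + t) ^ m"
    using mexp_bound_critical[OF assms] unfolding m_def by blast
  let ?U = "\<lambda>n j. opnorm (mexp (ln (real n / real j) *\<^sub>R (B - (1/2) *\<^sub>R mat 1)))"
  \<comment> \<open>\<open>4 ^ m\<close> arises from \<open>1 + ln (n / j) \<le> 2 * ln n\<close>,
    valid once \<open>ln n \<ge> 1\<close>, raised to the power \<open>2 * m\<close>.\<close>
  define L where "L = K\<^sup>2 * 4 ^ m"
  have L: "L \<ge> 0" by (simp add: L_def)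
  have large: "\<forall>\<^sub>F n in sequentially. ln (real n) \<ge> 1"
    using filterlim_ln_nat unfolding filterlim_at_top by blast
  have bound: "(?U n j)\<^sup>2 \<le> L * ln (real n) ^ (2 * m)" if "1 \<le> j" "j \<le> n" "ln (real n) \<ge> 1" for n j
  proof -
    have ln: "0 \<le> ln (real n / real j)" "ln (real n / real j) \<le> ln (real n)"
      using that by (auto simp: ln_div intro!: ln_ge_zero)
    have "?U n j \<le> K * (1 + ln (real n / real j)) ^ m" by (rule K(2)[OF ln(1)])
    also have "\<dots> \<le> K * (2 * ln (real n)) ^ m"
    proof (intro mult_left_mono power_mono K(1))
      show "1 + ln (real n / real j) \<le> 2 * ln (real n)" "0 \<le> 1 + ln (real n / real j)"
        using ln that(3) by linarith+
    qed
    finally have "(?U n j)\<^sup>2 \<le> (K * (2 * ln (real n)) ^ m)\<^sup>2"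
      by (intro power_mono opnorm_nonneg)
    also have "\<dots> = L * ln (real n) ^ (2 * m)"
    proof -
      have "((2 * ln (real n)) ^ m)\<^sup>2 = ((2 * ln (real n))\<^sup>2) ^ m"
        by (simp only: power_mult[symmetric] mult.commute)
      also have "\<dots> = 4 ^ m * ln (real n) ^ (2 * m)"
        by (simp add: power_mult_distrib power_mult)
      finally show ?thesis by (simp add: L_def power_mult_distrib[of K])
    qed
    finally show ?thesis .
  qed
  have "regular_scale B (\<lambda>n. ln (real n) ^ Suc (2 * m)) L"
  proof
    show "\<forall>\<^sub>F n in sequentially. 0 < ln (real n) ^ Suc (2 * m)"
      using large by eventually_elim simp
    show "\<forall>\<^sub>F n in sequentially. \<forall>j\<in>{1..n}. (?U n j)\<^sup>2 \<le> L * ln (real n) ^ Suc (2 * m)"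
      using large
    proof eventually_elim
      case (elim n)
      show ?case
      proof
        fix j assume j: "j \<in> {1..n}"
        have "(?U n j)\<^sup>2 \<le> L * ln (real n) ^ (2 * m)" using bound[of j n] j elim by auto
        also have "\<dots> \<le> L * ln (real n) ^ Suc (2 * m)"
          using elim L by (intro mult_left_mono power_increasing) auto
        finally show "(?U n j)\<^sup>2 \<le> L * ln (real n) ^ Suc (2 * m)" .
      qed
    qed
    fix j :: nat assume j: "1 \<le> j"
    show "(\<lambda>n. (?U n j)\<^sup>2 / ln (real n) ^ Suc (2 * m)) \<longlonglongrightarrow> 0"
    proof (rule tendsto_sandwich[OF _ _ tendsto_const])
      show "\<forall>\<^sub>F n in sequentially. 0 \<le> (?U n j)\<^sup>2 / ln (real n) ^ Suc (2 * m)"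
        using large by eventually_elim simp
      show "\<forall>\<^sub>F n in sequentially. (?U n j)\<^sup>2 / ln (real n) ^ Suc (2 * m) \<le> L / ln (real n)"
        using large eventually_ge_at_top[of j]
      proof eventually_elim
        case (elim n)
        have "(?U n j)\<^sup>2 / ln (real n) ^ Suc (2 * m) \<le> L * ln (real n) ^ (2 * m) / ln (real n) ^ Suc (2 * m)"
          using bound[OF j elim(2,1)] elim by (intro divide_right_mono) auto
        also have "\<dots> = L / ln (real n)" using elim by simp
        finally show ?case .
      qed
      show "(\<lambda>n. L / ln (real n)) \<longlonglongrightarrow> 0"
        by (intro tendsto_divide_0[OF tendsto_const] filterlim_at_top_imp_at_infinity filterlim_ln_nat)
    qed
  next
    have l: "(\<lambda>n. ln (real n) ^ Suc (2 * m) / exp (ln (real n))) \<longlonglongrightarrow> 0"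
      by (rule filterlim_compose[OF tendsto_power_div_exp_0 filterlim_ln_nat])
    have ev: "\<forall>\<^sub>F n in sequentially. ln (real n) ^ Suc (2 * m) / exp (ln (real n)) = ln (real n) ^ Suc (2 * m) / real n"
      using eventually_gt_at_top[of 0] by eventually_elim simp
    show "(\<lambda>n. ln (real n) ^ Suc (2 * m) / real n) \<longlonglongrightarrow> 0"
      by (rule Lim_transform_eventually[OF l ev])
  qed
  then show ?thesis unfolding nu by blast
qed

text \<open>Entries of the integrand are sums of products of two exponential polynomials of degree
  \<open>\<nu> - 1\<close>, hence of degree \<open>2 * \<nu> - 2\<close>, and
  \<open>exp_poly_mean_tendsto\<close> then normalises by exactly the power
  \<open>2 * \<nu> - 1\<close>. Convergence comes first, because only then does \<open>lim\<close>
  denote the limit.\<close>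

lemma Sigma3_limit:
  fixes B :: "real ^ 'v::finite ^ 'v"
  assumes "max_Re_eigenvalue B = 1/2"
  shows "convergent (Sigma3_seq B (max_jordan_part B))" "Sigma3_seq B (max_jordan_part B) \<longlonglongrightarrow> Sigma3 B (max_jordan_part B)"
proof -
  define m where "m = max_jordan_part B - 1"
  have nu: "2 * max_jordan_part B - 1 = Suc (2 * m)"
    using max_jordan_part_pos[of B] by (simp add: m_def)
  let ?U = "\<lambda>t. mexp (t *\<^sub>R (B - (1/2) *\<^sub>R mat 1))"
  have "\<exists>l. (\<lambda>n. Sigma3_seq B (max_jordan_part B) n $ i $ j) \<longlonglongrightarrow> l" for i j
  proof -
    have "exp_poly (m + m) (\<lambda>t. \<Sum>k\<in>UNIV. complex_of_real (?U t $ k $ i) * complex_of_real (?U t $ k $ j))"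
      unfolding m_def by (intro exp_poly_sum exp_poly_mult mexp_exp_poly_critical[OF assms]) simp
    moreover have "(\<Sum>k\<in>UNIV. complex_of_real (?U t $ k $ i) * complex_of_real (?U t $ k $ j)) = of_real (cov_integrand B t $ i $ j)" for t
      by (simp add: cov_integrand_eq mm_entry transpose_def)
    ultimately have "exp_poly (2 * m) (\<lambda>t. of_real (cov_integrand B t $ i $ j))" by (simp add: mult_2)
    from exp_poly_mean_tendsto[OF this] obtain l where
      l: "((\<lambda>L. (1 / L ^ Suc (2 * m)) *\<^sub>R integral {0..L} (\<lambda>t. complex_of_real (cov_integrand B t $ i $ j))) \<longlongrightarrow> l) at_top"
      by blast
    have lim: "(\<lambda>n. Re ((1 / ln (real n) ^ Suc (2 * m)) *\<^sub>R integral {0..ln (real n)} (\<lambda>t. complex_of_real (cov_integrand B t $ i $ j)))) \<longlonglongrightarrow> Re l"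
      by (intro tendsto_Re filterlim_compose[OF l filterlim_ln_nat])
    have entry: "Re ((1 / L ^ Suc (2 * m)) *\<^sub>R integral {0..L} (\<lambda>t. complex_of_real (cov_integrand B t $ i $ j)))
        = ((1 / L ^ Suc (2 * m)) *\<^sub>R (LINT t:{0..L}|lborel. cov_integrand B t)) $ i $ j" for L
    proof -
      have "complex_of_real ((LINT t:{0..L}|lborel. cov_integrand B t) $ i $ j)
          = integral {0..L} (\<lambda>t. complex_of_real (cov_integrand B t $ i $ j))"
        by (rule cov_integral_linear[OF bounded_linear_compose[OF bounded_linear_of_real bounded_linear_entry]])
      then have "Re (integral {0..L} (\<lambda>t. complex_of_real (cov_integrand B t $ i $ j)))
          = (LINT t:{0..L}|lborel. cov_integrand B t) $ i $ j"
        by (metis Re_complex_of_real)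
      then show ?thesis by simp
    qed
    show ?thesis using lim unfolding entry Sigma3_seq_def nu by blast
  qed
  then obtain l where l: "\<And>i j. (\<lambda>n. Sigma3_seq B (max_jordan_part B) n $ i $ j) \<longlonglongrightarrow> l i j" by metis
  have "Sigma3_seq B (max_jordan_part B) \<longlonglongrightarrow> (\<chi> i j. l i j)"
    using l by (intro vec_tendstoI) simp
  then show c: "convergent (Sigma3_seq B (max_jordan_part B))" unfolding convergent_def by blast
  then show "Sigma3_seq B (max_jordan_part B) \<longlonglongrightarrow> Sigma3 B (max_jordan_part B)"
    unfolding Sigma3_def by (simp add: convergent_LIMSEQ_iff)
qed

text \<open>Integrability and convergence are part of the conclusion so that \<open>Sigma1\<close>
  and \<open>Sigma3\<close>, built with total operators, denote an actual integral and an actual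
  limit.\<close>

theorem theorem12:
  fixes M :: "'a measure"
    and E :: "('v::finite \<times> 'v) set"
    and p q :: "'v \<Rightarrow> real"
    and \<sigma> :: "'v \<Rightarrow> 'a \<Rightarrow> int"
    and \<xi> :: "nat \<Rightarrow> 'v \<Rightarrow> 'a \<Rightarrow> int"
    and D :: "nat \<Rightarrow> 'v \<Rightarrow> 'a \<Rightarrow> nat"
    and u :: "nat \<Rightarrow> 'v \<Rightarrow> 'a \<Rightarrow> 'v"
    and S :: "nat \<Rightarrow> 'a \<Rightarrow> real ^ 'v"
    and B :: "real ^ 'v ^ 'v"
    and \<eta> :: real
    and \<nu> :: nat
  assumes "erwg M E p q \<sigma> \<xi> D u"
    and "S = erwg_walk \<sigma> \<xi> D u"
    and "B = memory_matrix E p"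
    and "\<eta> = max_Re_eigenvalue B"
    and "\<nu> = max_jordan_part B"
  shows "(\<eta> < 1/2 \<longrightarrow>
            set_integrable lborel {0..} (cov_integrand B) \<and>
            (\<exists>\<mu>. centered_normal (Sigma1 B) \<mu> \<and>
                 converges_in_distr M (\<lambda>n \<omega>. (1 / sqrt (real n)) *\<^sub>R S n \<omega>) \<mu>)) \<and>
         (\<eta> = 1/2 \<longrightarrow>
            convergent (Sigma3_seq B \<nu>) \<and>
            (\<exists>\<mu>. centered_normal (Sigma3 B \<nu>) \<mu> \<and>
                 converges_in_distr M
                   (\<lambda>n \<omega>. (1 / (sqrt (real n) * ln (real n) powr (real \<nu> - 1/2))) *\<^sub>R S n \<omega>) \<mu>))"
proof (intro conjI impI)
  assume sub: "\<eta> < 1/2"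
  show "set_integrable lborel {0..} (cov_integrand B)"
    using set_integrable_cov_integrand sub assms(4) by simp
  obtain K where "regular_scale B (\<lambda>n. 1) K"
    using regular_scale_subcritical sub assms(4) by blast
  then interpret erwg_scaled M E p q \<sigma> \<xi> D u "\<lambda>n. 1" K "\<lambda>n. 1 / sqrt (real n)" "Sigma1 B"
    using assms(1) Sigma1_limit[of B] sub assms(3,4)
    by (simp add: erwg_scaled_def erwg_scaled_axioms_def)
  show "\<exists>\<mu>. centered_normal (Sigma1 B) \<mu> \<and> converges_in_distr M (\<lambda>n \<omega>. (1 / sqrt (real n)) *\<^sub>R S n \<omega>) \<mu>"
    using walk_clt by (simp only: assms(2))
next
  assume crit: "\<eta> = 1/2"
  then have B: "max_Re_eigenvalue B = 1/2" using assms(4) by simp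
  show "convergent (Sigma3_seq B \<nu>)" using Sigma3_limit(1)[OF B] assms(5) by simp
  let ?w = "\<lambda>n. ln (real n) ^ (2 * \<nu> - 1)" and ?c = "\<lambda>n. 1 / (sqrt (real n) * ln (real n) powr (real \<nu> - 1/2))"
  have nu: "\<nu> \<ge> 1" using max_jordan_part_pos assms(5) by simp
  obtain K where "regular_scale B ?w K"
    using regular_scale_critical[OF B] assms(5) by blast
  moreover have "\<forall>\<^sub>F n in sequentially. ?c n = 1 / sqrt (n * ?w n)"
  proof -
    have "\<forall>\<^sub>F n in sequentially. ln (real n) \<ge> 1"
      using filterlim_ln_nat unfolding filterlim_at_top by blast
    then show ?thesis
    proof eventually_elim
      case (elim n)
      \<comment> \<open>The square root halves the exponent \<open>2 * \<nu> - 1\<close>; passing to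
        \<open>powr\<close> uses that \<open>ln n\<close> is positive, hence the restriction to
        large \<open>n\<close>.\<close>
      have "sqrt (?w n) = (ln (real n) powr real (2 * \<nu> - 1)) powr (1/2)"
        using elim by (simp add: powr_realpow powr_half_sqrt)
      also have "\<dots> = ln (real n) powr (real \<nu> - 1/2)"
        using nu by (simp add: powr_powr of_nat_diff diff_divide_distrib)
      finally show ?case by (simp add: real_sqrt_mult)
    qed
  qed
  moreover have "(\<lambda>n. (1 / ?w n) *\<^sub>R (LINT t:{0..ln (real n)}|lborel. cov_integrand B t)) \<longlonglongrightarrow> Sigma3 B \<nu>"
    using Sigma3_limit(2)[OF B] unfolding assms(5)[symmetric] Sigma3_seq_def[abs_def] .
  ultimately interpret erwg_scaled M E p q \<sigma> \<xi> D u ?w K ?c "Sigma3 B \<nu>"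
    using assms(1,3) by (simp add: erwg_scaled_def erwg_scaled_axioms_def)
  show "\<exists>\<mu>. centered_normal (Sigma3 B \<nu>) \<mu> \<and> converges_in_distr M (\<lambda>n \<omega>. ?c n *\<^sub>R S n \<omega>) \<mu>"
    using walk_clt by (simp only: assms(2))
qed

end
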